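(* Let $N$, $M(x,\nabla_x)$, $V,\tilde V$, $d,\tilde d$ satisfy all the standing assumptions (A1)--(A9) listed in the context, let $\alpha\ge0$ be the exponent in (A3), let $p\in\left(1,1+\frac1{2\alpha}\right)$, and let $u\in\mathcal W$ be a non-trivial weak solution (in the sense defined in the context) of $$V(x)\,\partial_t^2u+d(t)\,M(x,\nabla_x)u=\tilde V(x)\tilde d(t)|u|^{p-1}u\quad\text{on }\mathbb R^N\times\mathbb R$$ with $u\in L^q_{Vd}(\mathbb R^N\times\mathbb R)$ for all $q\in\left[2,2+\frac1\alpha\right)$. (a) If $N=1$, $V=1$ and $M=\left(-\frac{d^2}{dx^2}+x^2\right)^2$, then $\partial_tu,\ xu,\ x^2u,\ \partial_xu,\ x\partial_xu,\ \partial_x^2u\in L^2(\mathbb R\times\mathbb R)$. (b) If $N\ge2$ is even, $V(x)=\frac1{(|x|^2+1)^2}$ and $M=-\Delta+V(x)$, then $\partial_tu\in L^2_V(\mathbb R^N\times\mathbb R)$ and $\nabla_xu\in L^2_d(\mathbb R^N\times\mathbb R)$.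
   Context: Notation. $\mathbb N=\{1,2,\dots\}$; all functions are real-valued; for $\alpha=0$ one reads $\frac1\alpha=\frac1{2\alpha}=\infty$. $L^q_V(\mathbb R^N)=L^q(\mathbb R^N,V(x)\,dx)$, $L^q_d(\mathbb R)=L^q(\mathbb R,d(t)\,dt)$, $L^q_V(\mathbb R^N\times\mathbb R)=L^q(\mathbb R^N\times\mathbb R,V(x)\,d(x,t))$, $L^q_d(\mathbb R^N\times\mathbb R)=L^q(\mathbb R^N\times\mathbb R,d(t)\,d(x,t))$ and $L^q_{Vd}(\mathbb R^N\times\mathbb R)=L^q(\mathbb R^N\times\mathbb R,V(x)d(t)\,d(x,t))$, where $d(x,t)$ denotes Lebesgue measure. $a\lesssim b$ means $a\le cb$ for some constant $c>0$. Standing assumptions ($V,\tilde V,d,\tilde d$ are measurable and non-negative, $M$ is elliptic): (A1) $\frac1{V(x)}M(x,\nabla_x)$ is a self-adjoint operator on $L^2_V(\mathbb R^N)$ with distinct eigenvalues $0\le\nu_1<\nu_2<\nu_3<\dots$; $d_n$ denotes the (finite) dimension of the eigenspace of $\nu_n$, and the associated eigenfunctions $(\varphi_{n,l})_{n\in\mathbb N,1\le l\le d_n}$ form a complete orthonormal system of $L^2_V(\mathbb R^N)$. (A2) There is $K\in\mathbb N$ with $\#\{n:\sqrt{\nu_n}\in B\}\le K$ for every interval $B$ of length $1$. (A3) There are $\alpha\ge0$ and $c>0$ with $d_n\|\varphi_{n,l}\|_\infty^2\le c\,\nu_n^\alpha$ for all $n\in\mathbb N$, $1\le l\le d_n$.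 (A4) $d,\tilde d\in L^\infty(\mathbb R)$, $\operatorname{ess\,inf}_{\mathbb R}d>0$, $\tilde d>0$ almost everywhere, and $d$ has locally bounded variation. (A5) There are $T^\pm>0$, $R^\pm\in\mathbb R$ and $T^\pm$-periodic functions $d^\pm_{\rm per}\in L^\infty(\mathbb R)$ with $d(t)=d^+_{\rm per}(t)$ for $t>R^+$ and $d(t)=d^-_{\rm per}(t)$ for $t<R^-$. (A6) There is $r>\frac12$ such that the point spectrum of $-\frac1{d(t)}\frac{d^2}{dt^2}:H^2(\mathbb R)\subset L^2_d(\mathbb R)\to L^2_d(\mathbb R)$ satisfies $\sum_{\lambda\in\sigma_p(-\frac1{d}\frac{d^2}{dt^2})}\lambda^{-r}<\infty$. (A7) $\inf\{|\sqrt\lambda-\sqrt{\nu_n}|:n\in\mathbb N,\ \lambda\in\sigma(-\frac1{d(t)}\frac{d^2}{dt^2})\}>0$. (A8) $V,\tilde V\in L^\infty(\mathbb R^N)$, $\operatorname{ess\,inf}_{B_R(0)}V>0$ for all $R>0$, and $V\lesssim\tilde V\lesssim V$. (A9) One of the following holds: (a) $\lim_{|t|\to\infty}\tilde d(t)=0$; or (b) $d=d_{\rm per}$ is $T$-periodic on $\mathbb R$ and $\tilde d=\tilde d_{\rm per}+\tilde d_{\rm loc}$, where $\tilde d_{\rm per}$ is $T$-periodic, $\tilde d_{\rm loc}\ge0$ and $\lim_{|t|\to\infty}\tilde d_{\rm loc}(t)=0$. Weak solutions. Let $\sqrt{\tfrac1VM}$ be the square root of the self-adjoint operator in (A1), acting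 in the $x$-variable (for a.e. $t$). Put $$\mathcal W=\Big\{u\in L^{p+1}_{Vd}(\mathbb R^N\times\mathbb R):\ \partial_tu\in L^2_V(\mathbb R^N\times\mathbb R),\ \sqrt{\tfrac1VM}\,u\in L^2_{Vd}(\mathbb R^N\times\mathbb R)\Big\}.$$ A function $u\in\mathcal W$ is a weak solution if for all $h\in\mathcal W$ $$\int_{\mathbb R^N\times\mathbb R}-(\partial_tu)(\partial_th)V(x)+\Big(\sqrt{\tfrac1VM}\,u\Big)\Big(\sqrt{\tfrac1VM}\,h\Big)V(x)d(t)\,d(x,t)=\int_{\mathbb R^N\times\mathbb R}|u|^{p-1}u\,h\,\tilde V(x)\tilde d(t)\,d(x,t).$$ The two operators. In (a) the self-adjoint operator $\frac1VM$ is the square of the quantum harmonic oscillator $-\frac{d^2}{dx^2}+x^2$ on $L^2(\mathbb R)$; its eigenvalues are $\nu_n=(2n+1)^2$, $n\in\mathbb N\cup\{0\}$ (indexed from $0$), with the Hermite functions as eigenfunctions, so $\sqrt{\frac1VM}=-\frac{d^2}{dx^2}+x^2$. In (b) the self-adjoint operator $\frac1VM$ on $L^2_V(\mathbb R^N)$ is the one with eigenvalues $\nu_n=(2n+N-1)^2$, $n\in\mathbb N\cup\{0\}$ (indexed from $0$), and eigenfunctions (up to normalization) $\varphi_{n,l}(x)=\left(\frac2{|x|^2+1}\right)^{\frac{N-2}2}\mathcal Y_{n,l}(\Pi^{-1}(x))$, where $\mathcal Y_{n,l}$ runs through an orthonormal basis of spherical harmonics of degree $n$ on $\mathbb S^N\subset\mathbb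 R^{N+1}$ and $\Pi^{-1}(x)=\left(\frac{2x}{|x|^2+1},\frac{|x|^2-1}{|x|^2+1}\right)$ is inverse stereographic projection. *)

theory Defs
  imports "HOL-Analysis.Analysis" "HOL-Probability.Essential_Supremum"
begin

section \<open>Weighted Lebesgue spaces\<close>

text \<open>All functions are real-valued. Elements of the Lebesgue spaces are represented by
  Lebesgue measurable functions, and equality of elements is equality almost everywhere.\<close>

definition weighted :: "('a::euclidean_space \<Rightarrow> real) \<Rightarrow> 'a measure" where
  "weighted w = density lebesgue (\<lambda>x. ennreal (w x))"

definition Lq :: "real \<Rightarrow> 'a measure \<Rightarrow> ('a \<Rightarrow> real) set" where
  "Lq q \<mu> = {f \<in> borel_measurable \<mu>. integrable \<mu> (\<lambda>x. \<bar>f x\<bar> powr q)}"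

definition Linf :: "('a::euclidean_space \<Rightarrow> real) set" where
  "Linf = {f \<in> borel_measurable lebesgue. \<exists>C. AE x in lebesgue. \<bar>f x\<bar> \<le> C}"

definition Linf_norm :: "('a::euclidean_space \<Rightarrow> real) \<Rightarrow> ereal" where
  "Linf_norm f = esssup lebesgue (\<lambda>x. ereal \<bar>f x\<bar>)"

definition L2_inner :: "'a measure \<Rightarrow> ('a \<Rightarrow> real) \<Rightarrow> ('a \<Rightarrow> real) \<Rightarrow> real" where
  "L2_inner \<mu> f g = (LINT x|\<mu>. f x * g x)"

definition L2_norm :: "'a measure \<Rightarrow> ('a \<Rightarrow> real) \<Rightarrow> real" where
  "L2_norm \<mu> f = sqrt (L2_inner \<mu> f f)"


section \<open>Test functions and weak derivatives\<close>

definition pd :: "'a::euclidean_space \<Rightarrow> ('a \<Rightarrow> real) \<Rightarrow> 'a \<Rightarrow> real" where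
  "pd v f x = frechet_derivative f (at x) v"

primrec C_k :: "nat \<Rightarrow> ('a::euclidean_space \<Rightarrow> real) \<Rightarrow> bool" where
  "C_k 0 f \<longleftrightarrow> continuous_on UNIV f"
| "C_k (Suc k) f \<longleftrightarrow> (\<forall>x. f differentiable (at x)) \<and> (\<forall>b\<in>Basis. C_k k (pd b f))"

definition test_fun :: "('a::euclidean_space \<Rightarrow> real) set" where
  "test_fun = {\<psi>. (\<forall>k. C_k k \<psi>) \<and> compact (closure {x. \<psi> x \<noteq> 0})}"

definition locally_integrable :: "('a::euclidean_space \<Rightarrow> real) \<Rightarrow> bool" where
  "locally_integrable f \<longleftrightarrow> (\<forall>K. compact K \<longrightarrow> f absolutely_integrable_on K)"

definition has_weak_deriv ::
    "'a::euclidean_space \<Rightarrow> ('a \<Rightarrow> real) \<Rightarrow> ('a \<Rightarrow> real) \<Rightarrow> bool" where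
  "has_weak_deriv v u w \<longleftrightarrow> locally_integrable u \<and> locally_integrable w \<and>
     (\<forall>\<psi>\<in>test_fun. (LINT x|lebesgue. u x * pd v \<psi> x) = - (LINT x|lebesgue. w x * \<psi> x))"

definition laplacian :: "('a::euclidean_space \<Rightarrow> real) \<Rightarrow> 'a \<Rightarrow> real" where
  "laplacian f x = (\<Sum>b\<in>Basis. pd b (pd b f) x)"


section \<open>Unbounded operators on a real Lebesgue space\<close>

text \<open>An operator on $L^2(\mu)$ is given by its graph, a set of pairs of square integrable
  functions.\<close>

type_synonym 'a operator = "(('a \<Rightarrow> real) \<times> ('a \<Rightarrow> real)) set"

definition densely_defined :: "'a measure \<Rightarrow> 'a operator \<Rightarrow> bool" where
  "densely_defined \<mu> T \<longleftrightarrow> T \<subseteq> Lq 2 \<mu> \<times> Lq 2 \<mu> \<and>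
     (\<forall>f\<in>Lq 2 \<mu>. \<forall>e>0. \<exists>(g, h)\<in>T. L2_norm \<mu> (\<lambda>x. f x - g x) < e)"

definition adjoint_op :: "'a measure \<Rightarrow> 'a operator \<Rightarrow> 'a operator" where
  "adjoint_op \<mu> T = {(g, k). g \<in> Lq 2 \<mu> \<and> k \<in> Lq 2 \<mu> \<and>
     (\<forall>(f, h)\<in>T. L2_inner \<mu> h g = L2_inner \<mu> f k)}"

text \<open>Linearity of the graph, single-valuedness up to null sets and invariance under change of
  representatives need not be required separately: any $T$ with dense domain and $T = T^*$ has
  these properties.\<close>

definition self_adjoint :: "'a measure \<Rightarrow> 'a operator \<Rightarrow> bool" where
  "self_adjoint \<mu> T \<longleftrightarrow> densely_defined \<mu> T \<and> adjoint_op \<mu> T = T"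

definition eigenspace :: "'a measure \<Rightarrow> 'a operator \<Rightarrow> real \<Rightarrow> ('a \<Rightarrow> real) set" where
  "eigenspace \<mu> T \<kappa> = {f \<in> Lq 2 \<mu>. (f, \<lambda>x. \<kappa> * f x) \<in> T}"

definition point_spectrum :: "'a measure \<Rightarrow> 'a operator \<Rightarrow> real set" where
  "point_spectrum \<mu> T = {\<kappa>. \<exists>f\<in>eigenspace \<mu> T \<kappa>. \<not> (AE x in \<mu>. f x = 0)}"

text \<open>$\kappa$ is in the resolvent set if $T - \kappa$ is a bijection from its domain onto
  $L^2(\mu)$ with bounded inverse. Only real $\kappa$ are considered; this
  loses nothing for self-adjoint operators.\<close>

definition resolvent_set :: "'a measure \<Rightarrow> 'a operator \<Rightarrow> real set" where
  "resolvent_set \<mu> T = {\<kappa>. (\<forall>f\<in>eigenspace \<mu> T \<kappa>. AE x in \<mu>. f x = 0) \<and>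
     (\<exists>C. \<forall>g\<in>Lq 2 \<mu>. \<exists>f. (f, \<lambda>x. \<kappa> * f x + g x) \<in> T \<and> L2_norm \<mu> f \<le> C * L2_norm \<mu> g)}"

definition spectrum_op :: "'a measure \<Rightarrow> 'a operator \<Rightarrow> real set" where
  "spectrum_op \<mu> T = - resolvent_set \<mu> T"

text \<open>The square root of a non-negative self-adjoint operator is its unique non-negative
  self-adjoint square root. Composition of graphs is relational composition, so the domain of
  the product is the natural one.\<close>

definition is_sqrt_op :: "'a measure \<Rightarrow> 'a operator \<Rightarrow> 'a operator \<Rightarrow> bool" where
  "is_sqrt_op \<mu> A B \<longleftrightarrow> self_adjoint \<mu> B \<and> (\<forall>(f, g)\<in>B. 0 \<le> L2_inner \<mu> g f) \<and> B O B = A"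


section \<open>Standing assumptions\<close>

text \<open>The operator $-\frac{1}{d(t)}\frac{d^2}{dt^2}$ with domain $H^2(\mathbb{R})$ on
  $L^2_d(\mathbb{R})$.\<close>

definition time_operator :: "(real \<Rightarrow> real) \<Rightarrow> real operator" where
  "time_operator d = {(f, g). g \<in> Lq 2 (weighted d) \<and>
     (\<exists>f1 f2. f \<in> Lq 2 lebesgue \<and> f1 \<in> Lq 2 lebesgue \<and> f2 \<in> Lq 2 lebesgue \<and>
        has_weak_deriv 1 f f1 \<and> has_weak_deriv 1 f1 f2 \<and>
        (AE t in lebesgue. g t = - f2 t / d t))}"

definition locally_bounded_variation :: "(real \<Rightarrow> real) \<Rightarrow> bool" where
  "locally_bounded_variation f \<longleftrightarrow>
     (\<forall>a b. \<exists>C. \<forall>s m. incseq s \<and> range s \<subseteq> {a..b} \<longrightarrow> (\<Sum>i<m. \<bar>f (s (Suc i)) - f (s i)\<bar>) \<le> C)"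

definition periodic :: "real \<Rightarrow> (real \<Rightarrow> real) \<Rightarrow> bool" where
  "periodic T f \<longleftrightarrow> T > 0 \<and> (\<forall>t. f (t + T) = f t)"

text \<open>The eigenvalues, eigenfunctions and multiplicities are indexed from 0 instead of 1:
  \<open>\<nu> n\<close> is $\nu_{n+1}$, \<open>D n\<close> is $d_{n+1}$, and \<open>\<phi> n l\<close> with \<open>l < D n\<close> is
  $\varphi_{n+1,l+1}$.

  \<open>M\<close> is the (formally symmetric) differential expression, acting on test functions.
  That the self-adjoint operator \<open>A\<close> is a realization of $\frac1V M$ means that it acts as
  $\frac1V M$ on test functions.
  For self-adjoint \<open>A\<close> this is equivalent to \<open>A f = g\<close> implying $Mf = Vg$ as distributions.

  The last conjunct together with orthonormality says that \<open>D n\<close> is the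
  dimension of the eigenspace.\<close>

definition A1 :: "(('a::euclidean_space \<Rightarrow> real) \<Rightarrow> 'a \<Rightarrow> real) \<Rightarrow> ('a \<Rightarrow> real) \<Rightarrow> 'a operator \<Rightarrow>
    (nat \<Rightarrow> real) \<Rightarrow> (nat \<Rightarrow> nat) \<Rightarrow> (nat \<Rightarrow> nat \<Rightarrow> 'a \<Rightarrow> real) \<Rightarrow> bool" where
  "A1 M V A \<nu> D \<phi> \<longleftrightarrow>
     self_adjoint (weighted V) A \<and>
     (\<forall>\<psi>\<in>test_fun. (\<psi>, \<lambda>x. M \<psi> x / V x) \<in> A) \<and>
     0 \<le> \<nu> 0 \<and> strict_mono \<nu> \<and> point_spectrum (weighted V) A = range \<nu> \<and>
     (\<forall>n. \<forall>l<D n. \<phi> n l \<in> eigenspace (weighted V) A (\<nu> n)) \<and>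
     (\<forall>n m. \<forall>l<D n. \<forall>k<D m. L2_inner (weighted V) (\<phi> n l) (\<phi> m k) = of_bool (n = m \<and> l = k)) \<and>
     (\<forall>f\<in>Lq 2 (weighted V). (\<forall>n. \<forall>l<D n. L2_inner (weighted V) f (\<phi> n l) = 0) \<longrightarrow>
        (AE x in weighted V. f x = 0)) \<and>
     (\<forall>n. \<forall>f\<in>eigenspace (weighted V) A (\<nu> n).
        \<exists>c. AE x in weighted V. f x = (\<Sum>l<D n. c l * \<phi> n l x))"

definition A2 :: "(nat \<Rightarrow> real) \<Rightarrow> bool" where
  "A2 \<nu> \<longleftrightarrow> (\<exists>K::nat. \<forall>B::real set. is_interval B \<and> emeasure lborel B = 1 \<longrightarrow>
     finite {n. sqrt (\<nu> n) \<in> B} \<and> card {n. sqrt (\<nu> n) \<in> B} \<le> K)"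

text \<open>The case distinction is needed because \<open>0 powr 0 = 0\<close> in the library.\<close>

definition A3 :: "(nat \<Rightarrow> real) \<Rightarrow> (nat \<Rightarrow> nat) \<Rightarrow> (nat \<Rightarrow> nat \<Rightarrow> 'a::euclidean_space \<Rightarrow> real) \<Rightarrow>
    real \<Rightarrow> bool" where
  "A3 \<nu> D \<phi> \<alpha> \<longleftrightarrow> \<alpha> \<ge> 0 \<and> (\<exists>c>0. \<forall>n. \<forall>l<D n.
     ereal (real (D n)) * (Linf_norm (\<phi> n l))\<^sup>2 \<le> ereal (c * (if \<alpha> = 0 then 1 else \<nu> n powr \<alpha>)))"

definition A4 :: "(real \<Rightarrow> real) \<Rightarrow> (real \<Rightarrow> real) \<Rightarrow> bool" where
  "A4 d dt \<longleftrightarrow> d \<in> Linf \<and> dt \<in> Linf \<and> (\<exists>\<delta>>0. AE t in lebesgue. \<delta> \<le> d t) \<and>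
     (AE t in lebesgue. 0 < dt t) \<and> locally_bounded_variation d"

definition A5 :: "(real \<Rightarrow> real) \<Rightarrow> bool" where
  "A5 d \<longleftrightarrow>
     (\<exists>T R dper. periodic T dper \<and> dper \<in> Linf \<and> (\<forall>t>R. d t = dper t)) \<and>
     (\<exists>T R dper. periodic T dper \<and> dper \<in> Linf \<and> (\<forall>t<R. d t = dper t))"

definition A6 :: "(real \<Rightarrow> real) \<Rightarrow> bool" where
  "A6 d \<longleftrightarrow> (\<exists>r>1/2. (\<lambda>\<kappa>. \<kappa> powr (- r)) summable_on point_spectrum (weighted d) (time_operator d))"

definition A7 :: "(real \<Rightarrow> real) \<Rightarrow> (nat \<Rightarrow> real) \<Rightarrow> bool" where
  "A7 d \<nu> \<longleftrightarrow> (\<exists>\<delta>>0. \<forall>n. \<forall>\<kappa>\<in>spectrum_op (weighted d) (time_operator d).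
     \<delta> \<le> \<bar>sqrt \<kappa> - sqrt (\<nu> n)\<bar>)"

definition A8 :: "('a::euclidean_space \<Rightarrow> real) \<Rightarrow> ('a \<Rightarrow> real) \<Rightarrow> bool" where
  "A8 V Vt \<longleftrightarrow> V \<in> Linf \<and> Vt \<in> Linf \<and>
     (\<forall>R>0. \<exists>\<delta>>0. AE x in lebesgue. x \<in> ball 0 R \<longrightarrow> \<delta> \<le> V x) \<and>
     (\<exists>c>0. AE x in lebesgue. V x \<le> c * Vt x) \<and>
     (\<exists>c>0. AE x in lebesgue. Vt x \<le> c * V x)"

definition A9 :: "(real \<Rightarrow> real) \<Rightarrow> (real \<Rightarrow> real) \<Rightarrow> bool" where
  "A9 d dt \<longleftrightarrow> (dt \<longlongrightarrow> 0) at_infinity \<or>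
     (\<exists>T dtper dtloc. periodic T d \<and> periodic T dtper \<and> (\<forall>t. dt t = dtper t + dtloc t) \<and>
        (\<forall>t. 0 \<le> dtloc t) \<and> (dtloc \<longlongrightarrow> 0) at_infinity)"

definition standing_assumptions ::
    "(('a::euclidean_space \<Rightarrow> real) \<Rightarrow> 'a \<Rightarrow> real) \<Rightarrow> ('a \<Rightarrow> real) \<Rightarrow> ('a \<Rightarrow> real) \<Rightarrow>
     (real \<Rightarrow> real) \<Rightarrow> (real \<Rightarrow> real) \<Rightarrow> 'a operator \<Rightarrow>
     (nat \<Rightarrow> real) \<Rightarrow> (nat \<Rightarrow> nat) \<Rightarrow> (nat \<Rightarrow> nat \<Rightarrow> 'a \<Rightarrow> real) \<Rightarrow> real \<Rightarrow> bool" where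
  "standing_assumptions M V Vt d dt A \<nu> D \<phi> \<alpha> \<longleftrightarrow>
     V \<in> borel_measurable lebesgue \<and> Vt \<in> borel_measurable lebesgue \<and>
     d \<in> borel_measurable lebesgue \<and> dt \<in> borel_measurable lebesgue \<and>
     (\<forall>x. 0 \<le> V x) \<and> (\<forall>x. 0 \<le> Vt x) \<and> (\<forall>t. 0 \<le> d t) \<and> (\<forall>t. 0 \<le> dt t) \<and>
     A1 M V A \<nu> D \<phi> \<and> A2 \<nu> \<and> A3 \<nu> D \<phi> \<alpha> \<and> A4 d dt \<and> A5 d \<and> A6 d \<and> A7 d \<nu> \<and>
     A8 V Vt \<and> A9 d dt"


section \<open>Weak solutions\<close>

text \<open>Points of $\mathbb{R}^N \times \mathbb{R}$ are pairs $(x, t)$. The following three weights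
  give the measures $V(x)\,d(x,t)$, $d(t)\,d(x,t)$ and $V(x)d(t)\,d(x,t)$.\<close>

definition mV :: "('a::euclidean_space \<Rightarrow> real) \<Rightarrow> ('a \<times> real) measure" where
  "mV V = weighted (\<lambda>(x, t). V x)"

definition md :: "(real \<Rightarrow> real) \<Rightarrow> ('a::euclidean_space \<times> real) measure" where
  "md d = weighted (\<lambda>(x, t). d t)"

definition mVd :: "('a::euclidean_space \<Rightarrow> real) \<Rightarrow> (real \<Rightarrow> real) \<Rightarrow> ('a \<times> real) measure" where
  "mVd V d = weighted (\<lambda>(x, t). V x * d t)"

text \<open>\<open>W_data p V d B u ut Bu\<close> says that \<open>u\<close> belongs to the space $\mathcal W$ and that \<open>ut\<close> and
  \<open>Bu\<close> are (representatives of) $\partial_t u$ and of \<open>B\<close>, here the square root of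
  $\frac1V M$, applied to \<open>u\<close> in the \<open>x\<close>-variable.\<close>

definition W_data :: "real \<Rightarrow> ('a::euclidean_space \<Rightarrow> real) \<Rightarrow> (real \<Rightarrow> real) \<Rightarrow> 'a operator \<Rightarrow>
    ('a \<times> real \<Rightarrow> real) \<Rightarrow> ('a \<times> real \<Rightarrow> real) \<Rightarrow> ('a \<times> real \<Rightarrow> real) \<Rightarrow> bool" where
  "W_data p V d B u ut Bu \<longleftrightarrow>
     u \<in> Lq (p + 1) (mVd V d) \<and>
     has_weak_deriv (0, 1) u ut \<and> ut \<in> Lq 2 (mV V) \<and>
     (AE t in lebesgue. (\<lambda>x. u (x, t), \<lambda>x. Bu (x, t)) \<in> B) \<and> Bu \<in> Lq 2 (mVd V d)"

definition W_space :: "real \<Rightarrow> ('a::euclidean_space \<Rightarrow> real) \<Rightarrow> (real \<Rightarrow> real) \<Rightarrow> 'a operator \<Rightarrow>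
    ('a \<times> real \<Rightarrow> real) set" where
  "W_space p V d B = {u. \<exists>ut Bu. W_data p V d B u ut Bu}"

definition weak_solution :: "real \<Rightarrow> ('a::euclidean_space \<Rightarrow> real) \<Rightarrow> ('a \<Rightarrow> real) \<Rightarrow>
    (real \<Rightarrow> real) \<Rightarrow> (real \<Rightarrow> real) \<Rightarrow> 'a operator \<Rightarrow> ('a \<times> real \<Rightarrow> real) \<Rightarrow> bool" where
  "weak_solution p V Vt d dt B u \<longleftrightarrow> u \<in> W_space p V d B \<and>
     (\<forall>ut Bu h ht Bh. W_data p V d B u ut Bu \<and> W_data p V d B h ht Bh \<longrightarrow>
        (LINT (x, t)|lebesgue. - ut (x, t) * ht (x, t) * V x + Bu (x, t) * Bh (x, t) * V x * d t)
        = (LINT (x, t)|lebesgue.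
             \<bar>u (x, t)\<bar> powr (p - 1) * u (x, t) * h (x, t) * Vt x * dt t))"

text \<open>The hypotheses on the exponent and on the solution: $1 < p < 1 + \frac{1}{2\alpha}$ and
  $u \in L^q_{Vd}$ for $2 \le q < 2 + \frac1\alpha$, where the upper bounds are void for
  $\alpha = 0$ (in the library \<open>1 / 0 = 0\<close>).\<close>

definition admissible_solution :: "real \<Rightarrow> real \<Rightarrow> ('a::euclidean_space \<Rightarrow> real) \<Rightarrow> ('a \<Rightarrow> real) \<Rightarrow>
    (real \<Rightarrow> real) \<Rightarrow> (real \<Rightarrow> real) \<Rightarrow> 'a operator \<Rightarrow> ('a \<times> real \<Rightarrow> real) \<Rightarrow> bool" where
  "admissible_solution \<alpha> p V Vt d dt B u \<longleftrightarrow>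
     1 < p \<and> (\<alpha> > 0 \<longrightarrow> p < 1 + 1 / (2 * \<alpha>)) \<and>
     weak_solution p V Vt d dt B u \<and> \<not> (AE z in lebesgue. u z = 0) \<and>
     (\<forall>q\<ge>2. (\<alpha> > 0 \<longrightarrow> q < 2 + 1 / \<alpha>) \<longrightarrow> u \<in> Lq q (mVd V d))"


section \<open>The two operators\<close>

definition harmonic_expr :: "(real \<Rightarrow> real) \<Rightarrow> real \<Rightarrow> real" where
  "harmonic_expr \<psi> x = - pd 1 (pd 1 \<psi>) x + x\<^sup>2 * \<psi> x"

text \<open>The quantum harmonic oscillator on $L^2(\mathbb{R})$ with its maximal (distributional)
  domain. Since the oscillator is essentially self-adjoint on test functions, this is its unique
  self-adjoint realization.\<close>

definition harmonic_oscillator :: "real operator" where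
  "harmonic_oscillator = {(f, g). f \<in> Lq 2 lebesgue \<and> g \<in> Lq 2 lebesgue \<and>
     (\<forall>\<psi>\<in>test_fun. (LINT x|lebesgue. f x * harmonic_expr \<psi> x) = (LINT x|lebesgue. g x * \<psi> x))}"

text \<open>Spherical harmonics of degree $n$ on $\mathbb{S}^N \subset \mathbb{R}^N \times \mathbb{R}$
  are the restrictions to the sphere of the homogeneous harmonic polynomials of degree $n$.\<close>

definition solid_harmonics :: "nat \<Rightarrow> ('b::euclidean_space \<Rightarrow> real) set" where
  "solid_harmonics n = {Y. real_polynomial_function Y \<and> (\<forall>c z. Y (c *\<^sub>R z) = c ^ n * Y z) \<and>
     (\<forall>z. laplacian Y z = 0)}"

definition stereo_inv :: "'a::euclidean_space \<Rightarrow> 'a \<times> real" where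
  "stereo_inv x = ((2 / ((norm x)\<^sup>2 + 1)) *\<^sub>R x, ((norm x)\<^sup>2 - 1) / ((norm x)\<^sup>2 + 1))"

definition stereo_lift :: "('a::euclidean_space \<times> real \<Rightarrow> real) \<Rightarrow> 'a \<Rightarrow> real" where
  "stereo_lift Y x = (2 / ((norm x)\<^sup>2 + 1)) powr ((real DIM('a) - 2) / 2) * Y (stereo_inv x)"

definition stereo_weight :: "'a::euclidean_space \<Rightarrow> real" where
  "stereo_weight x = 1 / ((norm x)\<^sup>2 + 1)\<^sup>2"

text \<open>\<open>A\<close> has the eigenvalues $\nu_n = (2n+N-1)^2$, and the eigenspace of $\nu_n$ consists of the
  lifts of the spherical harmonics of degree $n$. Up to a constant factor, \<open>stereo_lift\<close> is an
  isometry from $L^2(\mathbb{S}^N)$ onto $L^2_V(\mathbb{R}^N)$, so the orthonormal bases of the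
  eigenspace are, up to normalization, the lifts of the orthonormal bases of the space of
  spherical harmonics.\<close>

definition stereographic_spectrum :: "'a::euclidean_space operator \<Rightarrow> (nat \<Rightarrow> real) \<Rightarrow> bool" where
  "stereographic_spectrum A \<nu> \<longleftrightarrow>
     (\<forall>n. \<nu> n = (2 * real n + real DIM('a) - 1)\<^sup>2 \<and>
        eigenspace (weighted stereo_weight) A (\<nu> n) =
          {f \<in> Lq 2 (weighted stereo_weight).
             \<exists>Y\<in>solid_harmonics n. AE x in weighted stereo_weight. f x = stereo_lift Y x})"

end

theory Submission
  imports Defs
begin

text \<open>Both parts are regularity statements about a function \<open>u\<close> for which \<open>u\<close> and \<open>B u\<close> are square
  integrable in $(x,t)$, where \<open>B\<close> is the square root of the operator \<open>A\<close> in \<open>x\<close>. The \<open>t\<close>-derivative is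
  part of the definition of a weak solution, so the content is that \<open>B u\<close> controls the derivatives
  and weights in \<open>x\<close>.

  The link between \<open>B\<close> and these operations is made on eigenfunctions. If \<open>A \<phi> = \<nu> \<phi>\<close>, then
  \<open>B \<phi> = sqrt \<nu> \<phi>\<close> (\<open>sqrt_op_eigenfunction\<close>), so for almost every \<open>t\<close> the coefficients $c_i(t)$ of
  $u(\cdot,t)$ satisfy $\sum_i (1+\nu_i) c_i(t)^2 \le \|u(\cdot,t)\|^2 + \|(Bu)(\cdot,t)\|^2$ by
  Bessel's inequality. Let \<open>E\<close> be an operation (a derivative, or multiplication by a weight) with
  $\|\sum_i b_i E\varphi_i\|^2 \le \kappa \sum_i (1+\nu_i) b_i^2$ for all finite linear
  combinations. Then the partial sums $\sum_i c_i(t)\, (E\varphi_i)(x)$ converge in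
  $L^2(dx\,dt)$ (\<open>controlled_limit\<close>), while $\sum_i c_i(t) \varphi_i(x)$ converges to \<open>u\<close> because the
  eigenfunctions are complete (\<open>expansion_converges\<close>). Integrating by parts against test functions
  identifies the first limit with \<open>E u\<close> (\<open>weak_derivative_limit\<close>, \<open>L2_lim_mult\<close>). The
  expansions are measurable in $(x,t)$ by construction, and so are their limits. What remains is
  one estimate for finite combinations \<open>F\<close> of eigenfunctions in each part.

  For the oscillator $H = -\frac{d^2}{dx^2} + x^2$, positivity of \<open>H\<close> shows that eigenfunctions of
  $H^2$ are eigenfunctions of \<open>H\<close> (\<open>harmonic_square_eigenfunction\<close>), and distributional solutions
  of the eigenvalue equation are twice continuously differentiable (\<open>weak_solution_classical\<close>).
  Testing $HF = G$ with $(1+x^2) F$ bounds \<open>F'\<close>, \<open>x F'\<close>, \<open>x\<^sup>2 F\<close> and \<open>F''\<close> by \<open>F\<close> and \<open>G\<close>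
  (\<open>harmonic_estimate\<close>).

  In the second part the eigenfunctions are lifts of polynomials on the sphere and hence smooth,
  with explicit decay at infinity (\<open>tame_stereo_lift\<close>). Green's formula then bounds
  the square norms of the partial derivatives of $F = \sum_i b_i \varphi_i$ by $\sum_i \nu_i b_i^2$
  (\<open>dirichlet_energy\<close>). The decay is essential: nothing may escape through the point at infinity,
  and in dimension two this fails for distributional solutions with a logarithmic singularity there.\<close>

section \<open>Square integrable functions\<close>

abbreviation sqnorm :: "'a measure \<Rightarrow> ('a \<Rightarrow> real) \<Rightarrow> real" where
  "sqnorm M f \<equiv> L2_inner M f f"

lemma Lq2_iff: "f \<in> Lq 2 M \<longleftrightarrow> f \<in> borel_measurable M \<and> integrable M (\<lambda>x. (f x)\<^sup>2)"
proof -
  have "\<bar>y::real\<bar> powr 2 = y\<^sup>2" for y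
    by (cases "y = 0") (auto simp: powr_numeral)
  then show ?thesis by (simp add: Lq_def)
qed

lemma Lq2_measurable: "f \<in> Lq 2 M \<Longrightarrow> f \<in> borel_measurable M"
  by (simp add: Lq2_iff)

lemma sqnorm_eq: "sqnorm M f = (LINT x|M. (f x)\<^sup>2)"
  by (simp add: L2_inner_def power2_eq_square)

lemma sqnorm_nonneg: "0 \<le> sqnorm M f"
  by (simp add: sqnorm_eq)

lemma L2_inner_commute: "L2_inner M f g = L2_inner M g f"
  by (simp add: L2_inner_def mult.commute)

lemma Lq2_mult_integrable:
  assumes "f \<in> Lq 2 M" "g \<in> Lq 2 M"
  shows "integrable M (\<lambda>x. f x * g x)"
proof (rule Bochner_Integration.integrable_bound)
  show "integrable M (\<lambda>x. (f x)\<^sup>2 + (g x)\<^sup>2)"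
    using assms by (simp add: Lq2_iff)
  show "(\<lambda>x. f x * g x) \<in> borel_measurable M"
    using assms by (intro borel_measurable_times) (auto simp: Lq2_iff)
  have "\<bar>a * b\<bar> \<le> a\<^sup>2 + b\<^sup>2" for a b :: real
  proof -
    have "2 * (\<bar>a\<bar> * \<bar>b\<bar>) \<le> a\<^sup>2 + b\<^sup>2"
      using sum_squares_bound[of "\<bar>a\<bar>" "\<bar>b\<bar>"] by (simp add: mult.assoc)
    moreover have "0 \<le> \<bar>a\<bar> * \<bar>b\<bar>" by simp
    ultimately show ?thesis unfolding abs_mult by linarith
  qed
  then show "AE x in M. norm (f x * g x) \<le> norm ((f x)\<^sup>2 + (g x)\<^sup>2)"
    by simp
qed

lemma Lq2_lin:
  assumes "f \<in> Lq 2 M" "g \<in> Lq 2 M"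
  shows "(\<lambda>x. a * f x + b * g x) \<in> Lq 2 M"
proof -
  have "(\<lambda>x. (a * f x + b * g x)\<^sup>2) = (\<lambda>x. a\<^sup>2 * (f x)\<^sup>2 + b\<^sup>2 * (g x)\<^sup>2 + 2 * a * b * (f x * g x))"
    by (auto simp: power2_eq_square algebra_simps)
  moreover have "(\<lambda>x. a * f x + b * g x) \<in> borel_measurable M"
    using assms by (intro borel_measurable_add borel_measurable_times) (auto simp: Lq2_iff)
  ultimately show ?thesis
    using assms Lq2_mult_integrable[OF assms] by (simp add: Lq2_iff)
qed

lemma Lq2_add: "f \<in> Lq 2 M \<Longrightarrow> g \<in> Lq 2 M \<Longrightarrow> (\<lambda>x. f x + g x) \<in> Lq 2 M"
  using Lq2_lin[of f M g 1 1] by simp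

lemma Lq2_diff: "f \<in> Lq 2 M \<Longrightarrow> g \<in> Lq 2 M \<Longrightarrow> (\<lambda>x. f x - g x) \<in> Lq 2 M"
  using Lq2_lin[of f M g 1 "-1"] by simp

lemma Lq2_scale: "f \<in> Lq 2 M \<Longrightarrow> (\<lambda>x. c * f x) \<in> Lq 2 M"
  using Lq2_lin[of f M f c 0] by simp

lemma Lq2_zero: "(\<lambda>x. 0) \<in> Lq 2 M"
  by (simp add: Lq2_iff)

lemma Lq2_sum:
  assumes "\<And>i. i \<in> J \<Longrightarrow> f i \<in> Lq 2 M"
  shows "(\<lambda>x. \<Sum>i\<in>J. f i x) \<in> Lq 2 M"
  using assms
  by (induction J rule: infinite_finite_induct) (auto simp: Lq2_zero intro!: Lq2_add)

lemma L2_inner_lin: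
  assumes "f \<in> Lq 2 M" "g \<in> Lq 2 M" "h \<in> Lq 2 M"
  shows "L2_inner M (\<lambda>x. a * f x + b * g x) h = a * L2_inner M f h + b * L2_inner M g h"
proof -
  have "(\<lambda>x. (a * f x + b * g x) * h x) = (\<lambda>x. a * (f x * h x) + b * (g x * h x))"
    by (auto simp: algebra_simps)
  then show ?thesis
    using assms by (simp add: L2_inner_def Lq2_mult_integrable)
qed

lemma L2_inner_diff:
  assumes "f \<in> Lq 2 M" "g \<in> Lq 2 M" "h \<in> Lq 2 M"
  shows "L2_inner M (\<lambda>x. f x - g x) h = L2_inner M f h - L2_inner M g h"
  using L2_inner_lin[OF assms, of 1 "-1"] by simp

lemma L2_inner_sum:
  assumes "\<And>i. i \<in> J \<Longrightarrow> f i \<in> Lq 2 M" "h \<in> Lq 2 M"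
  shows "L2_inner M (\<lambda>x. \<Sum>i\<in>J. c i * f i x) h = (\<Sum>i\<in>J. c i * L2_inner M (f i) h)"
proof -
  have "L2_inner M (\<lambda>x. \<Sum>i\<in>J. c i * f i x) h = (LINT x|M. (\<Sum>i\<in>J. c i * (f i x * h x)))"
    by (simp add: L2_inner_def sum_distrib_right mult.assoc)
  also have "\<dots> = (\<Sum>i\<in>J. c i * L2_inner M (f i) h)"
    using assms by (subst Bochner_Integration.integral_sum) (auto simp: L2_inner_def Lq2_mult_integrable)
  finally show ?thesis .
qed

lemma sqnorm_add:
  assumes "f \<in> Lq 2 M" "g \<in> Lq 2 M"
  shows "sqnorm M (\<lambda>x. f x + s * g x) = sqnorm M f + 2 * s * L2_inner M f g + s\<^sup>2 * sqnorm M g"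
proof -
  have h: "(\<lambda>x. f x + s * g x) \<in> Lq 2 M"
    using Lq2_lin[OF assms, of 1 s] by simp
  show ?thesis
    using L2_inner_lin[OF assms h, of 1 s] L2_inner_lin[OF assms assms(1), of 1 s]
      L2_inner_lin[OF assms assms(2), of 1 s]
    by (simp add: L2_inner_commute[of M f "\<lambda>x. f x + s * g x"]
        L2_inner_commute[of M g "\<lambda>x. f x + s * g x"] L2_inner_commute[of M g f]
        power2_eq_square algebra_simps)
qed

lemma L2_Cauchy_Schwarz:
  assumes "f \<in> Lq 2 M" "g \<in> Lq 2 M"
  shows "(L2_inner M f g)\<^sup>2 \<le> sqnorm M f * sqnorm M g"
proof -
  define a b c where "a = sqnorm M f" and "b = L2_inner M f g" and "c = sqnorm M g"
  have q: "0 \<le> a + 2 * s * b + s\<^sup>2 * c" for s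
    using sqnorm_nonneg[of M "\<lambda>x. f x + s * g x"] sqnorm_add[OF assms, of s]
    by (simp add: a_def b_def c_def)
  have "c \<ge> 0" by (simp add: c_def sqnorm_nonneg)
  show ?thesis
  proof (cases "c = 0")
    case True
    have "b = 0"
    proof (rule ccontr)
      assume "b \<noteq> 0"
      then show False
        \<comment> \<open>at this point the linear function \<open>a + 2 s b\<close> takes the value \<open>- 1\<close>\<close>
        using q[of "- (a + 1) / (2 * b)"] True by (simp add: field_simps)
    qed
    then show ?thesis using True by (simp add: a_def[symmetric] b_def[symmetric] c_def[symmetric])
  next
    case False
    then have "c > 0" using \<open>c \<ge> 0\<close> by simp
    with q[of "- b / c"] have "b\<^sup>2 \<le> a * c"
      by (simp add: field_simps power2_eq_square)
    then show ?thesis by (simp add: a_def b_def c_def)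
  qed
qed

lemma sqnorm_add_le:
  assumes "f \<in> Lq 2 M" "g \<in> Lq 2 M"
  shows "sqnorm M (\<lambda>x. f x + g x) \<le> 2 * sqnorm M f + 2 * sqnorm M g"
proof -
  have "sqnorm M (\<lambda>x. f x + g x) + sqnorm M (\<lambda>x. f x - g x) = 2 * sqnorm M f + 2 * sqnorm M g"
    using sqnorm_add[OF assms, of 1] sqnorm_add[OF assms, of "-1"] by simp
  then show ?thesis
    using sqnorm_nonneg[of M "\<lambda>x. f x - g x"] by linarith
qed

lemma sqnorm_minus: "sqnorm M (\<lambda>x. g x - f x) = sqnorm M (\<lambda>x. f x - g x)"
  by (simp add: L2_inner_def algebra_simps)

lemma sqnorm_0_AE:
  assumes "f \<in> Lq 2 M" "sqnorm M f = 0"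
  shows "AE x in M. f x = 0"
proof -
  have "AE x in M. (f x)\<^sup>2 = 0"
    using assms by (subst integral_nonneg_eq_0_iff_AE[symmetric]) (auto simp: Lq2_iff sqnorm_eq)
  then show ?thesis by simp
qed

lemma L2_inner_cong_AE:
  assumes "AE x in M. f x = f' x" "AE x in M. g x = g' x"
    "f \<in> borel_measurable M" "f' \<in> borel_measurable M"
    "g \<in> borel_measurable M" "g' \<in> borel_measurable M"
  shows "L2_inner M f g = L2_inner M f' g'"
  unfolding L2_inner_def using assms(1,2)
  by (intro integral_cong_AE) (use assms in auto)

lemma Lq2_cong_AE:
  assumes "f \<in> Lq 2 M" "AE x in M. f x = g x" "g \<in> borel_measurable M"
  shows "g \<in> Lq 2 M"
proof -
  have "integrable M (\<lambda>x. (g x)\<^sup>2)"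
    using assms by (intro integrable_cong_AE_imp[where g="\<lambda>x. (f x)\<^sup>2" and f="\<lambda>x. (g x)\<^sup>2"])
      (auto simp: Lq2_iff)
  then show ?thesis using assms by (simp add: Lq2_iff)
qed

text \<open>The form of Fatou's lemma for removing cut-offs: the bounds \<open>K j\<close> may contain boundary errors that
  vanish only in the limit.\<close>

lemma integral_Fatou:
  fixes P :: "nat \<Rightarrow> 'a \<Rightarrow> real"
  assumes "\<And>j. integrable M (P j)" "\<And>j x. 0 \<le> P j x" "\<forall>\<^sub>F j in sequentially. integral\<^sup>L M (P j) \<le> K j"
    "K \<longlonglongrightarrow> C" "AE x in M. (\<lambda>j. P j x) \<longlonglongrightarrow> Q x" "Q \<in> borel_measurable M"
  shows "integrable M Q" "integral\<^sup>L M Q \<le> C"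
proof -
  have C: "0 \<le> C"
  proof (rule tendsto_lowerbound[OF assms(4)])
    show "\<forall>\<^sub>F j in sequentially. 0 \<le> K j"
      using assms(3)
    proof eventually_elim
      case (elim j)
      have "0 \<le> integral\<^sup>L M (P j)" using assms(2) by simp
      then show ?case using elim by linarith
    qed
  qed simp
  have Q0: "AE x in M. 0 \<le> Q x"
    using assms(5) by eventually_elim (meson LIMSEQ_le_const assms(2))
  have "(\<integral>\<^sup>+x. ennreal (Q x) \<partial>M) = (\<integral>\<^sup>+x. liminf (\<lambda>j. ennreal (P j x)) \<partial>M)"
  proof (rule nn_integral_cong_AE)
    show "AE x in M. ennreal (Q x) = liminf (\<lambda>j. ennreal (P j x))"
      using assms(5)
    proof eventually_elim
      case (elim x)
      then have "(\<lambda>j. ennreal (P j x)) \<longlonglongrightarrow> ennreal (Q x)"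
        by (rule tendsto_ennrealI)
      then show ?case
        by (simp add: lim_imp_Liminf)
    qed
  qed
  also have "\<dots> \<le> liminf (\<lambda>j. \<integral>\<^sup>+x. ennreal (P j x) \<partial>M)"
    using assms(1) by (intro nn_integral_liminf) auto
  also have "\<dots> = liminf (\<lambda>j. ennreal (integral\<^sup>L M (P j)))"
    using assms(1,2) by (simp add: nn_integral_eq_integral)
  also have "\<dots> \<le> liminf (\<lambda>j. ennreal (K j))"
    by (rule Liminf_mono, use assms(3) in eventually_elim) (rule ennreal_leI)
  also have "\<dots> = ennreal C"
    using assms(4) by (intro lim_imp_Liminf) auto
  finally have le: "(\<integral>\<^sup>+x. ennreal (Q x) \<partial>M) \<le> ennreal C" .
  show int: "integrable M Q"
    using le Q0 assms(6) by (intro integrableI_nonneg) (auto simp: less_top[symmetric] top_unique)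
  show "integral\<^sup>L M Q \<le> C"
    using le C Q0 int by (simp add: nn_integral_eq_integral)
qed

text \<open>Riesz--Fischer. A subsequence with geometrically decreasing increments \<open>h\<close> converges
  almost everywhere, because \<open>\<bar>h j\<bar> \<le> 2\<^sup>-\<^sup>j + 2\<^sup>j h\<^sup>2 j\<close> and the second terms have a summable
  integral; Fatou's lemma then upgrades the pointwise limit to a limit in $L^2$.\<close>

theorem L2_complete:
  fixes f :: "nat \<Rightarrow> 'a \<Rightarrow> real"
  assumes f: "\<And>k. f k \<in> Lq 2 M"
    and Cauchy: "\<And>e. e > 0 \<Longrightarrow> \<exists>N. \<forall>m\<ge>N. \<forall>k\<ge>N. sqnorm M (\<lambda>x. f m x - f k x) \<le> e"
  shows "\<exists>g\<in>Lq 2 M. (\<lambda>k. sqnorm M (\<lambda>x. f k x - g x)) \<longlonglongrightarrow> 0"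
proof -
  have [measurable]: "f k \<in> borel_measurable M" for k using f by (simp add: Lq2_iff)
  have "\<exists>N. \<forall>m\<ge>N. \<forall>k\<ge>N. sqnorm M (\<lambda>x. f m x - f k x) \<le> (1/8)^j" for j :: nat
    by (rule Cauchy) simp
  then obtain N where N: "\<And>j m k. m \<ge> N j \<Longrightarrow> k \<ge> N j \<Longrightarrow> sqnorm M (\<lambda>x. f m x - f k x) \<le> (1/8)^j"
    by metis
  \<comment> \<open>the summand \<open>j\<close> makes \<open>r\<close> tend to infinity, which is all that the last step needs\<close>
  define r where "r j = (\<Sum>i\<le>j. N i) + j" for j
  have rN: "N j \<le> r j" for j
    unfolding r_def by (rule order.trans[of _ "\<Sum>i\<le>j. N i"]) (auto intro: member_le_sum)
  have rN': "N j \<le> r (Suc j)" for j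
    using rN[of j] by (simp add: r_def)
  have rj: "j \<le> r j" for j by (simp add: r_def)
  define h where "h j x = f (r (Suc j)) x - f (r j) x" for j x
  have hL: "h j \<in> Lq 2 M" for j unfolding h_def[abs_def] by (intro Lq2_diff f)
  have [measurable]: "h j \<in> borel_measurable M" for j using hL by (simp add: Lq2_iff)
  have hn: "sqnorm M (h j) \<le> (1/8)^j" for j
    unfolding h_def[abs_def] by (rule N[OF rN' rN])
  have "(\<integral>\<^sup>+x. (\<Sum>j. ennreal (2^j * (h j x)\<^sup>2)) \<partial>M) = (\<Sum>j. \<integral>\<^sup>+x. ennreal (2^j * (h j x)\<^sup>2) \<partial>M)"
    by (rule nn_integral_suminf) measurable
  also have "\<dots> = (\<Sum>j. ennreal (2^j * sqnorm M (h j)))"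
    using hL by (simp add: nn_integral_eq_integral Lq2_iff sqnorm_eq)
  also have "\<dots> \<le> (\<Sum>j. ennreal ((1/4)^j))"
  proof (intro suminf_le ennreal_leI)
    fix j
    have "2^j * sqnorm M (h j) \<le> 2^j * (1/8)^j" using hn by simp
    also have "\<dots> = (1/4)^j" by (simp add: power_mult_distrib[symmetric])
    finally show "2^j * sqnorm M (h j) \<le> (1/4)^j" .
  qed auto
  also have "\<dots> = ennreal (\<Sum>j. (1/4)^j)"
    by (rule suminf_ennreal2) auto
  finally have "(\<integral>\<^sup>+x. (\<Sum>j. ennreal (2^j * (h j x)\<^sup>2)) \<partial>M) < \<infinity>"
    by (rule le_less_trans) simp
  then have "AE x in M. (\<Sum>j. ennreal (2^j * (h j x)\<^sup>2)) \<noteq> \<infinity>"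
    by (intro nn_integral_PInf_AE) (auto simp: less_top)
  then have conv: "AE x in M. convergent (\<lambda>j. f (r j) x)"
  proof eventually_elim
    case (elim x)
    have s1: "summable (\<lambda>j. 2^j * (h j x)\<^sup>2)"
      using elim by (intro summable_suminf_not_top) auto
    have "summable (\<lambda>j. \<bar>h j x\<bar>)"
    proof (rule summable_comparison_test')
      show "summable (\<lambda>j. (1/2)^j + 2^j * (h j x)\<^sup>2)"
        using s1 by (intro summable_add summable_geometric) auto
      fix j :: nat
      show "norm \<bar>h j x\<bar> \<le> (1/2)^j + 2^j * (h j x)\<^sup>2"
      proof (cases "\<bar>h j x\<bar> \<le> (1/2)^j")
        case True
        then show ?thesis by (simp add: add_increasing2)
      next
        case False
        then have "1 \<le> 2^j * \<bar>h j x\<bar>" by (simp add: field_simps)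
        then have "\<bar>h j x\<bar> \<le> (2^j * \<bar>h j x\<bar>) * \<bar>h j x\<bar>"
          using mult_right_mono[of 1 "2^j * \<bar>h j x\<bar>" "\<bar>h j x\<bar>"] by simp
        also have "\<dots> = 2^j * (h j x)\<^sup>2" by (simp add: power2_eq_square mult.assoc)
        finally show ?thesis by (simp add: add_increasing)
      qed
    qed
    then have "summable (\<lambda>j. h j x)" by (rule summable_rabs_cancel)
    then have "convergent (\<lambda>n. \<Sum>j<n. h j x)" by (simp add: summable_iff_convergent)
    then have "convergent (\<lambda>n. f (r n) x - f (r 0) x)"
      unfolding h_def by (simp add: sum_lessThan_telescope[of "\<lambda>n. f (r n) x"])
    then have "convergent (\<lambda>n. (f (r n) x - f (r 0) x) + f (r 0) x)"
      by (intro convergent_add convergent_const)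
    then show ?case by simp
  qed
  define g where "g x = lim (\<lambda>j. f (r j) x)" for x
  have [measurable]: "g \<in> borel_measurable M" unfolding g_def[abs_def] by measurable
  have lim: "AE x in M. (\<lambda>j. f (r j) x) \<longlonglongrightarrow> g x"
    using conv by eventually_elim (simp add: g_def convergent_LIMSEQ_iff)
  have main: "integrable M (\<lambda>x. (f k x - g x)\<^sup>2) \<and> sqnorm M (\<lambda>x. f k x - g x) \<le> e"
    if e: "\<forall>m\<ge>n. \<forall>k\<ge>n. sqnorm M (\<lambda>x. f m x - f k x) \<le> e" and k: "k \<ge> n" for k n e
  proof -
    have i: "integrable M (\<lambda>x. (f k x - f (r j) x)\<^sup>2)" for j
      using Lq2_diff[OF f f] by (simp add: Lq2_iff)
    have ev: "\<forall>\<^sub>F j in sequentially. (LINT x|M. (f k x - f (r j) x)\<^sup>2) \<le> e"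
      using eventually_ge_at_top[of n]
    proof eventually_elim
      case (elim j)
      then have "r j \<ge> n" using rj[of j] by linarith
      then show ?case using e k by (simp add: sqnorm_eq)
    qed
    have l: "AE x in M. (\<lambda>j. (f k x - f (r j) x)\<^sup>2) \<longlonglongrightarrow> (f k x - g x)\<^sup>2"
      using lim by eventually_elim (intro tendsto_intros)
    show ?thesis
      using integral_Fatou[OF i _ ev tendsto_const l] by (simp add: sqnorm_eq)
  qed
  obtain n where n: "\<forall>m\<ge>n. \<forall>k\<ge>n. sqnorm M (\<lambda>x. f m x - f k x) \<le> 1"
    using Cauchy[of 1] by auto
  have "(\<lambda>x. f n x - g x) \<in> Lq 2 M"
    using main[OF n] by (simp add: Lq2_iff)
  from Lq2_diff[OF f this, of n] have g: "g \<in> Lq 2 M" by simp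
  moreover have "(\<lambda>k. sqnorm M (\<lambda>x. f k x - g x)) \<longlonglongrightarrow> 0"
  proof (rule LIMSEQ_I)
    fix e :: real assume "e > 0"
    then obtain n where n: "\<forall>m\<ge>n. \<forall>k\<ge>n. sqnorm M (\<lambda>x. f m x - f k x) \<le> e/2"
      using Cauchy[of "e/2"] by auto
    have "norm (sqnorm M (\<lambda>x. f k x - g x) - 0) < e" if "k \<ge> n" for k
      using main[OF n that] sqnorm_nonneg[of M "\<lambda>x. f k x - g x"] \<open>e > 0\<close> by simp
    then show "\<exists>n. \<forall>k\<ge>n. norm (sqnorm M (\<lambda>x. f k x - g x) - 0) < e" by blast
  qed
  ultimately show ?thesis by blast
qed

lemma L2_lim_inner:
  assumes "\<And>k. f k \<in> Lq 2 M" "g \<in> Lq 2 M" "h \<in> Lq 2 M"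
    "(\<lambda>k. sqnorm M (\<lambda>x. f k x - g x)) \<longlonglongrightarrow> 0"
  shows "(\<lambda>k. L2_inner M (f k) h) \<longlonglongrightarrow> L2_inner M g h"
proof -
  have "(\<lambda>k. (L2_inner M (f k) h - L2_inner M g h)\<^sup>2) \<longlonglongrightarrow> 0"
  proof (rule tendsto_sandwich[of "\<lambda>_. 0"])
    show "\<forall>\<^sub>F k in sequentially. (L2_inner M (f k) h - L2_inner M g h)\<^sup>2
        \<le> sqnorm M (\<lambda>x. f k x - g x) * sqnorm M h"
      using L2_Cauchy_Schwarz[OF Lq2_diff[OF assms(1,2)] assms(3)] assms
      by (simp add: L2_inner_diff)
    show "(\<lambda>k. sqnorm M (\<lambda>x. f k x - g x) * sqnorm M h) \<longlonglongrightarrow> 0"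
      using tendsto_mult_right[OF assms(4), of "sqnorm M h"] by simp
  qed auto
  then have "(\<lambda>k. sqrt ((L2_inner M (f k) h - L2_inner M g h)\<^sup>2)) \<longlonglongrightarrow> sqrt 0"
    by (rule tendsto_real_sqrt)
  then have "(\<lambda>k. L2_inner M (f k) h - L2_inner M g h) \<longlonglongrightarrow> 0"
    by (simp add: tendsto_rabs_zero_iff)
  then show ?thesis by (rule LIM_zero_cancel)
qed

lemma L2_lim_AE_subseq:
  assumes f: "\<And>k. f k \<in> Lq 2 M" "g \<in> Lq 2 M" "(\<lambda>k. sqnorm M (\<lambda>x. f k x - g x)) \<longlonglongrightarrow> 0"
  shows "\<exists>r::nat\<Rightarrow>nat. strict_mono r \<and> (AE x in M. (\<lambda>n. f (r n) x) \<longlonglongrightarrow> g x)"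
proof -
  have i: "integrable M (\<lambda>x. (f k x - g x)\<^sup>2)" for k
    using Lq2_diff[OF f(1,2)] by (simp add: Lq2_iff)
  have "(\<lambda>k. LINT x|M. norm ((f k x - g x)\<^sup>2)) \<longlonglongrightarrow> 0"
    using f(3) by (simp add: sqnorm_eq)
  from tendsto_L1_AE_subseq[OF i this] obtain r :: "nat \<Rightarrow> nat"
    where r: "strict_mono r" "AE x in M. (\<lambda>n. (f (r n) x - g x)\<^sup>2) \<longlonglongrightarrow> 0" by blast
  have "AE x in M. (\<lambda>n. f (r n) x) \<longlonglongrightarrow> g x"
    using r(2)
  proof eventually_elim
    case (elim x)
    from tendsto_real_sqrt[OF elim] have "(\<lambda>n. f (r n) x - g x) \<longlonglongrightarrow> 0"
      by (simp add: tendsto_rabs_zero_iff)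
    then show ?case by (rule LIM_zero_cancel)
  qed
  then show ?thesis using r(1) by blast
qed

text \<open>Multiplication by a fixed function is a closed operation in $L^2$: along a subsequence both
  limits hold almost everywhere.\<close>

lemma L2_lim_mult:
  assumes f: "\<And>k. f k \<in> Lq 2 M" "g \<in> Lq 2 M" "(\<lambda>k. sqnorm M (\<lambda>x. f k x - g x)) \<longlonglongrightarrow> 0"
    and m: "m \<in> borel_measurable M"
    and w: "\<And>k. (\<lambda>x. m x * f k x) \<in> Lq 2 M" "w \<in> Lq 2 M"
      "(\<lambda>k. sqnorm M (\<lambda>x. m x * f k x - w x)) \<longlonglongrightarrow> 0"
  shows "(\<lambda>x. m x * g x) \<in> Lq 2 M"
proof -
  obtain r :: "nat \<Rightarrow> nat" where r: "strict_mono r" "AE x in M. (\<lambda>n. f (r n) x) \<longlonglongrightarrow> g x"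
    using L2_lim_AE_subseq[OF f] by blast
  have "(\<lambda>k. sqnorm M (\<lambda>x. m x * f (r k) x - w x)) \<longlonglongrightarrow> 0"
    using LIMSEQ_subseq_LIMSEQ[OF w(3) r(1)] by (simp add: o_def)
  from L2_lim_AE_subseq[OF w(1,2) this] obtain s :: "nat \<Rightarrow> nat"
    where s: "strict_mono s" "AE x in M. (\<lambda>n. m x * f (r (s n)) x) \<longlonglongrightarrow> w x" by blast
  have "AE x in M. w x = m x * g x"
    using r(2) s(2)
  proof eventually_elim
    case (elim x)
    have "(\<lambda>n. m x * f (r (s n)) x) \<longlonglongrightarrow> m x * g x"
      using LIMSEQ_subseq_LIMSEQ[OF elim(1) s(1)] by (intro tendsto_mult_left) (simp add: o_def)
    then show ?case using elim(2) LIMSEQ_unique by blast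
  qed
  then show ?thesis
    using f(2) m by (intro Lq2_cong_AE[OF w(2)] borel_measurable_times) (auto simp: Lq2_iff)
qed

section \<open>Orthonormal systems\<close>

definition orthonormal :: "'a measure \<Rightarrow> 'i set \<Rightarrow> ('i \<Rightarrow> 'a \<Rightarrow> real) \<Rightarrow> bool" where
  "orthonormal M I e \<longleftrightarrow> (\<forall>i\<in>I. e i \<in> Lq 2 M) \<and>
     (\<forall>i\<in>I. \<forall>j\<in>I. L2_inner M (e i) (e j) = of_bool (i = j))"

lemma orthonormal_comb_inner:
  assumes "orthonormal M I e" "finite J" "J \<subseteq> I" "j \<in> I"
  shows "L2_inner M (\<lambda>x. \<Sum>i\<in>J. c i * e i x) (e j) = (if j \<in> J then c j else 0)"
proof -
  have "L2_inner M (\<lambda>x. \<Sum>i\<in>J. c i * e i x) (e j) = (\<Sum>i\<in>J. c i * L2_inner M (e i) (e j))"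
    using assms by (intro L2_inner_sum) (auto simp: orthonormal_def)
  also have "\<dots> = (\<Sum>i\<in>J. if i = j then c i else 0)"
    using assms by (intro sum.cong) (auto simp: orthonormal_def)
  also have "\<dots> = (if j \<in> J then c j else 0)"
    using assms by simp
  finally show ?thesis .
qed

lemma orthonormal_comb_sqnorm:
  assumes "orthonormal M I e" "finite J" "J \<subseteq> I"
  shows "L2_inner M (\<lambda>x. \<Sum>i\<in>J. c i * e i x) (\<lambda>x. \<Sum>i\<in>J. b i * e i x) = (\<Sum>i\<in>J. c i * b i)"
proof -
  have L: "(\<lambda>x. \<Sum>i\<in>J. a i * e i x) \<in> Lq 2 M" for a
    using assms by (intro Lq2_sum Lq2_scale) (auto simp: orthonormal_def)
  have "L2_inner M (\<lambda>x. \<Sum>i\<in>J. c i * e i x) (\<lambda>x. \<Sum>i\<in>J. b i * e i x)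
      = (\<Sum>i\<in>J. c i * L2_inner M (e i) (\<lambda>x. \<Sum>i\<in>J. b i * e i x))"
    using assms L by (intro L2_inner_sum) (auto simp: orthonormal_def)
  also have "\<dots> = (\<Sum>i\<in>J. c i * b i)"
    using assms by (intro sum.cong)
      (auto simp: L2_inner_commute[of M "e _"] orthonormal_comb_inner[OF assms])
  finally show ?thesis .
qed

lemma Bessel:
  assumes "orthonormal M I e" "finite J" "J \<subseteq> I" "f \<in> Lq 2 M"
  shows "sqnorm M (\<lambda>x. f x - (\<Sum>i\<in>J. L2_inner M f (e i) * e i x))
      = sqnorm M f - (\<Sum>i\<in>J. (L2_inner M f (e i))\<^sup>2)"
proof -
  define P where "P x = (\<Sum>i\<in>J. L2_inner M f (e i) * e i x)" for x
  have P: "P \<in> Lq 2 M"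
    using assms unfolding P_def[abs_def] by (intro Lq2_sum Lq2_scale) (auto simp: orthonormal_def)
  have "L2_inner M P f = (\<Sum>i\<in>J. L2_inner M f (e i) * L2_inner M (e i) f)"
    unfolding P_def[abs_def] using assms by (intro L2_inner_sum) (auto simp: orthonormal_def)
  then have "L2_inner M f P = (\<Sum>i\<in>J. (L2_inner M f (e i))\<^sup>2)"
    by (simp add: L2_inner_commute[of M _ f] power2_eq_square L2_inner_commute[of M P f])
  moreover have "sqnorm M P = (\<Sum>i\<in>J. (L2_inner M f (e i))\<^sup>2)"
    unfolding P_def[abs_def] orthonormal_comb_sqnorm[OF assms(1-3)] by (simp add: power2_eq_square)
  ultimately show ?thesis
    using sqnorm_add[OF assms(4) P, of "-1"] unfolding P_def by simp
qed

lemma Bessel_le: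
  assumes "orthonormal M I e" "finite J" "J \<subseteq> I" "f \<in> Lq 2 M"
  shows "(\<Sum>i\<in>J. (L2_inner M f (e i))\<^sup>2) \<le> sqnorm M f"
  using Bessel[OF assms] sqnorm_nonneg[of M "\<lambda>x. f x - (\<Sum>i\<in>J. L2_inner M f (e i) * e i x)"]
  by linarith

text \<open>Blocks of the series are dominated by blocks of a bounded increasing numerical sequence, so the
  partial sums form a Cauchy sequence. They run over increasing finite index sets, because the
  eigenfunctions come in groups, one for each eigenvalue.\<close>

lemma L2_block_limit:
  fixes T :: "'i \<Rightarrow> 'a \<Rightarrow> real" and J :: "nat \<Rightarrow> 'i set"
  assumes T: "\<And>i. i \<in> I \<Longrightarrow> T i \<in> Lq 2 M"
    and J: "incseq J" "\<And>k. finite (J k)" "\<And>k. J k \<subseteq> I"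
    and gram: "\<And>L. finite L \<Longrightarrow> L \<subseteq> I \<Longrightarrow> sqnorm M (\<lambda>x. \<Sum>i\<in>L. T i x) \<le> (\<Sum>i\<in>L. a i)"
    and bounded: "\<And>k. (\<Sum>i\<in>J k. a i) \<le> C"
  shows "\<exists>g\<in>Lq 2 M. (\<lambda>k. sqnorm M (\<lambda>x. (\<Sum>i\<in>J k. T i x) - g x)) \<longlonglongrightarrow> 0"
proof (rule L2_complete)
  show "(\<lambda>x. \<Sum>i\<in>J k. T i x) \<in> Lq 2 M" for k
    using T J by (intro Lq2_sum) auto
  have block: "sqnorm M (\<lambda>x. (\<Sum>i\<in>J m. T i x) - (\<Sum>i\<in>J k. T i x)) \<le> (\<Sum>i\<in>J m. a i) - (\<Sum>i\<in>J k. a i)"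
    if "k \<le> m" for k m
  proof -
    have sub: "J k \<subseteq> J m" using J(1) that by (auto dest: incseqD)
    have "(\<Sum>i\<in>J m. b i) - (\<Sum>i\<in>J k. b i) = (\<Sum>i\<in>J m - J k. b i)" for b :: "'i \<Rightarrow> real"
      using sub J(2) by (simp add: sum_diff)
    then show ?thesis
      using gram[of "J m - J k"] J by auto
  qed
  define A where "A k = (\<Sum>i\<in>J k. a i)" for k
  have "incseq A"
  proof (rule monoI)
    fix k m :: nat assume "k \<le> m"
    then show "A k \<le> A m"
      using block[of k m] sqnorm_nonneg[of M "\<lambda>x. (\<Sum>i\<in>J m. T i x) - (\<Sum>i\<in>J k. T i x)"]
      by (simp add: A_def)
  qed
  moreover have "\<forall>k. A k \<le> C" using bounded by (simp add: A_def)
  ultimately obtain l where "A \<longlonglongrightarrow> l" by (rule incseq_convergent)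
  then have "Cauchy A" by (rule LIMSEQ_imp_Cauchy)
  fix e :: real assume "e > 0"
  then obtain N where N: "\<And>m k. m \<ge> N \<Longrightarrow> k \<ge> N \<Longrightarrow> dist (A m) (A k) < e"
    using \<open>Cauchy A\<close> by (meson metric_CauchyD)
  have "sqnorm M (\<lambda>x. (\<Sum>i\<in>J m. T i x) - (\<Sum>i\<in>J k. T i x)) \<le> e" if "m \<ge> N" "k \<ge> N" for m k
  proof (cases "k \<le> m")
    case True
    then show ?thesis using block[OF True] N[OF that] by (simp add: A_def dist_real_def)
  next
    case False
    then have "m \<le> k" by simp
    from block[OF this] show ?thesis
      using N[OF that] by (subst sqnorm_minus) (simp add: A_def dist_real_def)
  qed
  then show "\<exists>N. \<forall>m\<ge>N. \<forall>k\<ge>N. sqnorm M (\<lambda>x. (\<Sum>i\<in>J m. T i x) - (\<Sum>i\<in>J k. T i x)) \<le> e" by blast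
qed

text \<open>Bessel's inequality makes the partial sums converge; their limit has the same coefficients as \<open>f\<close>,
  and totality identifies the two.\<close>

theorem total_expansion:
  fixes J :: "nat \<Rightarrow> 'i set"
  assumes on: "orthonormal M I e"
    and J: "incseq J" "\<And>k. finite (J k)" "(\<Union>k. J k) = I"
    and total: "\<And>f. f \<in> Lq 2 M \<Longrightarrow> (\<And>i. i \<in> I \<Longrightarrow> L2_inner M f (e i) = 0) \<Longrightarrow> AE x in M. f x = 0"
    and f: "f \<in> Lq 2 M"
  shows "(\<lambda>k. sqnorm M (\<lambda>x. f x - (\<Sum>i\<in>J k. L2_inner M f (e i) * e i x))) \<longlonglongrightarrow> 0"
proof -
  define c where "c i = L2_inner M f (e i)" for i
  have JI: "J k \<subseteq> I" for k using J by auto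
  have e: "e i \<in> Lq 2 M" if "i \<in> I" for i using on that by (simp add: orthonormal_def)
  have gram: "sqnorm M (\<lambda>x. \<Sum>i\<in>L. c i * e i x) \<le> (\<Sum>i\<in>L. (c i)\<^sup>2)" if "finite L" "L \<subseteq> I" for L
    using orthonormal_comb_sqnorm[OF on that, of c c] by (simp add: power2_eq_square)
  have "(\<Sum>i\<in>J k. (c i)\<^sup>2) \<le> sqnorm M f" for k
    unfolding c_def by (rule Bessel_le[OF on J(2) JI f])
  then obtain g where g: "g \<in> Lq 2 M"
    and lim: "(\<lambda>k. sqnorm M (\<lambda>x. (\<Sum>i\<in>J k. c i * e i x) - g x)) \<longlonglongrightarrow> 0"
    using L2_block_limit[OF Lq2_scale[OF e] J(1) J(2) JI gram, of "sqnorm M f"] by blast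
  have L: "(\<lambda>x. \<Sum>i\<in>J k. c i * e i x) \<in> Lq 2 M" for k
    using JI e by (intro Lq2_sum Lq2_scale) auto
  have "AE x in M. f x - g x = 0"
  proof (rule total)
    show "(\<lambda>x. f x - g x) \<in> Lq 2 M" by (intro Lq2_diff f g)
    fix j assume j: "j \<in> I"
    then obtain k0 where k0: "j \<in> J k0" using J by auto
    have "\<forall>\<^sub>F k in sequentially. L2_inner M (\<lambda>x. \<Sum>i\<in>J k. c i * e i x) (e j) = c j"
      using eventually_ge_at_top[of k0]
    proof eventually_elim
      case (elim k)
      then have "j \<in> J k" using k0 J(1) by (auto dest: incseqD)
      then show ?case by (simp add: orthonormal_comb_inner[OF on J(2) JI j])
    qed
    then have "(\<lambda>k. L2_inner M (\<lambda>x. \<Sum>i\<in>J k. c i * e i x) (e j)) \<longlonglongrightarrow> c j"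
      by (rule tendsto_eventually)
    with L2_lim_inner[OF L g e[OF j] lim] have "L2_inner M g (e j) = c j"
      by (rule LIMSEQ_unique)
    then show "L2_inner M (\<lambda>x. f x - g x) (e j) = 0"
      using L2_inner_diff[OF f g e[OF j]] by (simp add: c_def)
  qed
  then have fg: "AE x in M. f x = g x" by simp
  have [measurable]: "f \<in> borel_measurable M" "g \<in> borel_measurable M"
      "(\<lambda>x. \<Sum>i\<in>J k. c i * e i x) \<in> borel_measurable M" for k
    using f g L by (auto simp: Lq2_iff)
  have "sqnorm M (\<lambda>x. f x - (\<Sum>i\<in>J k. c i * e i x)) = sqnorm M (\<lambda>x. g x - (\<Sum>i\<in>J k. c i * e i x))" for k
    using fg by (intro L2_inner_cong_AE) auto
  then show ?thesis
    using lim unfolding c_def[symmetric] by (simp add: sqnorm_minus)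
qed

section \<open>Eigenfunction expansions depending on a parameter\<close>

lemma Lq2_slices:
  fixes U :: "'a::euclidean_space \<times> real \<Rightarrow> real"
  assumes "U \<in> Lq 2 lborel"
  shows "AE t in lborel. (\<lambda>x. U (x, t)) \<in> Lq 2 lborel"
    "integrable lborel (\<lambda>t. sqnorm lborel (\<lambda>x. U (x, t)))"
    "(LINT t|lborel. sqnorm lborel (\<lambda>x. U (x, t))) = sqnorm lborel U"
proof -
  have [measurable]: "U \<in> borel_measurable (lborel \<Otimes>\<^sub>M lborel)"
    using assms by (simp add: Lq2_iff lborel_prod)
  have i: "integrable (lborel \<Otimes>\<^sub>M lborel) (\<lambda>(x, t). (U (x, t))\<^sup>2)"
    using assms by (simp add: Lq2_iff lborel_prod case_prod_beta')
  show "AE t in lborel. (\<lambda>x. U (x, t)) \<in> Lq 2 lborel"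
    using lborel_pair.AE_integrable_snd[OF i] by eventually_elim (simp add: Lq2_iff)
  show "integrable lborel (\<lambda>t. sqnorm lborel (\<lambda>x. U (x, t)))"
    using lborel_pair.integrable_snd[OF i] by (simp add: sqnorm_eq)
  show "(LINT t|lborel. sqnorm lborel (\<lambda>x. U (x, t))) = sqnorm lborel U"
    using lborel_pair.integral_snd[OF i] by (simp add: sqnorm_eq lborel_prod case_prod_beta')
qed

lemma Lq2_product:
  fixes D :: "'a::euclidean_space \<Rightarrow> real" and c :: "real \<Rightarrow> real"
  assumes "D \<in> Lq 2 lborel" "c \<in> Lq 2 lborel"
  shows "(\<lambda>z. c (snd z) * D (fst z)) \<in> Lq 2 lborel"
proof -
  have [measurable]: "D \<in> borel_measurable lborel" "c \<in> borel_measurable lborel"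
    using assms by (auto simp: Lq2_iff)
  have "integrable (lborel \<Otimes>\<^sub>M lborel) (\<lambda>z. (c (snd z) * D (fst z))\<^sup>2)"
  proof (rule lborel_pair.Fubini_integrable)
    show "integrable lborel (\<lambda>x. LINT y|lborel. norm ((c (snd (x, y)) * D (fst (x, y)))\<^sup>2))"
      using assms by (simp add: Lq2_iff power_mult_distrib)
    show "AE x in lborel. integrable lborel (\<lambda>y. (c (snd (x, y)) * D (fst (x, y)))\<^sup>2)"
      using assms by (simp add: Lq2_iff power_mult_distrib)
  qed measurable
  moreover have "(\<lambda>z. c (snd z) * D (fst z)) \<in> borel_measurable (lborel \<Otimes>\<^sub>M lborel)"
    by measurable
  ultimately show ?thesis by (simp add: Lq2_iff lborel_prod)
qed

text \<open>\<open>E\<close> stands for the functions that a derivative or a weight produces from eigenfunctions with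
  eigenvalues \<open>\<mu>\<close>; the bound says that this operation is dominated by the graph norm.\<close>

definition controlled ::
    "'i set \<Rightarrow> ('i \<Rightarrow> real) \<Rightarrow> real \<Rightarrow> ('i \<Rightarrow> 'a::euclidean_space \<Rightarrow> real) \<Rightarrow> bool" where
  "controlled I \<mu> \<kappa> E \<longleftrightarrow> (\<forall>i\<in>I. E i \<in> Lq 2 lborel) \<and>
     (\<forall>L b. finite L \<longrightarrow> L \<subseteq> I \<longrightarrow>
        sqnorm lborel (\<lambda>x. \<Sum>i\<in>L. b i * E i x) \<le> \<kappa> * (\<Sum>i\<in>L. (1 + (\<mu> i)\<^sup>2) * (b i)\<^sup>2))"

lemma controlledD: "controlled I \<mu> \<kappa> E \<Longrightarrow> i \<in> I \<Longrightarrow> E i \<in> Lq 2 lborel"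
  by (simp add: controlled_def)

text \<open>Here \<open>U\<close> and \<open>G\<close> play the role of a function \<open>u\<close> of $(x,t)$ and of an operator with
  eigenfunctions \<open>e i\<close> and eigenvalues \<open>\<mu> i\<close> applied to \<open>u\<close> in \<open>x\<close>. The operator enters
  only through the coefficients of \<open>G\<close>.\<close>

locale slice_expansion =
  fixes I :: "'i set" and J :: "nat \<Rightarrow> 'i set"
    and e :: "'i \<Rightarrow> 'a::euclidean_space \<Rightarrow> real" and \<mu> :: "'i \<Rightarrow> real"
    and U G :: "'a \<times> real \<Rightarrow> real"
  assumes on: "orthonormal lborel I e"
    and J_inc: "incseq J" and J_fin: "\<And>k. finite (J k)" and J_un: "(\<Union>k. J k) = I"
    and U: "U \<in> Lq 2 lborel" and G: "G \<in> Lq 2 lborel"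
    and slice: "AE t in lborel. \<forall>i\<in>I. L2_inner lborel (\<lambda>x. G (x, t)) (e i)
        = \<mu> i * L2_inner lborel (\<lambda>x. U (x, t)) (e i)"
begin

definition c :: "'i \<Rightarrow> real \<Rightarrow> real" where
  "c i t = L2_inner lborel (\<lambda>x. U (x, t)) (e i)"

definition partial_sum :: "('i \<Rightarrow> 'a \<Rightarrow> real) \<Rightarrow> nat \<Rightarrow> 'a \<times> real \<Rightarrow> real" where
  "partial_sum E k z = (\<Sum>i\<in>J k. c i (snd z) * E i (fst z))"

lemma J_sub: "J k \<subseteq> I"
  using J_un by auto

lemma e_L2: "i \<in> I \<Longrightarrow> e i \<in> Lq 2 lborel"
  using on by (simp add: orthonormal_def)

lemma c_measurable [measurable]:
  assumes "i \<in> I" shows "c i \<in> borel_measurable lborel"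
proof -
  have [measurable]: "U \<in> borel_measurable (lborel \<Otimes>\<^sub>M lborel)"
    using U by (simp add: Lq2_iff lborel_prod)
  have [measurable]: "e i \<in> borel_measurable lborel"
    using e_L2[OF assms] by (simp add: Lq2_iff)
  show ?thesis
    unfolding c_def[abs_def] L2_inner_def
    by (rule lborel.borel_measurable_lebesgue_integral) measurable
qed

text \<open>Bessel's inequality for \<open>U\<close> and for \<open>G\<close>. The exceptional set does not depend on the index set.\<close>

lemma coefficient_bound:
  "AE t in lborel. \<forall>L. finite L \<longrightarrow> L \<subseteq> I \<longrightarrow>
     (\<Sum>i\<in>L. (1 + (\<mu> i)\<^sup>2) * (c i t)\<^sup>2)
       \<le> sqnorm lborel (\<lambda>x. U (x, t)) + sqnorm lborel (\<lambda>x. G (x, t))"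
  using slice Lq2_slices(1)[OF U] Lq2_slices(1)[OF G]
proof eventually_elim
  case (elim t)
  show ?case
  proof (intro allI impI)
    fix L assume L: "finite L" "L \<subseteq> I"
    have "(\<Sum>i\<in>L. (1 + (\<mu> i)\<^sup>2) * (c i t)\<^sup>2) = (\<Sum>i\<in>L. (c i t)\<^sup>2) + (\<Sum>i\<in>L. (\<mu> i * c i t)\<^sup>2)"
      by (simp add: sum.distrib[symmetric] algebra_simps power_mult_distrib)
    also have "(\<Sum>i\<in>L. (\<mu> i * c i t)\<^sup>2) = (\<Sum>i\<in>L. (L2_inner lborel (\<lambda>x. G (x, t)) (e i))\<^sup>2)"
      using elim L unfolding c_def by (intro sum.cong) auto
    finally show "(\<Sum>i\<in>L. (1 + (\<mu> i)\<^sup>2) * (c i t)\<^sup>2)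
       \<le> sqnorm lborel (\<lambda>x. U (x, t)) + sqnorm lborel (\<lambda>x. G (x, t))"
      using Bessel_le[OF on L elim(2)] Bessel_le[OF on L elim(3)] unfolding c_def by linarith
  qed
qed

lemma c_L2:
  assumes "i \<in> I" shows "c i \<in> Lq 2 lborel"
proof -
  note c_measurable[OF assms, measurable]
  have i: "integrable lborel (\<lambda>t. sqnorm lborel (\<lambda>x. U (x, t)) + sqnorm lborel (\<lambda>x. G (x, t)))"
    using Lq2_slices(2) U G by (intro Bochner_Integration.integrable_add) auto
  have "integrable lborel (\<lambda>t. (c i t)\<^sup>2)"
  proof (rule Bochner_Integration.integrable_bound[OF i])
    show "AE t in lborel. norm ((c i t)\<^sup>2)
        \<le> norm (sqnorm lborel (\<lambda>x. U (x, t)) + sqnorm lborel (\<lambda>x. G (x, t)))"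
      using coefficient_bound
    proof eventually_elim
      case (elim t)
      have "(c i t)\<^sup>2 \<le> (1 + (\<mu> i)\<^sup>2) * (c i t)\<^sup>2" by (simp add: algebra_simps)
      also have "\<dots> \<le> sqnorm lborel (\<lambda>x. U (x, t)) + sqnorm lborel (\<lambda>x. G (x, t))"
        using elim[rule_format, of "{i}"] assms by simp
      finally show ?case by simp
    qed
  qed measurable
  then show ?thesis using c_measurable[OF assms] by (simp add: Lq2_iff)
qed

lemma integrated_coefficient_bound:
  assumes "finite L" "L \<subseteq> I"
  shows "(\<Sum>i\<in>L. (1 + (\<mu> i)\<^sup>2) * sqnorm lborel (c i)) \<le> sqnorm lborel U + sqnorm lborel G"
proof -
  have c: "integrable lborel (\<lambda>t. (c i t)\<^sup>2)" if "i \<in> L" for i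
    using c_L2 assms that by (auto simp: Lq2_iff)
  have "(\<Sum>i\<in>L. (1 + (\<mu> i)\<^sup>2) * sqnorm lborel (c i)) = (LINT t|lborel. (\<Sum>i\<in>L. (1 + (\<mu> i)\<^sup>2) * (c i t)\<^sup>2))"
    using c by (subst Bochner_Integration.integral_sum) (auto simp: sqnorm_eq)
  also have "\<dots> \<le> (LINT t|lborel. sqnorm lborel (\<lambda>x. U (x, t)) + sqnorm lborel (\<lambda>x. G (x, t)))"
    using coefficient_bound Lq2_slices(2) U G c assms
    by (intro integral_mono_AE Bochner_Integration.integrable_add Bochner_Integration.integrable_sum) auto
  also have "\<dots> = sqnorm lborel U + sqnorm lborel G"
    by (subst Bochner_Integration.integral_add)
      (simp_all add: Lq2_slices(2,3)[OF U] Lq2_slices(2,3)[OF G])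
  finally show ?thesis .
qed

lemma product_L2:
  assumes "i \<in> I" "E \<in> Lq 2 lborel"
  shows "(\<lambda>z. c i (snd z) * E (fst z)) \<in> Lq 2 (lborel :: ('a \<times> real) measure)"
  using Lq2_product[OF assms(2) c_L2[OF assms(1)]] .

lemma partial_sum_L2:
  assumes "\<And>i. i \<in> I \<Longrightarrow> E i \<in> Lq 2 lborel"
  shows "partial_sum E k \<in> Lq 2 lborel"
  unfolding partial_sum_def[abs_def] using J_sub assms by (intro Lq2_sum product_L2) auto

text \<open>Integrated over \<open>t\<close>, the bound on a controlled system is a bound by the convergent series of the
  coefficients.\<close>

theorem controlled_limit:
  assumes ctrl: "controlled I \<mu> \<kappa> E" and \<kappa>: "0 \<le> \<kappa>"
  shows "\<exists>w\<in>Lq 2 lborel. (\<lambda>k. sqnorm lborel (\<lambda>z. partial_sum E k z - w z)) \<longlonglongrightarrow> 0"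
  unfolding partial_sum_def
proof (rule L2_block_limit[where I=I])
  show "(\<lambda>z. c i (snd z) * E i (fst z)) \<in> Lq 2 lborel" if "i \<in> I" for i
    using product_L2[OF that controlledD[OF ctrl that]] .
  show "sqnorm lborel (\<lambda>z. \<Sum>i\<in>L. c i (snd z) * E i (fst z))
      \<le> (\<Sum>i\<in>L. \<kappa> * ((1 + (\<mu> i)\<^sup>2) * sqnorm lborel (c i)))" if L: "finite L" "L \<subseteq> I" for L
  proof -
    define F where "F z = (\<Sum>i\<in>L. c i (snd z) * E i (fst z))" for z :: "'a \<times> real"
    have F: "F \<in> Lq 2 lborel"
      unfolding F_def[abs_def] using L controlledD[OF ctrl] by (intro Lq2_sum product_L2) auto
    have c: "integrable lborel (\<lambda>t. (c i t)\<^sup>2)" if "i \<in> L" for i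
      using c_L2 L that by (auto simp: Lq2_iff)
    have "sqnorm lborel F = (LINT t|lborel. sqnorm lborel (\<lambda>x. F (x, t)))"
      using Lq2_slices(3)[OF F] by simp
    also have "\<dots> \<le> (LINT t|lborel. \<kappa> * (\<Sum>i\<in>L. (1 + (\<mu> i)\<^sup>2) * (c i t)\<^sup>2))"
      using ctrl L Lq2_slices(2)[OF F] c
      by (intro integral_mono) (auto simp: F_def controlled_def)
    also have "\<dots> = (\<Sum>i\<in>L. \<kappa> * ((1 + (\<mu> i)\<^sup>2) * sqnorm lborel (c i)))"
      using c by (simp add: sqnorm_eq sum_distrib_left)
    finally show ?thesis unfolding F_def .
  qed
  show "(\<Sum>i\<in>J k. \<kappa> * ((1 + (\<mu> i)\<^sup>2) * sqnorm lborel (c i))) \<le> \<kappa> * (sqnorm lborel U + sqnorm lborel G)" for k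
    using mult_left_mono[OF integrated_coefficient_bound[OF J_fin J_sub] \<kappa>]
    by (simp add: sum_distrib_left)
qed (use J_inc J_fin J_sub in auto)

text \<open>Each slice is expanded separately, and Bessel's inequality provides the dominating function of \<open>t\<close>.\<close>

theorem expansion_converges:
  assumes total: "\<And>f. f \<in> Lq 2 lborel \<Longrightarrow> (\<And>i. i \<in> I \<Longrightarrow> L2_inner lborel f (e i) = 0) \<Longrightarrow>
      AE x in lborel. f x = 0"
  shows "(\<lambda>k. sqnorm lborel (\<lambda>z. partial_sum e k z - U z)) \<longlonglongrightarrow> 0"
proof -
  define R where "R k z = U z - partial_sum e k z" for k z
  have R: "R k \<in> Lq 2 lborel" for k
    unfolding R_def[abs_def] by (intro Lq2_diff U partial_sum_L2 e_L2)
  have "(\<lambda>k. LINT t|lborel. sqnorm lborel (\<lambda>x. R k (x, t))) \<longlonglongrightarrow> (LINT t|(lborel :: real measure). (0::real))"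
  proof (rule integral_dominated_convergence[where w="\<lambda>t. sqnorm lborel (\<lambda>x. U (x, t))"])
    show "integrable lborel (\<lambda>t. sqnorm lborel (\<lambda>x. U (x, t)))"
      by (rule Lq2_slices(2)[OF U])
    show "(\<lambda>t. sqnorm lborel (\<lambda>x. R k (x, t))) \<in> borel_measurable lborel" for k
      using Lq2_slices(2)[OF R] by (rule borel_measurable_integrable)
    show "AE t in lborel. (\<lambda>k. sqnorm lborel (\<lambda>x. R k (x, t))) \<longlonglongrightarrow> 0"
      using Lq2_slices(1)[OF U]
    proof eventually_elim
      case (elim t)
      show ?case
        using total_expansion[OF on J_inc J_fin J_un total elim]
        by (simp add: R_def partial_sum_def c_def)
    qed
    show "AE t in lborel. norm (sqnorm lborel (\<lambda>x. R k (x, t))) \<le> sqnorm lborel (\<lambda>x. U (x, t))" for k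
      using Lq2_slices(1)[OF U]
    proof eventually_elim
      case (elim t)
      have "sqnorm lborel (\<lambda>x. R k (x, t)) \<le> sqnorm lborel (\<lambda>x. U (x, t))"
        using Bessel[OF on J_fin J_sub elim, of k]
        by (simp add: R_def partial_sum_def c_def sum_nonneg)
      then show ?case using sqnorm_nonneg[of lborel "\<lambda>x. R k (x, t)"] by simp
    qed
  qed measurable
  then have "(\<lambda>k. sqnorm lborel (R k)) \<longlonglongrightarrow> 0"
    using Lq2_slices(3)[OF R] by simp
  then show ?thesis
    unfolding R_def[abs_def] by (simp add: sqnorm_minus[of _ U])
qed

end

section \<open>Smooth functions and test functions\<close>

definition smooth :: "('a::euclidean_space \<Rightarrow> real) \<Rightarrow> bool" where
  "smooth f \<longleftrightarrow> (\<forall>k. C_k k f)"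

lemma pd_eq: "(f has_derivative f') (at x) \<Longrightarrow> pd v f x = f' v"
  unfolding pd_def using frechet_derivative_at by metis

lemma pd_scaleR:
  assumes "f differentiable (at x)"
  shows "pd (s *\<^sub>R v) f x = pd v f x * s"
proof -
  have "linear (\<lambda>v. pd v f x)"
    using assms unfolding pd_def by (rule linear_frechet_derivative)
  then show ?thesis using linear_scale[of "\<lambda>v. pd v f x" s v] by simp
qed

lemma pd_real: "(f has_real_derivative y) (at x) \<Longrightarrow> pd 1 f x = y"
  using pd_eq[of f "(*) y" x 1] by (simp add: has_field_derivative_def)

lemma pd_has_derivative:
  "f differentiable (at x) \<Longrightarrow> (f has_derivative (\<lambda>v. pd v f x)) (at x)"
  unfolding pd_def by (simp add: frechet_derivative_works)

lemma pd_has_real_derivative: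
  "f differentiable (at x) \<Longrightarrow> (f has_real_derivative pd 1 f x) (at x)"
  using has_field_derivative_def pd_real real_differentiable_def by metis

lemma pd_add:
  assumes "f differentiable (at x)" "g differentiable (at x)"
  shows "pd v (\<lambda>x. f x + g x) x = pd v f x + pd v g x"
  by (rule pd_eq[OF has_derivative_add[OF assms[THEN pd_has_derivative]]])

lemma pd_mult:
  assumes "f differentiable (at x)" "g differentiable (at x)"
  shows "pd v (\<lambda>x. f x * g x) x = f x * pd v g x + pd v f x * g x"
  by (rule pd_eq[OF has_derivative_mult[OF assms[THEN pd_has_derivative]]])

lemma pd_const: "pd v (\<lambda>x. c) x = 0"
  by (rule pd_eq) simp

lemma pd_linear: "bounded_linear f \<Longrightarrow> pd v f x = f v"
  by (rule pd_eq) (rule bounded_linear_imp_has_derivative)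

lemma pd_comp:
  fixes g :: "real \<Rightarrow> real"
  assumes "f differentiable (at x)" "g differentiable (at (f x))"
  shows "pd v (\<lambda>x. g (f x)) x = pd 1 g (f x) * pd v f x"
proof (rule pd_eq)
  have "(g has_derivative (\<lambda>h. pd 1 g (f x) * h)) (at (f x))"
    using pd_has_real_derivative[OF assms(2)] by (simp add: has_field_derivative_def)
  from has_derivative_compose[OF pd_has_derivative[OF assms(1)] this]
  show "((\<lambda>x. g (f x)) has_derivative (\<lambda>v. pd 1 g (f x) * pd v f x)) (at x)" .
qed

lemma pd_sum:
  assumes "\<And>i. i \<in> J \<Longrightarrow> f i differentiable (at x)"
  shows "pd v (\<lambda>x. \<Sum>i\<in>J. f i x) x = (\<Sum>i\<in>J. pd v (f i) x)"
  by (rule pd_eq[OF has_derivative_sum]) (use assms pd_has_derivative in blast)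

lemma differentiable_continuous:
  fixes f :: "'a::euclidean_space \<Rightarrow> real"
  shows "(\<And>x. f differentiable (at x)) \<Longrightarrow> continuous_on A f"
  by (intro continuous_at_imp_continuous_on ballI differentiable_imp_continuous_within)

lemma has_real_derivative_continuous:
  "(\<And>x. (f has_real_derivative f1 x) (at x)) \<Longrightarrow> continuous_on UNIV f"
  by (rule DERIV_continuous_on) (auto intro: has_field_derivative_at_within)

lemma C_k_imp_continuous: "C_k k f \<Longrightarrow> continuous_on UNIV f"
  by (cases k) (auto intro: differentiable_continuous)

lemma bounded_cball_0:
  fixes S :: "'a::real_normed_vector set"
  assumes "bounded S" obtains R where "R > 0" "S \<subseteq> cball 0 R"
  using bounded_subset_ballD[OF assms, of 0] ball_subset_cball by (metis order.trans)

lemma C_k_Suc_imp: "C_k (Suc k) f \<Longrightarrow> C_k k f"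
proof (induction k arbitrary: f)
  case 0
  then show ?case using C_k_imp_continuous[OF 0] by (simp del: C_k.simps(2))
qed auto

lemma C_k_add: "C_k k f \<Longrightarrow> C_k k g \<Longrightarrow> C_k k (\<lambda>x. f x + g x)"
proof (induction k arbitrary: f g)
  case 0
  then show ?case by (auto intro: continuous_intros)
next
  case (Suc k)
  then have "pd b (\<lambda>x. f x + g x) = (\<lambda>x. pd b f x + pd b g x)" for b
    by (auto simp: pd_add)
  then show ?case using Suc by (auto intro: derivative_intros)
qed

lemma C_k_mult: "C_k k f \<Longrightarrow> C_k k g \<Longrightarrow> C_k k (\<lambda>x. f x * g x)"
proof (induction k arbitrary: f g)
  case 0
  then show ?case by (auto intro: continuous_intros)
next
  case (Suc k)
  then have "pd b (\<lambda>x. f x * g x) = (\<lambda>x. f x * pd b g x + pd b f x * g x)" for b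
    by (auto simp: pd_mult)
  then show ?case
    using Suc C_k_Suc_imp[OF Suc.prems(1)] C_k_Suc_imp[OF Suc.prems(2)]
    by (auto intro: derivative_intros C_k_add)
qed

lemma C_k_const: "C_k k (\<lambda>x. c)"
proof (induction k arbitrary: c)
  case (Suc k)
  have "pd b (\<lambda>x. c) = (\<lambda>x. 0)" for b :: 'a
    by (auto simp: pd_const)
  then show ?case using Suc by auto
qed simp

lemma smooth_const: "smooth (\<lambda>x. c)"
  by (simp add: smooth_def C_k_const)

lemma smooth_add: "smooth f \<Longrightarrow> smooth g \<Longrightarrow> smooth (\<lambda>x. f x + g x)"
  by (simp add: smooth_def C_k_add)

lemma smooth_mult: "smooth f \<Longrightarrow> smooth g \<Longrightarrow> smooth (\<lambda>x. f x * g x)"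
  by (simp add: smooth_def C_k_mult)

lemma smooth_sum: "(\<And>i. i \<in> J \<Longrightarrow> smooth (f i)) \<Longrightarrow> smooth (\<lambda>x. \<Sum>i\<in>J. f i x)"
  by (induction J rule: infinite_finite_induct) (auto simp: smooth_const smooth_add)

lemma smooth_power: "smooth f \<Longrightarrow> smooth (\<lambda>x. f x ^ n)"
  by (induction n) (auto simp: smooth_const smooth_mult)

lemma smooth_linear:
  assumes "bounded_linear f" shows "smooth f"
proof -
  have "C_k k f" for k
  proof (cases k)
    case 0
    then show ?thesis using linear_continuous_on[OF assms] by simp
  next
    case (Suc k)
    have "pd b f = (\<lambda>x. f b)" for b using pd_linear[OF assms] by auto
    then show ?thesis
      using assms by (simp add: Suc C_k_const bounded_linear_imp_differentiable)
  qed
  then show ?thesis by (simp add: smooth_def)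
qed

lemma smooth_differentiable: "smooth f \<Longrightarrow> f differentiable (at x)"
  unfolding smooth_def by (metis C_k.simps(2))

lemma smooth_pd: "smooth f \<Longrightarrow> b \<in> Basis \<Longrightarrow> smooth (pd b f)"
  unfolding smooth_def by (metis C_k.simps(2))

lemma smooth_continuous: "smooth f \<Longrightarrow> continuous_on A f"
  unfolding smooth_def using C_k.simps(1) continuous_on_subset by blast

lemma C_k_comp:
  fixes g :: "real \<Rightarrow> real"
  assumes "smooth g" "C_k k f"
  shows "C_k k (\<lambda>x. g (f x))"
  using assms
proof (induction k arbitrary: f g)
  case 0
  then show ?case
    using continuous_on_compose2[OF smooth_continuous[of g UNIV]] by auto
next
  case (Suc k)
  have "pd b (\<lambda>x. g (f x)) = (\<lambda>x. pd 1 g (f x) * pd b f x)" for b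
    using Suc.prems by (auto simp: pd_comp smooth_differentiable)
  moreover have "(\<lambda>x. g (f x)) differentiable (at x)" for x
    using Suc.prems differentiable_chain_at[of f x g] smooth_differentiable[OF Suc.prems(1)]
    by (auto simp: o_def)
  moreover have "smooth (pd 1 g)" using Suc.prems(1) by (simp add: smooth_pd)
  ultimately show ?case
    using Suc C_k_Suc_imp[OF Suc.prems(2)] by (auto intro!: C_k_mult)
qed

lemma smooth_comp: "smooth (g :: real \<Rightarrow> real) \<Longrightarrow> smooth f \<Longrightarrow> smooth (\<lambda>x. g (f x))"
  unfolding smooth_def[of f] smooth_def[of "\<lambda>x. g (f x)"] by (auto intro: C_k_comp)

text \<open>The functions $y^{-n} e^{-1/y}$ on the half-line, extended by zero. Their derivatives are
  linear combinations of functions of the same family, which gives smoothness.\<close>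

definition flat :: "nat \<Rightarrow> real \<Rightarrow> real" where
  "flat n y = (if y > 0 then (1 / y) ^ n * exp (- 1 / y) else 0)"

lemma flat_tendsto_0: "(flat n \<longlongrightarrow> 0) (at_right 0)"
proof -
  have "((\<lambda>y. y ^ n / exp y) \<longlongrightarrow> (0::real)) at_top"
    by (rule tendsto_power_div_exp_0)
  then have "((\<lambda>y. (inverse y) ^ n / exp (inverse y)) \<longlongrightarrow> (0::real)) (at_right 0)"
    by (rule filterlim_compose[OF _ filterlim_inverse_at_top_right])
  moreover have "\<forall>\<^sub>F y in at_right 0. (inverse y) ^ n / exp (inverse y) = flat n y"
    using eventually_at_right_less[of 0]
    by eventually_elim (simp add: flat_def exp_minus field_simps)
  ultimately show ?thesis by (rule Lim_transform_eventually)
qed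

lemma flat_deriv: "(flat n has_real_derivative - real n * flat (Suc n) y + flat (Suc (Suc n)) y) (at y)"
proof -
  consider "y < 0" | "y = 0" | "y > 0" by linarith
  then show ?thesis
  proof cases
    case 1
    have "(flat n has_real_derivative 0) (at y)"
    proof (rule has_field_derivative_transform_within)
      show "((\<lambda>_. 0) has_real_derivative 0) (at y)" by simp
    next
      show "0 < - y" using 1 by simp
      fix z assume "dist z y < - y"
      then show "0 = flat n z" using 1 by (auto simp: flat_def dist_real_def)
    qed simp
    then show ?thesis using 1 by (simp add: flat_def)
  next
    case 2
    have "((\<lambda>h. flat n h / h) \<longlongrightarrow> 0) (at 0)"
    proof (rule filterlim_split_at)
      show "((\<lambda>h. flat n h / h) \<longlongrightarrow> 0) (at_left 0)"
      proof (rule tendsto_eventually)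
        show "\<forall>\<^sub>F h in at_left 0. flat n h / h = 0"
          by (auto simp: eventually_at_filter flat_def)
      qed
      show "((\<lambda>h. flat n h / h) \<longlongrightarrow> 0) (at_right 0)"
      proof (rule Lim_transform_eventually[OF flat_tendsto_0[of "Suc n"]])
        show "\<forall>\<^sub>F h in at_right 0. flat (Suc n) h = flat n h / h"
          using eventually_at_right_less[of 0] by eventually_elim (simp add: flat_def)
      qed
    qed
    then show ?thesis using 2 by (simp add: has_field_derivative_iff flat_def)
  next
    case 3
    have "((\<lambda>z. (1 / z) ^ n * exp (- 1 / z)) has_real_derivative
        - real n * flat (Suc n) y + flat (Suc (Suc n)) y) (at y)"
    proof (cases n)
      case 0
      then show ?thesis using 3
        by (auto intro!: derivative_eq_intros simp: flat_def field_simps power2_eq_square)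
    next
      case (Suc k)
      have "((\<lambda>z. 1 / z) has_real_derivative - ((1 / y) * (1 / y))) (at y)"
        using 3 by (auto intro!: derivative_eq_intros)
      moreover have "((\<lambda>z. exp (- 1 / z)) has_real_derivative exp (- 1 / y) * ((1 / y) * (1 / y))) (at y)"
        using 3 by (auto intro!: derivative_eq_intros)
      ultimately show ?thesis
        unfolding Suc
        by (rule DERIV_cong[OF DERIV_mult[OF DERIV_power_Suc]]) (use 3 in \<open>simp add: flat_def field_simps\<close>)
    qed
    then show ?thesis
    proof (rule has_field_derivative_transform_within)
      fix z assume "dist z y < y"
      then show "(1 / z) ^ n * exp (- 1 / z) = flat n z"
        using 3 by (auto simp: flat_def dist_real_def)
    qed (use 3 in auto)
  qed
qed

lemma smooth_flat: "smooth (flat n)"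
proof -
  have d: "flat n differentiable (at y)" for n y
    using flat_deriv real_differentiable_def by blast
  have p: "pd 1 (flat n) = (\<lambda>y. - real n * flat (Suc n) y + flat (Suc (Suc n)) y)" for n
    using pd_real[OF flat_deriv] by auto
  have "C_k k (flat n)" for k
  proof (induction k arbitrary: n)
    case 0
    have "flat n differentiable_on UNIV"
      using d by (auto simp: differentiable_on_def)
    then show ?case by (simp add: differentiable_imp_continuous_on)
  next
    case (Suc k)
    have "C_k k (pd 1 (flat n))"
      unfolding p by (intro C_k_add C_k_mult C_k_const Suc)
    then show ?case using d by simp
  qed
  then show ?thesis by (simp add: smooth_def)
qed

definition bump :: "real \<Rightarrow> real" where
  "bump = flat 0"

lemma smooth_bump: "smooth bump"
  by (simp add: bump_def smooth_flat)

lemma bump_bounds: "0 \<le> bump y" "bump y \<le> 1" "y \<le> 0 \<Longrightarrow> bump y = 0"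
  by (auto simp: bump_def flat_def)

lemma bump_tendsto: "y > 0 \<Longrightarrow> (\<lambda>n. bump (real n * y)) \<longlonglongrightarrow> 1"
proof -
  assume y: "y > 0"
  have "(\<lambda>n. exp (- (1 / y) / real n)) \<longlonglongrightarrow> exp 0"
    by (intro tendsto_exp lim_const_over_n)
  moreover have "\<forall>\<^sub>F n in sequentially. exp (- (1 / y) / real n) = bump (real n * y)"
    using eventually_gt_at_top[of 0]
    by eventually_elim (use y in \<open>simp add: bump_def flat_def field_simps\<close>)
  ultimately show ?thesis using Lim_transform_eventually by fastforce
qed

lemma test_funI: "smooth f \<Longrightarrow> bounded {x. f x \<noteq> 0} \<Longrightarrow> f \<in> test_fun"
  by (simp add: test_fun_def smooth_def compact_closure)

lemma test_fun_smooth: "f \<in> test_fun \<Longrightarrow> smooth f"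
  by (simp add: test_fun_def smooth_def)

lemma test_fun_bounded: "f \<in> test_fun \<Longrightarrow> bounded {x. f x \<noteq> 0}"
  by (simp add: test_fun_def compact_closure)

lemma smooth_mult_test: "smooth f \<Longrightarrow> g \<in> test_fun \<Longrightarrow> (\<lambda>x. f x * g x) \<in> test_fun"
  by (rule test_funI)
    (auto intro: smooth_mult test_fun_smooth bounded_subset[OF test_fun_bounded[of g]])

lemma pd_support: "{x. pd b f x \<noteq> 0} \<subseteq> closure {x. f x \<noteq> 0}"
proof
  fix x assume x: "x \<in> {x. pd b f x \<noteq> 0}"
  show "x \<in> closure {x. f x \<noteq> 0}"
  proof (rule ccontr)
    assume n: "x \<notin> closure {x. f x \<noteq> 0}"
    have "(f has_derivative (\<lambda>_. 0)) (at x)"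
    proof (rule has_derivative_transform_within_open[of "\<lambda>_. 0"])
      show "open (- closure {x. f x \<noteq> 0})" by auto
      show "0 = f y" if "y \<in> - closure {x. f x \<noteq> 0}" for y
        using that closure_subset[of "{x. f x \<noteq> 0}"] by auto
    qed (use n in auto)
    then show False using x pd_eq by force
  qed
qed

lemma bounded_pd_support: "bounded {x. f x \<noteq> 0} \<Longrightarrow> bounded {x. pd b f x \<noteq> 0}"
  by (rule bounded_subset[OF bounded_closure pd_support])

lemma test_fun_pd: "f \<in> test_fun \<Longrightarrow> b \<in> Basis \<Longrightarrow> pd b f \<in> test_fun"
  by (rule test_funI[OF smooth_pd[OF test_fun_smooth] bounded_pd_support[OF test_fun_bounded]])

lemma test_fun_lin:
  assumes "f \<in> test_fun" "g \<in> test_fun"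
  shows "(\<lambda>x. f x + c * g x) \<in> test_fun"
proof (rule test_funI)
  show "smooth (\<lambda>x. f x + c * g x)"
    using assms by (intro smooth_add smooth_mult smooth_const test_fun_smooth)
  show "bounded {x. f x + c * g x \<noteq> 0}"
    by (rule bounded_subset[of "{x. f x \<noteq> 0} \<union> {x. g x \<noteq> 0}"])
      (use assms test_fun_bounded in auto)
qed

section \<open>Integration by parts\<close>

lemma integrable_continuous_bounded_support:
  fixes f :: "'a::euclidean_space \<Rightarrow> real"
  assumes "continuous_on UNIV f" "bounded {x. f x \<noteq> 0}"
  shows "integrable lborel f"
proof -
  obtain R where R: "{x. f x \<noteq> 0} \<subseteq> cball 0 R"
    using bounded_cball_0[OF assms(2)] by metis
  have "integrable lborel (\<lambda>x. indicator (cball 0 R) x *\<^sub>R f x)"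
    by (rule borel_integrable_compact[OF compact_cball continuous_on_subset[OF assms(1) subset_UNIV]])
  also have "(\<lambda>x. indicator (cball 0 R) x *\<^sub>R f x) = f"
  proof
    fix x show "indicator (cball 0 R) x *\<^sub>R f x = f x"
      using R by (cases "x \<in> cball 0 R") auto
  qed
  finally show ?thesis .
qed

lemma Lq2_continuous_bounded_support:
  fixes f :: "'a::euclidean_space \<Rightarrow> real"
  assumes "continuous_on UNIV f" "bounded {x. f x \<noteq> 0}"
  shows "f \<in> Lq 2 lborel"
proof -
  have "integrable lborel (\<lambda>x. (f x)\<^sup>2)"
    using assms by (intro integrable_continuous_bounded_support continuous_intros) auto
  then show ?thesis
    using borel_measurable_continuous_onI[OF assms(1)] by (simp add: Lq2_iff)
qed

text \<open>The difference quotients of \<open>f\<close> have integral zero by translation invariance of Lebesgue measure;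
  they are bounded by the mean value theorem and supported in a fixed ball.\<close>

lemma integral_pd_zero:
  fixes f :: "'a::euclidean_space \<Rightarrow> real"
  assumes d: "\<And>x. f differentiable (at x)" and c: "continuous_on UNIV (pd b f)"
    and s: "bounded {x. f x \<noteq> 0}"
  shows "(LINT x|lborel. pd b f x) = 0"
proof -
  have fc: "continuous_on UNIV f"
    by (rule differentiable_continuous[OF d])
  have fi: "integrable lborel f"
    using integrable_continuous_bounded_support[OF fc s] .
  obtain R where R: "{x. f x \<noteq> 0} \<subseteq> cball 0 R" "R > 0"
    using bounded_cball_0[OF s] by metis
  define B where "B = cball (0::'a) (R + norm b)"
  have "compact (pd b f ` cball 0 (R + 2 * norm b))"
    by (rule compact_continuous_image[OF continuous_on_subset[OF c subset_UNIV] compact_cball])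
  from compact_imp_bounded[OF this] obtain K
    where "\<forall>y\<in>pd b f ` cball 0 (R + 2 * norm b). \<bar>y\<bar> \<le> K"
    unfolding bounded_real by blast
  then have K: "\<bar>pd b f x\<bar> \<le> K" if "x \<in> cball 0 (R + 2 * norm b)" for x
    using that by blast
  have sh: "f x = 0" if "norm x > R" for x using R that by auto
  define q where "q n x = real (Suc n) * (f (x + (1 / real (Suc n)) *\<^sub>R b) - f x)" for n x
  have "(LINT x|lborel. q n x) = 0" for n
  proof -
    have i2: "integrable lborel (\<lambda>x. f (x + (1 / real (Suc n)) *\<^sub>R b))"
    proof (rule integrable_continuous_bounded_support)
      show "continuous_on UNIV (\<lambda>x. f (x + (1 / real (Suc n)) *\<^sub>R b))"
        by (rule continuous_on_compose2[OF fc]) (auto intro!: continuous_intros)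
      have "{x. f (x + (1 / real (Suc n)) *\<^sub>R b) \<noteq> 0} = (\<lambda>x. - ((1 / real (Suc n)) *\<^sub>R b) + x) ` {x. f x \<noteq> 0}"
        by (force simp: image_iff algebra_simps)
      then show "bounded {x. f (x + (1 / real (Suc n)) *\<^sub>R b) \<noteq> 0}"
        by (simp only: bounded_translation[OF s])
    qed
    have "(LINT x|lborel. f (x + (1 / real (Suc n)) *\<^sub>R b)) = (LINT x|distr lborel borel ((+) ((1 / real (Suc n)) *\<^sub>R b)). f x)"
      using borel_measurable_continuous_onI[OF fc]
      by (subst integral_distr) (auto simp: add.commute)
    also have "\<dots> = (LINT x|lborel. f x)" by (simp add: lborel_distr_plus)
    finally show ?thesis using i2 fi by (simp add: q_def)
  qed
  moreover have "(\<lambda>n. LINT x|lborel. q n x) \<longlonglongrightarrow> (LINT x|lborel. pd b f x)"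
  proof (rule integral_dominated_convergence[where w="\<lambda>x. K * indicator B x"])
    show "integrable lborel (\<lambda>x. K * indicator B x)"
      unfolding B_def
      by (intro integrable_mult_right integrable_real_indicator emeasure_lborel_cball_finite) simp
    show "pd b f \<in> borel_measurable lborel"
      using borel_measurable_continuous_onI[OF c] by simp
    have "continuous_on UNIV (q n)" for n
      unfolding q_def[abs_def]
      by (intro continuous_intros continuous_on_compose2[OF fc]) auto
    then show "q n \<in> borel_measurable lborel" for n
      by (simp add: borel_measurable_continuous_onI)
    show "AE x in lborel. (\<lambda>n. q n x) \<longlonglongrightarrow> pd b f x"
    proof (intro AE_I2)
      fix x
      have "((\<lambda>s. f (x + s *\<^sub>R b)) has_real_derivative pd b f x) (at 0)"
      proof -
        have "((\<lambda>s. x + s *\<^sub>R b) has_derivative (\<lambda>s. s *\<^sub>R b)) (at 0)"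
          by (auto intro!: derivative_eq_intros)
        then have "((\<lambda>s. f (x + s *\<^sub>R b)) has_derivative (\<lambda>s. pd (s *\<^sub>R b) f x)) (at 0)"
          using has_derivative_compose[of "\<lambda>s. x + s *\<^sub>R b" _ 0 UNIV f] pd_has_derivative[OF d[of x]]
          by simp
        then show ?thesis by (simp add: has_field_derivative_def pd_scaleR[OF d])
      qed
      then have D: "((\<lambda>h. (f (x + h *\<^sub>R b) - f x) / h) \<longlongrightarrow> pd b f x) (at 0)"
        by (simp add: has_field_derivative_iff)
      have "filterlim (\<lambda>n. 1 / real (Suc n)) (at 0) sequentially"
        using lim_inverse_n' LIMSEQ_Suc[OF lim_1_over_n]
        by (auto simp: filterlim_at)
      from filterlim_compose[OF D this]
      show "(\<lambda>n. q n x) \<longlonglongrightarrow> pd b f x" by (simp add: q_def mult.commute)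
    qed
    show "AE x in lborel. norm (q n x) \<le> K * indicator B x" for n
    proof (intro AE_I2)
      fix x
      have nb: "norm ((s / real (Suc n)) *\<^sub>R b) \<le> norm b" if "0 \<le> s" "s \<le> 1" for s
        using that mult_right_mono[of "s / real (Suc n)" 1 "norm b"] by (simp add: divide_le_eq)
      show "norm (q n x) \<le> K * indicator B x"
      proof (cases "x \<in> B")
        case False
        then have "norm x > R + norm b" by (simp add: B_def)
        moreover have "norm x \<le> norm (x + (1 / real (Suc n)) *\<^sub>R b) + norm ((1 / real (Suc n)) *\<^sub>R b)"
          using norm_triangle_ineq4[of "x + (1 / real (Suc n)) *\<^sub>R b" "(1 / real (Suc n)) *\<^sub>R b"]
          by simp
        ultimately have "norm (x + (1 / real (Suc n)) *\<^sub>R b) > R"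
          using nb[of 1] by simp
        moreover have "norm x > R" using \<open>norm x > R + norm b\<close> norm_ge_zero[of b] by linarith
        ultimately show ?thesis using False sh by (simp add: q_def)
      next
        case True
        define \<gamma> where "\<gamma> s = f (x + (s / real (Suc n)) *\<^sub>R b)" for s
        have g': "(\<gamma> has_real_derivative pd b f (x + (s / real (Suc n)) *\<^sub>R b) / real (Suc n)) (at s)" for s
        proof -
          let ?y = "x + (s / real (Suc n)) *\<^sub>R b"
          have "((\<lambda>s. x + (s / real (Suc n)) *\<^sub>R b) has_derivative (\<lambda>s. (s / real (Suc n)) *\<^sub>R b)) (at s)"
            by (auto intro!: derivative_eq_intros)
          then have "(\<gamma> has_derivative (\<lambda>s. pd ((s / real (Suc n)) *\<^sub>R b) f ?y)) (at s)"
            using has_derivative_compose[of "\<lambda>s. x + (s / real (Suc n)) *\<^sub>R b" _ s UNIV f] pd_has_derivative[OF d[of ?y]]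
            by (simp add: \<gamma>_def[abs_def])
          moreover have "(*) (pd b f ?y / real (Suc n)) = (\<lambda>s. pd ((s / real (Suc n)) *\<^sub>R b) f ?y)"
            by (auto simp: pd_scaleR[OF d])
          ultimately show ?thesis by (simp only: has_field_derivative_def)
        qed
        obtain z where z: "0 < z" "z < 1" "\<gamma> 1 - \<gamma> 0 = (1 - 0) * (pd b f (x + (z / real (Suc n)) *\<^sub>R b) / real (Suc n))"
          using MVT2[OF zero_less_one g'] by blast
        then have "q n x = pd b f (x + (z / real (Suc n)) *\<^sub>R b)"
          by (simp add: q_def \<gamma>_def)
        moreover have "x + (z / real (Suc n)) *\<^sub>R b \<in> cball 0 (R + 2 * norm b)"
        proof -
          have "norm (x + (z / real (Suc n)) *\<^sub>R b) \<le> norm x + norm ((z / real (Suc n)) *\<^sub>R b)"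
            by (rule norm_triangle_ineq)
          also have "\<dots> \<le> R + norm b + norm b"
            using True nb[of z] z by (intro add_mono) (auto simp: B_def)
          finally show ?thesis by simp
        qed
        ultimately show ?thesis using K True by simp
      qed
    qed
  qed
  ultimately show ?thesis using LIMSEQ_unique[OF tendsto_const] by force
qed

lemma integration_by_parts_pd:
  fixes f g :: "'a::euclidean_space \<Rightarrow> real"
  assumes f: "\<And>x. f differentiable (at x)" "continuous_on UNIV (pd b f)"
    and g: "\<And>x. g differentiable (at x)" "continuous_on UNIV (pd b g)" "bounded {x. g x \<noteq> 0}"
  shows "integrable lborel (\<lambda>x. f x * pd b g x)" "integrable lborel (\<lambda>x. pd b f x * g x)"
    "(LINT x|lborel. f x * pd b g x) = - (LINT x|lborel. pd b f x * g x)"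
proof -
  have fc: "continuous_on UNIV f" and gc: "continuous_on UNIV g"
    by (rule differentiable_continuous[OF f(1)], rule differentiable_continuous[OF g(1)])
  show i1: "integrable lborel (\<lambda>x. f x * pd b g x)"
    by (intro integrable_continuous_bounded_support continuous_intros fc g
        bounded_subset[OF bounded_pd_support[OF g(3), of b]]) auto
  show i2: "integrable lborel (\<lambda>x. pd b f x * g x)"
    by (intro integrable_continuous_bounded_support continuous_intros gc f
        bounded_subset[OF g(3)]) auto
  have p: "pd b (\<lambda>x. f x * g x) = (\<lambda>x. f x * pd b g x + pd b f x * g x)"
    using f g by (auto simp: pd_mult)
  have "(LINT x|lborel. pd b (\<lambda>x. f x * g x) x) = 0"
    by (intro integral_pd_zero derivative_intros f g bounded_subset[OF g(3)])
      (auto simp: p intro!: continuous_intros f g fc gc)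
  then show "(LINT x|lborel. f x * pd b g x) = - (LINT x|lborel. pd b f x * g x)"
    using i1 i2 by (simp add: p)
qed

context slice_expansion
begin

lemma test_slice:
  fixes \<psi> :: "'a \<times> real \<Rightarrow> real"
  assumes "\<psi> \<in> test_fun" "b \<in> Basis"
  shows "(\<lambda>x. \<psi> (x, t)) differentiable (at x)"
    "pd b (\<lambda>x. \<psi> (x, t)) = (\<lambda>x. pd (b, 0) \<psi> (x, t))"
    "continuous_on UNIV (\<lambda>x. pd (b, 0) \<psi> (x, t))"
    "bounded {x. \<psi> (x, t) \<noteq> 0}"
proof -
  have D: "((\<lambda>x. \<psi> (x, t)) has_derivative (\<lambda>v. pd (v, 0) \<psi> (x, t))) (at x)" for x
    using has_derivative_compose[OF has_derivative_Pair[OF has_derivative_ident has_derivative_const]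
        pd_has_derivative[OF smooth_differentiable[OF test_fun_smooth[OF assms(1)]]]] .
  show "(\<lambda>x. \<psi> (x, t)) differentiable (at x)"
    using D differentiable_def by blast
  show "pd b (\<lambda>x. \<psi> (x, t)) = (\<lambda>x. pd (b, 0) \<psi> (x, t))"
    using pd_eq[OF D] by auto
  have "(b, 0) \<in> (Basis :: ('a \<times> real) set)"
    using assms(2) by (auto simp: Basis_prod_def)
  then have "continuous_on UNIV (pd (b, 0) \<psi>)"
    using smooth_continuous[OF smooth_pd[OF test_fun_smooth[OF assms(1)]]] by blast
  then show "continuous_on UNIV (\<lambda>x. pd (b, 0) \<psi> (x, t))"
    by (rule continuous_on_compose2) (auto intro!: continuous_intros)
  have "{x. \<psi> (x, t) \<noteq> 0} \<subseteq> fst ` {z. \<psi> z \<noteq> 0}" by force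
  then show "bounded {x. \<psi> (x, t) \<noteq> 0}"
    by (rule bounded_subset[OF bounded_fst[OF test_fun_bounded[OF assms(1)]]])
qed

text \<open>Weak derivatives in \<open>x\<close> pass to the limit of the expansions. The factor \<open>\<rho>\<close> is the square
  root of the weight: the expansion of \<open>\<rho> u\<close> converges in the unweighted space, and the test
  function absorbs \<open>1 / \<rho>\<close> because its support is compact.\<close>

theorem weak_derivative_limit:
  fixes S DS :: "'i \<Rightarrow> 'a \<Rightarrow> real" and b :: 'a
  assumes b: "b \<in> Basis"
    and S: "\<And>i x. i \<in> I \<Longrightarrow> S i differentiable (at x)"
      "\<And>i x. i \<in> I \<Longrightarrow> DS i = pd b (S i)" "\<And>i. i \<in> I \<Longrightarrow> continuous_on UNIV (DS i)"
    and \<rho>: "continuous_on UNIV \<rho>" "\<And>x. 0 < \<rho> x"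
    and E: "\<And>i. i \<in> I \<Longrightarrow> (\<lambda>x. \<rho> x * S i x) \<in> Lq 2 lborel" "\<And>i. i \<in> I \<Longrightarrow> DS i \<in> Lq 2 lborel"
    and P: "P \<in> Lq 2 lborel" "(\<lambda>k. sqnorm lborel (\<lambda>z. partial_sum (\<lambda>i x. \<rho> x * S i x) k z - P z)) \<longlonglongrightarrow> 0"
    and w: "w \<in> Lq 2 lborel" "(\<lambda>k. sqnorm lborel (\<lambda>z. partial_sum DS k z - w z)) \<longlonglongrightarrow> 0"
    and \<psi>: "\<psi> \<in> test_fun"
  shows "(LINT z|lborel. P z / \<rho> (fst z) * pd (b, 0) \<psi> z) = - (LINT z|lborel. w z * \<psi> z)"
proof -
  have b0: "(b, 0) \<in> (Basis :: ('a \<times> real) set)"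
    using b by (auto simp: Basis_prod_def)
  note \<psi>b = test_fun_pd[OF \<psi> b0]
  define \<theta> where "\<theta> z = pd (b, 0) \<psi> z / \<rho> (fst z)" for z
  have \<rho>0: "\<rho> x \<noteq> 0" for x using \<rho>(2)[of x] by simp
  have "continuous_on UNIV \<theta>"
    unfolding \<theta>_def[abs_def] using \<rho>0
    by (intro continuous_intros smooth_continuous[OF test_fun_smooth[OF \<psi>b]]
        continuous_on_compose2[OF \<rho>(1)]) auto
  moreover have "bounded {z. \<theta> z \<noteq> 0}"
    by (rule bounded_subset[OF test_fun_bounded[OF \<psi>b]]) (auto simp: \<theta>_def)
  ultimately have \<theta>: "\<theta> \<in> Lq 2 lborel" by (rule Lq2_continuous_bounded_support)
  have \<psi>L: "\<psi> \<in> Lq 2 lborel"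
    by (intro Lq2_continuous_bounded_support smooth_continuous test_fun_smooth test_fun_bounded \<psi>)
  have step: "L2_inner lborel (\<lambda>z. c i (snd z) * (\<rho> (fst z) * S i (fst z))) \<theta>
      = - L2_inner lborel (\<lambda>z. c i (snd z) * DS i (fst z)) \<psi>" if i: "i \<in> I" for i
  proof -
    have eq: "(\<lambda>z. c i (snd z) * (\<rho> (fst z) * S i (fst z)) * \<theta> z)
        = (\<lambda>(x, t). c i t * S i x * pd (b, 0) \<psi> (x, t))"
      using \<rho>0 by (auto simp: \<theta>_def)
    have eq2: "(\<lambda>z. c i (snd z) * DS i (fst z) * \<psi> z) = (\<lambda>(x, t). c i t * DS i x * \<psi> (x, t))"
      by auto
    have i1: "integrable (lborel \<Otimes>\<^sub>M lborel) (\<lambda>(x, t). c i t * S i x * pd (b, 0) \<psi> (x, t))"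
      using Lq2_mult_integrable[OF product_L2[OF i E(1)[OF i]] \<theta>] unfolding eq lborel_prod .
    have i2: "integrable (lborel \<Otimes>\<^sub>M lborel) (\<lambda>(x, t). c i t * DS i x * \<psi> (x, t))"
      using Lq2_mult_integrable[OF product_L2[OF i E(2)[OF i]] \<psi>L] unfolding eq2 lborel_prod .
    have "(LINT x|lborel. c i t * S i x * pd (b, 0) \<psi> (x, t)) = - (LINT x|lborel. c i t * DS i x * \<psi> (x, t))" for t
      using integration_by_parts_pd(3)[of "S i" b "\<lambda>x. \<psi> (x, t)"] S[OF i] test_slice[OF \<psi> b, of t]
      by (simp add: mult.assoc)
    then show ?thesis
      unfolding L2_inner_def eq eq2 using lborel_pair.integral_snd[OF i1] lborel_pair.integral_snd[OF i2]
      by (simp add: lborel_prod)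
  qed
  have sums: "L2_inner lborel (partial_sum (\<lambda>i x. \<rho> x * S i x) k) \<theta> = - L2_inner lborel (partial_sum DS k) \<psi>" for k
  proof -
    have "L2_inner lborel (\<lambda>z. \<Sum>i\<in>J k. 1 * (c i (snd z) * (\<rho> (fst z) * S i (fst z)))) \<theta>
      = (\<Sum>i\<in>J k. 1 * L2_inner lborel (\<lambda>z. c i (snd z) * (\<rho> (fst z) * S i (fst z))) \<theta>)"
      using J_sub by (intro L2_inner_sum \<theta> product_L2 E) auto
    moreover have "L2_inner lborel (\<lambda>z. \<Sum>i\<in>J k. 1 * (c i (snd z) * DS i (fst z))) \<psi>
      = (\<Sum>i\<in>J k. 1 * L2_inner lborel (\<lambda>z. c i (snd z) * DS i (fst z)) \<psi>)"
      using J_sub by (intro L2_inner_sum \<psi>L product_L2 E) auto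
    moreover have "(\<Sum>i\<in>J k. L2_inner lborel (\<lambda>z. c i (snd z) * (\<rho> (fst z) * S i (fst z))) \<theta>)
      = (\<Sum>i\<in>J k. - L2_inner lborel (\<lambda>z. c i (snd z) * DS i (fst z)) \<psi>)"
      using J_sub step by (intro sum.cong) auto
    ultimately show ?thesis by (simp add: partial_sum_def[abs_def] sum_negf)
  qed
  have "(\<lambda>k. L2_inner lborel (partial_sum (\<lambda>i x. \<rho> x * S i x) k) \<theta>) \<longlonglongrightarrow> L2_inner lborel P \<theta>"
    by (rule L2_lim_inner[OF partial_sum_L2[OF E(1)] P(1) \<theta> P(2)])
  moreover have "(\<lambda>k. - L2_inner lborel (partial_sum DS k) \<psi>) \<longlonglongrightarrow> - L2_inner lborel w \<psi>"
    by (intro tendsto_minus L2_lim_inner[OF partial_sum_L2[OF E(2)] w(1) \<psi>L w(2)])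
  ultimately have "L2_inner lborel P \<theta> = - L2_inner lborel w \<psi>"
    unfolding sums using LIMSEQ_unique by blast
  then show ?thesis by (simp add: L2_inner_def \<theta>_def)
qed

end

section \<open>Distributional differential equations on the line\<close>

text \<open>Integrability on the intervals \<open>(- R, R)\<close> with a natural number \<open>R\<close> is enough, and it keeps
  exceptional null sets countable in number.\<close>

abbreviation loc_int :: "(real \<Rightarrow> real) \<Rightarrow> bool" where
  "loc_int f \<equiv> f \<in> borel_measurable borel \<and> (\<forall>R::nat. integrable lborel (\<lambda>y. indicator {- real R<..<real R} y * f y))"

lemma loc_int_mult_continuous:
  assumes "loc_int f" "continuous_on UNIV g" shows "loc_int (\<lambda>x. g x * f x)"
proof (intro conjI allI)
  have [measurable]: "f \<in> borel_measurable borel" "g \<in> borel_measurable borel"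
    using assms borel_measurable_continuous_onI by auto
  show "(\<lambda>x. g x * f x) \<in> borel_measurable borel" by measurable
  fix R :: nat
  have "compact (g ` {- real R..real R})"
    by (rule compact_continuous_image[OF continuous_on_subset[OF assms(2) subset_UNIV] compact_Icc])
  from compact_imp_bounded[OF this] obtain K where K: "\<forall>y\<in>g ` {- real R..real R}. \<bar>y\<bar> \<le> K"
    unfolding bounded_real by blast
  have i: "integrable lborel (\<lambda>y. K * (indicator {- real R<..<real R} y * f y))"
    using assms(1) by auto
  show "integrable lborel (\<lambda>y. indicator {- real R<..<real R} y * (g y * f y))"
  proof (rule Bochner_Integration.integrable_bound[OF i])
    show "AE y in lborel. norm (indicator {- real R<..<real R} y * (g y * f y)) \<le> norm (K * (indicator {- real R<..<real R} y * f y))"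
    proof (intro AE_I2)
      fix y
      show "norm (indicator {- real R<..<real R} y * (g y * f y)) \<le> norm (K * (indicator {- real R<..<real R} y * f y))"
      proof (cases "y \<in> {-real R<..<real R}")
        case True
        then have "\<bar>g y\<bar> \<le> K" using K by auto
        then have "\<bar>g y\<bar> \<le> \<bar>K\<bar>" by simp
        then have "\<bar>g y\<bar> * \<bar>f y\<bar> \<le> \<bar>K\<bar> * \<bar>f y\<bar>" by (rule mult_right_mono) simp
        then show ?thesis using True by (simp add: abs_mult)
      qed simp
    qed
  qed measurable
qed

lemma loc_int_Lq2:
  assumes "f \<in> Lq 2 lborel" shows "loc_int f"
proof (intro conjI allI)
  show "f \<in> borel_measurable borel" using assms by (simp add: Lq2_iff)
  fix R :: nat
  have "(\<lambda>y. indicator {- real R<..<real R} y) \<in> Lq 2 lborel"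
  proof -
    have "integrable lborel (indicator {- real R<..<real R} :: real \<Rightarrow> real)"
      by (rule integrable_real_indicator) auto
    moreover have "(\<lambda>y. (indicator {- real R<..<real R} y :: real)\<^sup>2) = indicator {- real R<..<real R}"
      by (auto simp: indicator_def)
    ultimately show ?thesis by (simp add: Lq2_iff)
  qed
  from Lq2_mult_integrable[OF this assms]
  show "integrable lborel (\<lambda>y. indicator {- real R<..<real R} y * f y)" .
qed

lemma loc_int_continuous: "continuous_on UNIV g \<Longrightarrow> loc_int g"
proof -
  assume "continuous_on UNIV g"
  moreover have "loc_int (\<lambda>x. 1)"
    by (auto intro!: integrable_real_indicator)
  ultimately show ?thesis using loc_int_mult_continuous[of "\<lambda>x. 1" g] by simp
qed

lemma loc_int_add: "loc_int f \<Longrightarrow> loc_int g \<Longrightarrow> loc_int (\<lambda>x. f x + c * g x)"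
proof -
  assume *: "loc_int f" "loc_int g"
  have "(\<lambda>y. indicator {- real R<..<real R} y * (f y + c * g y)) =
     (\<lambda>y. indicator {- real R<..<real R} y * f y + c * (indicator {- real R<..<real R} y * g y))" for R :: nat
    by (auto simp: algebra_simps)
  moreover have "(\<lambda>x. f x + c * g x) \<in> borel_measurable borel"
    using * by (intro borel_measurable_add borel_measurable_times) auto
  ultimately show ?thesis using * by simp
qed

lemma test_fun_interval:
  assumes "\<psi> \<in> test_fun"
  shows "\<exists>R::nat. \<forall>x. x \<notin> {- real R<..<real R} \<longrightarrow> \<psi> x = 0"
proof -
  obtain r where r: "r > 0" "{x. \<psi> x \<noteq> 0} \<subseteq> cball 0 r"
    using bounded_cball_0[OF test_fun_bounded[OF assms]] .
  obtain R :: nat where "r < R" using reals_Archimedean2 by blast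
  have "\<psi> x = 0" if x: "x \<notin> {- real R<..<real R}" for x
  proof (rule ccontr)
    assume "\<psi> x \<noteq> 0"
    then have "x \<in> cball 0 r" using r(2) by blast
    then show False using x \<open>r < R\<close> by auto
  qed
  then show ?thesis by blast
qed

lemma loc_int_test:
  assumes "loc_int f" "\<psi> \<in> test_fun"
  shows "integrable lborel (\<lambda>x. f x * \<psi> x)"
proof -
  obtain R :: nat where R: "\<And>x. x \<notin> {- real R<..<real R} \<Longrightarrow> \<psi> x = 0"
    using test_fun_interval[OF assms(2)] by blast
  have "loc_int (\<lambda>x. \<psi> x * f x)"
    by (rule loc_int_mult_continuous[OF assms(1) smooth_continuous[OF test_fun_smooth[OF assms(2)]]])
  then have "integrable lborel (\<lambda>y. indicator {- real R<..<real R} y * (\<psi> y * f y))" by blast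
  also have "(\<lambda>y. indicator {- real R<..<real R} y * (\<psi> y * f y)) = (\<lambda>y. f y * \<psi> y)"
  proof
    fix y show "indicator {- real R<..<real R} y * (\<psi> y * f y) = f y * \<psi> y"
      using R[of y] by (cases "y \<in> {- real R<..<real R}") auto
  qed
  finally show ?thesis .
qed

lemma bump_interval_test:
  assumes "a < b"
  shows "(\<lambda>x. bump (real n * ((x - a) * (b - x)))) \<in> test_fun"
proof (rule test_funI)
  have "smooth (\<lambda>x::real. x)" by (rule smooth_linear) simp
  then have "smooth (\<lambda>x. real n * ((x + - a) * (b + (- 1) * x)))"
    by (intro smooth_mult smooth_add smooth_const)
  from smooth_comp[OF smooth_bump this]
  show "smooth (\<lambda>x. bump (real n * ((x - a) * (b - x))))" by simp
  have "{x. bump (real n * ((x - a) * (b - x))) \<noteq> 0} \<subseteq> {a..b}"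
  proof
    fix x assume "x \<in> {x. bump (real n * ((x - a) * (b - x))) \<noteq> 0}"
    then have "\<not> real n * ((x - a) * (b - x)) \<le> 0" using bump_bounds(3) by blast
    then have "(x - a) * (b - x) > 0"
      using mult_nonneg_nonpos[of "real n" "(x - a) * (b - x)"] by force
    then show "x \<in> {a..b}" using assms by (auto simp: zero_less_mult_iff)
  qed
  then show "bounded {x. bump (real n * ((x - a) * (b - x))) \<noteq> 0}"
    by (rule bounded_subset[OF bounded_closed_interval])
qed

text \<open>The test functions \<open>bump (n (x - a) (b - x))\<close> converge boundedly to the indicator of the interval.\<close>

lemma weak_zero_interval:
  assumes f: "loc_int f" and 0: "\<And>\<psi>. \<psi> \<in> test_fun \<Longrightarrow> (LINT x|lborel. f x * \<psi> x) = 0" and "a < b"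
  shows "(LINT x|lborel. indicator {a<..<b} x * f x) = 0"
proof -
  obtain R :: nat where R: "max \<bar>a\<bar> \<bar>b\<bar> < real R" using reals_Archimedean2 by blast
  have fm [measurable]: "f \<in> borel_measurable lborel" using f by simp
  define \<beta> where "\<beta> n x = bump (real n * ((x - a) * (b - x)))" for n x
  have \<beta>: "\<beta> n \<in> test_fun" for n
    unfolding \<beta>_def[abs_def] by (rule bump_interval_test[OF \<open>a < b\<close>])
  have \<beta>m [measurable]: "\<beta> n \<in> borel_measurable lborel" for n
    using borel_measurable_continuous_onI[OF smooth_continuous[OF test_fun_smooth[OF \<beta>]]] by simp
  have z: "\<beta> n x = 0" if "x \<notin> {a<..<b}" for n x
  proof -
    have "(x - a) * (b - x) \<le> 0" using that \<open>a < b\<close> by (auto simp: mult_le_0_iff)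
    then show ?thesis unfolding \<beta>_def by (intro bump_bounds) (simp add: mult_nonneg_nonpos)
  qed
  have "(\<lambda>n. LINT x|lborel. f x * \<beta> n x) \<longlonglongrightarrow> (LINT x|lborel. indicator {a<..<b} x * f x)"
  proof (rule integral_dominated_convergence[where w="\<lambda>x. \<bar>indicator {- real R<..<real R} x * f x\<bar>"])
    show "integrable lborel (\<lambda>x. \<bar>indicator {- real R<..<real R} x * f x\<bar>)"
      using f by (intro integrable_abs) auto
    show "AE x in lborel. (\<lambda>n. f x * \<beta> n x) \<longlonglongrightarrow> indicator {a<..<b} x * f x"
    proof (intro AE_I2)
      fix x
      show "(\<lambda>n. f x * \<beta> n x) \<longlonglongrightarrow> indicator {a<..<b} x * f x"
      proof (cases "x \<in> {a<..<b}")
        case True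
        then have "(\<lambda>n. \<beta> n x) \<longlonglongrightarrow> 1"
          unfolding \<beta>_def by (intro bump_tendsto) auto
        from tendsto_mult_left[OF this, of "f x"] show ?thesis using True by simp
      qed (use z in simp)
    qed
    show "AE x in lborel. norm (f x * \<beta> n x) \<le> \<bar>indicator {- real R<..<real R} x * f x\<bar>" for n
    proof (intro AE_I2)
      fix x
      show "norm (f x * \<beta> n x) \<le> \<bar>indicator {- real R<..<real R} x * f x\<bar>"
      proof (cases "x \<in> {a<..<b}")
        case True
        then have x: "x \<in> {-real R<..<real R}" using R by auto
        have "\<bar>\<beta> n x\<bar> \<le> 1" using bump_bounds by (simp add: \<beta>_def)
        then have "\<bar>f x\<bar> * \<bar>\<beta> n x\<bar> \<le> \<bar>f x\<bar> * 1" by (rule mult_left_mono) simp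
        then show ?thesis using x by (simp add: abs_mult)
      qed (use z in simp)
    qed
  qed measurable
  moreover have "(LINT x|lborel. f x * \<beta> n x) = 0" for n using 0[OF \<beta>] .
  ultimately show ?thesis using LIMSEQ_unique[OF tendsto_const] by force
qed

text \<open>On a bounded interval the positive and the negative part of \<open>f\<close> have equal integrals over all
  half-lines, so they are densities of the same measure.\<close>

lemma weak_zero:
  assumes f: "loc_int f" and 0: "\<And>\<psi>. \<psi> \<in> test_fun \<Longrightarrow> (LINT x|lborel. f x * \<psi> x) = 0"
  shows "AE x in lborel. f x = 0"
proof -
  have [measurable]: "f \<in> borel_measurable borel" using f by simp
  have "AE x in lborel. indicator {- real R<..<real R} x * f x = 0" for R :: nat
  proof -
    define g where "g x = indicator {- real R<..<real R} x * f x" for x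
    have [measurable]: "g \<in> borel_measurable borel" unfolding g_def[abs_def] by measurable
    have g: "integrable lborel g" unfolding g_def[abs_def] using f by blast
    have gp: "integrable lborel (\<lambda>x. max 0 (g x))" "integrable lborel (\<lambda>x. max 0 (- g x))"
      using g by auto
    have tail: "(LINT x|lborel. indicator {a<..} x * g x) = 0" for a
    proof -
      have eq: "(\<lambda>x. indicator {a<..} x * g x) = (\<lambda>x. indicator {max a (- real R)<..<real R} x * f x)"
        by (auto simp: g_def indicator_def)
      show ?thesis
      proof (cases "max a (- real R) < R")
        case True
        then show ?thesis unfolding eq by (intro weak_zero_interval f 0)
      next
        case False
        then have "{max a (- real R)<..<real R} = {}" by auto
        then show ?thesis unfolding eq by simp
      qed
    qed
    have em: "emeasure (density lborel (\<lambda>x. ennreal (max 0 (h x)))) {a<..}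
        = ennreal (LINT x|lborel. indicator {a<..} x * max 0 (h x))"
      if "integrable lborel (\<lambda>x. max 0 (h x))" "h \<in> borel_measurable borel" for h :: "real \<Rightarrow> real" and a
    proof -
      have i: "integrable lborel (\<lambda>x. indicator {a<..} x * max 0 (h x))"
      proof -
        have "{a<..} \<in> sets lborel" by simp
        from integrable_mult_indicator[OF this that(1)] show ?thesis by simp
      qed
      have "emeasure (density lborel (\<lambda>x. ennreal (max 0 (h x)))) {a<..}
          = (\<integral>\<^sup>+x. ennreal (max 0 (h x)) * indicator {a<..} x \<partial>lborel)"
        using that by (intro emeasure_density) auto
      also have "\<dots> = (\<integral>\<^sup>+x. ennreal (indicator {a<..} x * max 0 (h x)) \<partial>lborel)"
        by (intro nn_integral_cong) (auto simp: indicator_def)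
      also have "\<dots> = ennreal (LINT x|lborel. indicator {a<..} x * max 0 (h x))"
        using i by (intro nn_integral_eq_integral) auto
      finally show ?thesis .
    qed
    have "density lborel (\<lambda>x. ennreal (max 0 (g x))) = density lborel (\<lambda>x. ennreal (max 0 (- g x)))"
    proof (rule measure_eqI_lessThan)
      fix a
      have i: "integrable lborel (\<lambda>x. indicator {a<..} x * max 0 (g x))"
         "integrable lborel (\<lambda>x. indicator {a<..} x * max 0 (- g x))"
        using integrable_mult_indicator[OF _ gp(1), of "{a<..}"]
          integrable_mult_indicator[OF _ gp(2), of "{a<..}"] by simp_all
      have "(\<lambda>x. indicator {a<..} x * g x) = (\<lambda>x. indicator {a<..} x * max 0 (g x) - indicator {a<..} x * max 0 (- g x))"
        by (auto simp: indicator_def max_def)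
      then have "(LINT x|lborel. indicator {a<..} x * max 0 (g x)) = (LINT x|lborel. indicator {a<..} x * max 0 (- g x))"
        using tail[of a] i by simp
      then show "emeasure (density lborel (\<lambda>x. ennreal (max 0 (g x)))) {a<..}
          = emeasure (density lborel (\<lambda>x. ennreal (max 0 (- g x)))) {a<..}"
        using em[of g a] em[of "\<lambda>x. - g x" a] gp by simp
      show "emeasure (density lborel (\<lambda>x. ennreal (max 0 (g x)))) {a<..} < \<infinity>"
        using em[of g a] gp by simp
    qed auto
    then have "AE x in lborel. ennreal (max 0 (g x)) = ennreal (max 0 (- g x))"
      by (intro sigma_finite_measure.density_unique[OF sigma_finite_lborel]) auto
    then show ?thesis
    proof eventually_elim
      case (elim x)
      then have "max 0 (g x) = max 0 (- g x)" by simp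
      then show ?case unfolding g_def[symmetric] by (simp add: max_def split: if_splits)
    qed
  qed
  then have "AE x in lborel. \<forall>R::nat. indicator {- real R<..<real R} x * f x = 0"
    unfolding AE_all_countable by blast
  then show ?thesis
  proof eventually_elim
    case (elim x)
    obtain R :: nat where "\<bar>x\<bar> < real R" using reals_Archimedean2 by blast
    then show ?case using elim[rule_format, of R] by (simp add: indicator_def abs_less_iff)
  qed
qed

lemma antiderivative_exists:
  assumes "continuous_on UNIV (r :: real \<Rightarrow> real)"
  shows "\<exists>H. \<forall>x. (H has_real_derivative r x) (at x)"
proof -
  have "isCont r x" for x
    using assms by (simp add: continuous_on_eq_continuous_at)
  then show ?thesis
    using einterval_antiderivative[of "-\<infinity>" "\<infinity>" r]
    by (auto simp: has_real_derivative_iff_has_vector_derivative)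
qed

lemma smooth_antiderivative:
  assumes "\<And>x. (f has_real_derivative g x) (at x)" "smooth g" shows "smooth f"
proof -
  have d: "f differentiable (at x)" for x using assms(1) real_differentiable_def by blast
  have "pd 1 f = g" using pd_real[OF assms(1)] by auto
  then have "C_k (Suc k) f" for k using d assms(2) by (simp add: smooth_def)
  then show ?thesis unfolding smooth_def using C_k_Suc_imp by blast
qed

lemma test_fun_derivative:
  "\<psi> \<in> test_fun \<Longrightarrow> (\<psi> has_real_derivative pd 1 \<psi> x) (at x)"
  by (rule pd_has_real_derivative[OF smooth_differentiable[OF test_fun_smooth]])

lemma test_fun_pd1: "(\<psi> :: real \<Rightarrow> real) \<in> test_fun \<Longrightarrow> pd 1 \<psi> \<in> test_fun"
  by (rule test_fun_pd) simp_all

lemma FTC_Icc: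
  assumes "a \<le> b" "\<And>x. (H has_real_derivative r x) (at x)" "continuous_on UNIV r"
  shows "(LINT x|lborel. r x * indicator {a..b} x) = H b - H a"
  using assms(1)
  by (rule integral_FTC_Icc_real) (use assms in \<open>auto simp: continuous_on_eq_continuous_at\<close>)

text \<open>The primitive is constant on both sides of the support, and the vanishing integral makes the two
  constants equal.\<close>

lemma test_fun_antiderivative:
  fixes r :: "real \<Rightarrow> real"
  assumes r: "r \<in> test_fun" and 0: "(LINT x|lborel. r x) = 0"
  shows "\<exists>\<psi>\<in>test_fun. pd 1 \<psi> = r"
proof -
  have rc: "continuous_on UNIV r" by (rule smooth_continuous[OF test_fun_smooth[OF r]])
  obtain H where H: "\<And>x. (H has_real_derivative r x) (at x)"
    using antiderivative_exists[OF rc] by blast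
  obtain R :: nat where R: "\<And>x. x \<notin> {- real R<..<real R} \<Longrightarrow> r x = 0"
    using test_fun_interval[OF r] by blast
  have out: "H b - H a = 0" if "a \<le> b" "\<And>x. x \<in> {a..b} \<Longrightarrow> r x = 0" for a b
  proof -
    have "(\<lambda>x. r x * indicator {a..b} x) = (\<lambda>x. 0)"
    proof
      fix x show "r x * indicator {a..b} x = 0"
        using that(2)[of x] by (cases "x \<in> {a..b}") auto
    qed
    then show ?thesis using FTC_Icc[OF that(1) H rc] by simp
  qed
  have "(\<lambda>x. r x * indicator {- real R..real R} x) = r"
  proof
    fix x show "r x * indicator {- real R..real R} x = r x"
      using R[of x] by (cases "x \<in> {- real R..real R}") auto
  qed
  then have full: "H (real R) - H (- real R) = 0"
    using FTC_Icc[of "- real R" "real R" H r] H rc 0 by simp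
  define \<psi> where "\<psi> x = H x - H (- real R)" for x
  have d: "(\<psi> has_real_derivative r x) (at x)" for x
    unfolding \<psi>_def[abs_def] using H by (auto intro!: derivative_eq_intros)
  have "\<psi> x = 0" if x: "x \<notin> {- real R<..<real R}" for x
  proof (cases "x \<le> - real R")
    case True
    then have "H (- real R) - H x = 0" by (intro out) (auto intro: R)
    then show ?thesis by (simp add: \<psi>_def)
  next
    case False
    then have "real R \<le> x" using x by auto
    then have "H x - H (real R) = 0" by (intro out) (auto intro: R)
    then show ?thesis using full by (simp add: \<psi>_def)
  qed
  then have "{x. \<psi> x \<noteq> 0} \<subseteq> {- real R<..<real R}" by blast
  then have "{x. \<psi> x \<noteq> 0} \<subseteq> {- real R..real R}"
    using greaterThanLessThan_subseteq_atLeastAtMost_iff by blast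
  then have "\<psi> \<in> test_fun"
    using smooth_antiderivative[OF d test_fun_smooth[OF r]]
    by (intro test_funI bounded_subset[OF bounded_closed_interval])
  moreover have "pd 1 \<psi> = r" using pd_real[OF d] by auto
  ultimately show ?thesis by blast
qed

lemma test_fun_integral_1: "\<exists>\<theta>\<in>test_fun. (LINT x|(lborel :: real measure). \<theta> x) = 1"
proof -
  have "\<exists>\<psi>\<in>test_fun. (LINT x|(lborel :: real measure). \<psi> x) \<noteq> 0"
  proof (rule ccontr)
    assume "\<not> ?thesis"
    then have "AE x in (lborel :: real measure). (1::real) = 0"
      by (intro weak_zero loc_int_continuous) auto
    then show False
      using ae_filter_eq_bot_iff[of "lborel :: real measure"] by (simp add: eventually_False)
  qed
  then obtain \<psi> where \<psi>: "\<psi> \<in> test_fun" "(LINT x|(lborel :: real measure). \<psi> x) \<noteq> 0" by blast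
  have "(\<lambda>x. (1 / (LINT x|lborel. \<psi> x)) * \<psi> x) \<in> test_fun"
    by (intro smooth_mult_test smooth_const \<psi>)
  moreover have "(LINT x|lborel. (1 / (LINT x|lborel. \<psi> x)) * \<psi> x) = 1"
    using \<psi> by simp
  ultimately show ?thesis by blast
qed

text \<open>Du Bois-Reymond: up to a multiple of a fixed \<open>\<theta>\<close> of integral one, every test function is
  the derivative of a test function.\<close>

lemma weak_const:
  assumes v: "loc_int v" and 0: "\<And>\<psi>. \<psi> \<in> test_fun \<Longrightarrow> (LINT x|lborel. v x * pd 1 \<psi> x) = 0"
  shows "\<exists>c. AE x in lborel. v x = c"
proof -
  obtain \<theta> :: "real \<Rightarrow> real" where \<theta>: "\<theta> \<in> test_fun" "(LINT x|lborel. \<theta> x) = 1"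
    using test_fun_integral_1 by blast
  define c where "c = (LINT x|lborel. v x * \<theta> x)"
  have one: "loc_int (\<lambda>x. 1)" by (rule loc_int_continuous) simp
  have "AE x in lborel. v x + (- c) * 1 = 0"
  proof (rule weak_zero)
    show "loc_int (\<lambda>x. v x + (- c) * 1)" by (rule loc_int_add[OF v one])
    fix \<rho> :: "real \<Rightarrow> real" assume \<rho>: "\<rho> \<in> test_fun"
    have i: "integrable lborel \<rho>" "integrable lborel \<theta>"
      using loc_int_test[OF one \<rho>] loc_int_test[OF one \<theta>(1)] by auto
    have vi: "integrable lborel (\<lambda>x. v x * \<rho> x)" "integrable lborel (\<lambda>x. v x * \<theta> x)"
      using loc_int_test[OF v] \<rho> \<theta> by auto
    define m where "m = (LINT x|lborel. \<rho> x)"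
    have "(LINT x|lborel. \<rho> x + (- m) * \<theta> x) = 0"
      using i \<theta> by (simp add: m_def)
    then obtain \<psi> where \<psi>: "\<psi> \<in> test_fun" "pd 1 \<psi> = (\<lambda>x. \<rho> x + (- m) * \<theta> x)"
      using test_fun_antiderivative[OF test_fun_lin[OF \<rho> \<theta>(1)]] by blast
    have "(LINT x|lborel. v x * \<rho> x - m * (v x * \<theta> x)) = 0"
      using 0[OF \<psi>(1)] unfolding \<psi>(2) by (simp add: algebra_simps)
    then have "(LINT x|lborel. v x * \<rho> x) = m * c"
      using vi by (simp add: c_def)
    then have "(LINT x|lborel. v x * \<rho> x - c * \<rho> x) = 0"
      using vi i by (simp add: m_def)
    then show "(LINT x|lborel. (v x + (- c) * 1) * \<rho> x) = 0"
      by (simp add: algebra_simps)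
  qed
  then show ?thesis by (intro exI[of _ c]) simp
qed

text \<open>Subtracting the right multiple of \<open>x\<close> reduces the second order statement to the first order one.
  The slope \<open>b\<close> is read off from a test function \<open>\<theta>\<close> of integral one.\<close>

lemma weak_affine:
  assumes v: "loc_int v"
    and 0: "\<And>\<psi>. \<psi> \<in> test_fun \<Longrightarrow> (LINT x|lborel. v x * pd 1 (pd 1 \<psi>) x) = 0"
  shows "\<exists>a b. AE x in lborel. v x = a + b * x"
proof -
  obtain \<theta> :: "real \<Rightarrow> real" where \<theta>: "\<theta> \<in> test_fun" "(LINT x|lborel. \<theta> x) = 1"
    using test_fun_integral_1 by blast
  define b where "b = - (LINT x|lborel. v x * pd 1 \<theta> x)"
  have one: "loc_int (\<lambda>x. 1)" by (rule loc_int_continuous) simp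
  have id: "loc_int (\<lambda>x. x)" by (rule loc_int_continuous) simp
  have "\<exists>c. AE x in lborel. v x + (- b) * x = c"
  proof (rule weak_const)
    show "loc_int (\<lambda>x. v x + (- b) * x)" by (rule loc_int_add[OF v id])
    fix \<rho> :: "real \<Rightarrow> real" assume \<rho>: "\<rho> \<in> test_fun"
    have i: "integrable lborel \<rho>" "integrable lborel \<theta>"
      using loc_int_test[OF one \<rho>] loc_int_test[OF one \<theta>(1)] by auto
    have vi: "integrable lborel (\<lambda>x. v x * pd 1 \<rho> x)" "integrable lborel (\<lambda>x. v x * pd 1 \<theta> x)"
      using loc_int_test[OF v test_fun_pd1] \<rho> \<theta> by auto
    define m where "m = (LINT x|lborel. \<rho> x)"
    have "(LINT x|lborel. \<rho> x + (- m) * \<theta> x) = 0"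
      using i \<theta> by (simp add: m_def)
    then obtain \<psi> where \<psi>: "\<psi> \<in> test_fun" "pd 1 \<psi> = (\<lambda>x. \<rho> x + (- m) * \<theta> x)"
      using test_fun_antiderivative[OF test_fun_lin[OF \<rho> \<theta>(1)]] by blast
    have "((\<lambda>x. \<rho> x + (- m) * \<theta> x) has_real_derivative pd 1 \<rho> x + (- m) * pd 1 \<theta> x) (at x)" for x
      using test_fun_derivative[OF \<rho>] test_fun_derivative[OF \<theta>(1)]
      by (auto intro!: derivative_eq_intros)
    then have "pd 1 (pd 1 \<psi>) = (\<lambda>x. pd 1 \<rho> x + (- m) * pd 1 \<theta> x)"
      unfolding \<psi>(2) using pd_real by blast
    then have "(LINT x|lborel. v x * pd 1 \<rho> x - m * (v x * pd 1 \<theta> x)) = 0"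
      using 0[OF \<psi>(1)] by (simp add: algebra_simps)
    then have 1: "(LINT x|lborel. v x * pd 1 \<rho> x) = - (b * m)"
      using vi by (simp add: b_def)
    have D1: "pd 1 (\<lambda>x. x) x = 1" for x :: real by (rule pd_real) simp
    then have D1': "pd 1 (\<lambda>x. x) = (\<lambda>x::real. 1)" by auto
    have "(LINT x|lborel. x * pd 1 \<rho> x) = - (LINT x|lborel. pd 1 (\<lambda>x. x) x * \<rho> x)"
      using smooth_differentiable[OF test_fun_smooth[OF \<rho>]]
        smooth_continuous[OF test_fun_smooth[OF test_fun_pd1[OF \<rho>]]] test_fun_bounded[OF \<rho>]
      by (intro integration_by_parts_pd) (auto simp: D1')
    then have 2: "(LINT x|lborel. x * pd 1 \<rho> x) = - m" by (simp add: D1' m_def)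
    have xi: "integrable lborel (\<lambda>x. x * pd 1 \<rho> x)"
      by (rule loc_int_test[OF id test_fun_pd1[OF \<rho>]])
    have "(LINT x|lborel. v x * pd 1 \<rho> x - b * (x * pd 1 \<rho> x)) = 0"
      using vi xi 1 2 by simp
    then show "(LINT x|lborel. (v x + (- b) * x) * pd 1 \<rho> x) = 0"
      by (simp add: algebra_simps)
  qed
  then obtain a where "AE x in lborel. v x + (- b) * x = a" by blast
  then have "AE x in lborel. v x = a + b * x" by eventually_elim simp
  then show ?thesis by blast
qed

text \<open>The primitive of a locally integrable function that vanishes at the origin, written as a
  single integral so that Fubini's theorem applies without distinguishing the sign of \<open>x\<close>.\<close>

definition between0 :: "real \<Rightarrow> real \<Rightarrow> real" where
  "between0 x y = (if 0 < y \<and> y \<le> x then 1 else 0) - (if x \<le> y \<and> y \<le> 0 then 1 else 0)"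

definition prim :: "(real \<Rightarrow> real) \<Rightarrow> real \<Rightarrow> real" where
  "prim k x = (LINT y|lborel. k y * between0 x y)"

lemma between0_measurable [measurable]:
  "(\<lambda>z. between0 (fst z) (snd z)) \<in> borel_measurable (lborel \<Otimes>\<^sub>M lborel)"
  unfolding between0_def by measurable

lemma between0_measurable' [measurable]: "between0 x \<in> borel_measurable lborel"
  unfolding between0_def[abs_def] by measurable

lemma between0_bound: "x \<in> {-R<..<R} \<Longrightarrow> \<bar>k * between0 x y\<bar> \<le> \<bar>indicator {-R<..<R} y * k\<bar>"
  by (auto simp: between0_def indicator_def)

lemma prim_cong_AE:
  assumes "AE x in lborel. k x = h x" "k \<in> borel_measurable borel" "h \<in> borel_measurable borel"
  shows "prim k = prim h"
proof
  fix x
  show "prim k x = prim h x"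
    unfolding prim_def by (intro integral_cong_AE) (use assms in auto)
qed

lemma prim_continuous:
  assumes k: "loc_int k" shows "continuous_on UNIV (prim k)"
  unfolding continuous_on_sequentially
proof (intro allI ballI impI, elim conjE)
  fix s :: "nat \<Rightarrow> real" and a assume s: "s \<longlonglongrightarrow> a"
  have [measurable]: "k \<in> borel_measurable lborel" using k by simp
  obtain B where B: "\<And>n. \<bar>s n\<bar> \<le> B"
    using convergent_imp_Bseq[OF convergentI[OF s]] by (auto simp: Bseq_def)
  obtain R :: nat where R: "B < R" using reals_Archimedean2 by blast
  have "(\<lambda>n. LINT y|lborel. k y * between0 (s n) y) \<longlonglongrightarrow> (LINT y|lborel. k y * between0 a y)"
  proof (rule integral_dominated_convergence[where w="\<lambda>y. \<bar>indicator {- real R<..<real R} y * k y\<bar>"])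
    show "integrable lborel (\<lambda>y. \<bar>indicator {- real R<..<real R} y * k y\<bar>)"
      using k by (intro integrable_abs) auto
    show "AE y in lborel. (\<lambda>n. k y * between0 (s n) y) \<longlonglongrightarrow> k y * between0 a y"
      using AE_lborel_singleton[of a]
    proof eventually_elim
      case (elim y)
      have "\<forall>\<^sub>F n in sequentially. between0 (s n) y = between0 a y"
      proof (cases "y < a")
        case True
        from order_tendstoD(1)[OF s this] show ?thesis
          by eventually_elim (use True in \<open>auto simp: between0_def\<close>)
      next
        case False
        then have y: "a < y" using elim by auto
        from order_tendstoD(2)[OF s this] show ?thesis
          by eventually_elim (use y in \<open>auto simp: between0_def\<close>)
      qed
      then show ?case by (intro tendsto_mult tendsto_const tendsto_eventually)
    qed
    show "AE y in lborel. norm (k y * between0 (s n) y) \<le> \<bar>indicator {- real R<..<real R} y * k y\<bar>" for n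
    proof (intro AE_I2)
      fix y
      have "s n \<in> {- real R<..<real R}" using B[of n] R by auto
      from between0_bound[OF this] show "norm (k y * between0 (s n) y) \<le> \<bar>indicator {- real R<..<real R} y * k y\<bar>"
        by simp
    qed
  qed measurable
  then show "(prim k \<circ> s) \<longlonglongrightarrow> prim k a" by (simp add: prim_def[abs_def] o_def)
qed

lemma prim_has_derivative:
  assumes h: "continuous_on UNIV h" shows "(prim h has_real_derivative h x) (at x)"
proof -
  obtain H where H: "\<And>x. (H has_real_derivative h x) (at x)"
    using antiderivative_exists[OF h] by blast
  have [measurable]: "h \<in> borel_measurable lborel"
    using borel_measurable_continuous_onI[OF h] by simp
  have "prim h x = H x - H 0" for x
  proof (cases "0 \<le> x")
    case True
    have "prim h x = (LINT y|lborel. h y * indicator {0..x} y)"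
      unfolding prim_def
    proof (intro integral_cong_AE)
      show "AE y in lborel. h y * between0 x y = h y * indicator {0..x} y"
        using AE_lborel_singleton[of 0] by eventually_elim (use True in \<open>auto simp: between0_def\<close>)
    qed auto
    then show ?thesis using FTC_Icc[OF True H h] by simp
  next
    case False
    have "prim h x = (LINT y|lborel. - (h y * indicator {x..0} y))"
      unfolding prim_def
      by (rule arg_cong[where f="integral\<^sup>L lborel"]) (use False in \<open>auto simp: between0_def indicator_def\<close>)
    then show ?thesis using FTC_Icc[of x 0 H h] False H h by simp
  qed
  then have "prim h = (\<lambda>x. H x - H 0)" by auto
  then show ?thesis using H by (auto intro!: derivative_eq_intros)
qed

lemma integrable_product_mult:
  fixes f g :: "real \<Rightarrow> real"
  assumes "integrable lborel f" "integrable lborel g"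
  shows "integrable (lborel \<Otimes>\<^sub>M lborel) (\<lambda>z. f (fst z) * g (snd z))"
proof (rule lborel_pair.Fubini_integrable)
  have [measurable]: "f \<in> borel_measurable lborel" "g \<in> borel_measurable lborel"
    using assms by auto
  show "(\<lambda>z. f (fst z) * g (snd z)) \<in> borel_measurable (lborel \<Otimes>\<^sub>M lborel)" by measurable
  show "integrable lborel (\<lambda>x. LINT y|lborel. norm (f (fst (x, y)) * g (snd (x, y))))"
    using assms by (simp add: abs_mult)
  show "AE x in lborel. integrable lborel (\<lambda>y. f (fst (x, y)) * g (snd (x, y)))"
    using assms by simp
qed

text \<open>Fubini's theorem. The double integral converges because the test function restricts \<open>x\<close>, and with it
  all points \<open>y\<close> between \<open>0\<close> and \<open>x\<close>, to a bounded interval.\<close>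

lemma prim_weak_derivative:
  assumes k: "loc_int k" and \<psi>: "\<psi> \<in> test_fun"
  shows "(LINT x|lborel. prim k x * pd 1 \<psi> x) = - (LINT x|lborel. k x * \<psi> x)"
proof -
  have [measurable]: "k \<in> borel_measurable lborel" using k by simp
  note \<psi>1 = test_fun_pd1[OF \<psi>]
  have c1: "continuous_on UNIV (pd 1 \<psi>)" by (rule smooth_continuous[OF test_fun_smooth[OF \<psi>1]])
  have [measurable]: "pd 1 \<psi> \<in> borel_measurable lborel"
    using borel_measurable_continuous_onI[OF c1] by simp
  have i1: "integrable lborel (pd 1 \<psi>)"
    by (rule integrable_continuous_bounded_support[OF c1 test_fun_bounded[OF \<psi>1]])
  obtain R1 :: nat where R1: "\<And>x. x \<notin> {- real R1<..<real R1} \<Longrightarrow> pd 1 \<psi> x = 0"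
    using test_fun_interval[OF \<psi>1] by blast
  obtain R2 :: nat where R2: "\<And>x. x \<notin> {- real R2<..<real R2} \<Longrightarrow> \<psi> x = 0"
    using test_fun_interval[OF \<psi>] by blast
  define F where "F x y = k y * between0 x y * pd 1 \<psi> x" for x y
  have F: "integrable (lborel \<Otimes>\<^sub>M lborel) (case_prod F)"
  proof (rule Bochner_Integration.integrable_bound)
    show "integrable (lborel \<Otimes>\<^sub>M lborel)
        (\<lambda>z. pd 1 \<psi> (fst z) * (indicator {- real R1<..<real R1} (snd z) * k (snd z)))"
      using k by (intro integrable_product_mult i1) auto
    show "case_prod F \<in> borel_measurable (lborel \<Otimes>\<^sub>M lborel)"
      unfolding F_def case_prod_beta by measurable
    have "\<bar>F x y\<bar> \<le> \<bar>pd 1 \<psi> x * (indicator {- real R1<..<real R1} y * k y)\<bar>" for x y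
    proof (cases "x \<in> {- real R1<..<real R1}")
      case True
      from mult_left_mono[OF between0_bound[OF this, of "k y" y], of "\<bar>pd 1 \<psi> x\<bar>"]
      show ?thesis by (simp add: F_def abs_mult mult_ac)
    qed (use R1 in \<open>simp add: F_def\<close>)
    then show "AE z in lborel \<Otimes>\<^sub>M lborel. norm (case_prod F z)
        \<le> norm (pd 1 \<psi> (fst z) * (indicator {- real R1<..<real R1} (snd z) * k (snd z)))"
      by (intro AE_I2) (auto simp: split_beta)
  qed
  have inner: "(LINT x|lborel. F x y) = - (k y * \<psi> y)" for y
  proof -
    \<comment> \<open>\<open>max r r1\<close> lies beyond \<open>y\<close> and beyond the supports of \<open>\<psi>\<close> and \<open>\<psi>'\<close>\<close>
    define r where "r = max (real R2) \<bar>y\<bar>"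
    define r1 where "r1 = max (real R1) \<bar>y\<bar>"
    have rr: "\<psi> (max r r1) = 0" "\<psi> (- max r r1) = 0" by (auto intro!: R2 simp: r_def)
    have "(LINT x|lborel. between0 x y * pd 1 \<psi> x) = - \<psi> y"
    proof (cases "0 < y")
      case True
      have eq: "between0 x y * pd 1 \<psi> x = pd 1 \<psi> x * indicator {y..max r r1} x" for x
      proof (cases "x \<le> max r r1")
        case False
        then have "pd 1 \<psi> x = 0" by (intro R1) (auto simp: r1_def)
        then show ?thesis by simp
      qed (use True in \<open>auto simp: between0_def indicator_def\<close>)
      have "y \<le> max r r1" by (auto simp: r_def)
      then show ?thesis
        unfolding eq using FTC_Icc[OF _ test_fun_derivative[OF \<psi>] c1, of y "max r r1"] rr by simp
    next
      case False
      have eq: "between0 x y * pd 1 \<psi> x = - (pd 1 \<psi> x * indicator {- max r r1..y} x)" for x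
      proof (cases "- max r r1 \<le> x")
        case False
        then have "pd 1 \<psi> x = 0" by (intro R1) (auto simp: r1_def)
        then show ?thesis by simp
      qed (use False in \<open>auto simp: between0_def indicator_def\<close>)
      have "- max r r1 \<le> y" by (auto simp: r_def)
      then show ?thesis
        unfolding eq using FTC_Icc[OF _ test_fun_derivative[OF \<psi>] c1, of "- max r r1" y] rr by simp
    qed
    moreover have "(\<lambda>x. F x y) = (\<lambda>x. k y * (between0 x y * pd 1 \<psi> x))"
      by (auto simp: F_def)
    ultimately show ?thesis by simp
  qed
  have "(LINT x|lborel. prim k x * pd 1 \<psi> x) = (LINT x|lborel. LINT y|lborel. F x y)"
    by (simp add: prim_def F_def)
  also have "\<dots> = (LINT y|lborel. LINT x|lborel. F x y)"
    using lborel_pair.integral_fst[OF F] lborel_pair.integral_snd[OF F] by simp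
  also have "\<dots> = - (LINT x|lborel. k x * \<psi> x)" by (simp add: inner)
  finally show ?thesis .
qed

text \<open>Bootstrapping: twice integrating the right-hand side gives a continuous function that differs from \<open>f\<close>
  by an affine one; inserting this representative \<open>S\<close> into the right-hand side makes it continuous,
  and the second derivative becomes classical.\<close>

theorem weak_solution_classical:
  assumes f: "loc_int f" and q: "continuous_on UNIV q"
    and weak: "\<And>\<psi>. \<psi> \<in> test_fun \<Longrightarrow>
      (LINT x|lborel. f x * pd 1 (pd 1 \<psi>) x) = (LINT x|lborel. q x * f x * \<psi> x)"
  shows "\<exists>S S1. (\<forall>x. (S has_real_derivative S1 x) (at x)) \<and>
      (\<forall>x. (S1 has_real_derivative q x * S x) (at x)) \<and> (AE x in lborel. f x = S x)"
proof -
  define k where "k x = q x * f x" for x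
  have k: "loc_int k" unfolding k_def[abs_def] by (rule loc_int_mult_continuous[OF f q])
  define K1 K2 where "K1 = prim k" and "K2 = prim K1"
  have K1: "continuous_on UNIV K1" unfolding K1_def by (rule prim_continuous[OF k])
  have K2': "(K2 has_real_derivative K1 x) (at x)" for x
    unfolding K2_def by (rule prim_has_derivative[OF K1])
  have K2: "continuous_on UNIV K2"
    by (rule has_real_derivative_continuous[OF K2'])
  have "\<exists>a b. AE x in lborel. f x + (- 1) * K2 x = a + b * x"
  proof (rule weak_affine)
    show "loc_int (\<lambda>x. f x + (- 1) * K2 x)"
      by (rule loc_int_add[OF f loc_int_continuous[OF K2]])
    fix \<psi> :: "real \<Rightarrow> real" assume \<psi>: "\<psi> \<in> test_fun"
    note \<psi>1 = test_fun_pd1[OF \<psi>] and \<psi>2 = test_fun_pd1[OF test_fun_pd1[OF \<psi>]]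
    have "(LINT x|lborel. K2 x * pd 1 (pd 1 \<psi>) x) = - (LINT x|lborel. K1 x * pd 1 \<psi> x)"
      unfolding K2_def by (rule prim_weak_derivative[OF loc_int_continuous[OF K1] \<psi>1])
    also have "\<dots> = (LINT x|lborel. k x * \<psi> x)"
      unfolding K1_def by (simp add: prim_weak_derivative[OF k \<psi>])
    finally have "(LINT x|lborel. f x * pd 1 (pd 1 \<psi>) x - K2 x * pd 1 (pd 1 \<psi>) x) = 0"
      using weak[OF \<psi>] loc_int_test[OF f \<psi>2] loc_int_test[OF loc_int_continuous[OF K2] \<psi>2]
      by (simp add: k_def)
    then show "(LINT x|lborel. (f x + (- 1) * K2 x) * pd 1 (pd 1 \<psi>) x) = 0"
      by (simp add: algebra_simps)
  qed
  then obtain a b where ab: "AE x in lborel. f x + (- 1) * K2 x = a + b * x" by blast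
  define S S1 where "S x = K2 x + (a + b * x)" and "S1 x = K1 x + b" for x
  have fS: "AE x in lborel. f x = S x"
    using ab by eventually_elim (simp add: S_def)
  have S: "(S has_real_derivative S1 x) (at x)" for x
    unfolding S_def[abs_def] S1_def using K2' by (auto intro!: derivative_eq_intros)
  have Sc: "continuous_on UNIV S"
    by (rule has_real_derivative_continuous[OF S])
  have qS: "continuous_on UNIV (\<lambda>x. q x * S x)" by (intro continuous_intros q Sc)
  have "K1 = prim (\<lambda>x. q x * S x)"
    unfolding K1_def
  proof (rule prim_cong_AE)
    show "AE x in lborel. k x = q x * S x"
      using fS by eventually_elim (simp add: k_def)
  qed (use k borel_measurable_continuous_onI[OF qS] in auto)
  then have "(S1 has_real_derivative q x * S x) (at x)" for x
    using prim_has_derivative[OF qS, of x] unfolding S1_def[abs_def]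
    by (auto intro!: derivative_eq_intros)
  then show ?thesis using S fS by blast
qed

section \<open>Lebesgue measurable functions and Borel representatives\<close>

lemma AE_lebesgue_iff: "(AE x in lebesgue. P x) \<longleftrightarrow> (AE x in lborel. P x)"
  by (rule AE_completion_iff)

lemma AE_lborel_null_set:
  assumes "AE x in (lborel :: 'a::euclidean_space measure). P x"
  shows "\<exists>N\<in>null_sets lborel. {x. \<not> P x} \<subseteq> N"
proof (rule AE_E3[OF assms])
  fix N assume "\<And>x. x \<in> space lborel - N \<Longrightarrow> P x" "N \<in> null_sets (lborel :: 'a measure)"
  then show ?thesis by (intro bexI[of _ N]) auto
qed

lemma borel_representative:
  fixes f :: "'a::euclidean_space \<Rightarrow> real"
  assumes "f \<in> borel_measurable lebesgue"
  shows "\<exists>g\<in>borel_measurable borel. AE x in lborel. f x = g x"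
  using completion_ex_borel_measurable_real[OF assms] by simp

text \<open>Lebesgue measure is complete.\<close>

lemma lebesgue_measurable_cong_AE:
  fixes f g :: "'a::euclidean_space \<Rightarrow> real"
  assumes g: "g \<in> borel_measurable borel" and eq: "AE x in lborel. f x = g x"
  shows "f \<in> borel_measurable lebesgue"
proof -
  obtain N where N: "N \<in> null_sets lborel" "{x. f x \<noteq> g x} \<subseteq> N"
    using AE_lborel_null_set[OF eq] by blast
  have N': "N \<in> null_sets lebesgue" using N(1) by (simp add: null_sets_completionI)
  have gm: "g \<in> borel_measurable lebesgue" using g by (simp add: measurable_completion)
  show ?thesis
  proof (rule measurableI)
    fix A :: "real set" assume A: "A \<in> sets borel"
    have "{x. f x \<in> A} \<inter> N \<in> null_sets lebesgue"
      by (rule null_sets_completion_subset[OF _ N']) auto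
    moreover have "{x. g x \<in> A} \<in> sets lebesgue"
      using measurable_sets[OF gm A] by (simp add: vimage_def)
    moreover have "f -` A \<inter> space lebesgue = ({x. g x \<in> A} - N) \<union> ({x. f x \<in> A} \<inter> N)"
      using N(2) by auto
    ultimately show "f -` A \<inter> space lebesgue \<in> sets lebesgue"
      using null_setsD2[OF N'] by (metis null_setsD2 sets.Diff sets.Un)
  qed auto
qed

lemma lebesgue_integral_cong_lborel:
  fixes f g :: "'a::euclidean_space \<Rightarrow> real"
  assumes g: "g \<in> borel_measurable borel" and eq: "AE x in lborel. f x = g x"
  shows "(LINT x|lebesgue. f x) = (LINT x|lborel. g x)"
    "integrable lebesgue f \<longleftrightarrow> integrable lborel g"
proof -
  have gm: "g \<in> borel_measurable lebesgue" using g by (simp add: measurable_completion)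
  have fm: "f \<in> borel_measurable lebesgue" by (rule lebesgue_measurable_cong_AE[OF assms])
  have eq': "AE x in lebesgue. f x = g x" using eq by (simp add: AE_lebesgue_iff)
  show "(LINT x|lebesgue. f x) = (LINT x|lborel. g x)"
    using integral_cong_AE[OF fm gm eq'] g by (simp add: integral_completion)
  show "integrable lebesgue f \<longleftrightarrow> integrable lborel g"
    using integrable_cong_AE[OF fm gm eq'] g by (simp add: integrable_completion)
qed

lemma Lq2_lebesgue_iff:
  fixes f g :: "'a::euclidean_space \<Rightarrow> real"
  assumes g: "g \<in> borel_measurable borel" and eq: "AE x in lborel. f x = g x"
  shows "f \<in> Lq 2 lebesgue \<longleftrightarrow> g \<in> Lq 2 lborel"
proof -
  have "AE x in lborel. (f x)\<^sup>2 = (g x)\<^sup>2" using eq by eventually_elim simp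
  then have "integrable lebesgue (\<lambda>x. (f x)\<^sup>2) \<longleftrightarrow> integrable lborel (\<lambda>x. (g x)\<^sup>2)"
    using g by (intro lebesgue_integral_cong_lborel) auto
  then show ?thesis
    using lebesgue_measurable_cong_AE[OF assms] g by (simp add: Lq2_iff)
qed

lemma Lq2_weighted_iff:
  assumes w: "w \<in> borel_measurable lebesgue" "\<And>x. 0 \<le> w x"
  shows "f \<in> Lq 2 (weighted w) \<longleftrightarrow>
    f \<in> borel_measurable lebesgue \<and> integrable lebesgue (\<lambda>x. w x * (f x)\<^sup>2)"
proof (cases "f \<in> borel_measurable lebesgue")
  case True
  then show ?thesis
    using w by (simp add: Lq2_iff weighted_def integrable_density)
next
  case False
  then show ?thesis
    by (simp add: Lq2_iff weighted_def)
qed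

lemma AE_weighted_iff:
  assumes w: "w \<in> borel_measurable lebesgue" "\<And>x. 0 < w x"
  shows "(AE x in weighted w. P x) \<longleftrightarrow> (AE x in lborel. P x)"
  unfolding weighted_def using w by (simp add: AE_density AE_lebesgue_iff)

lemma L2_inner_weighted:
  assumes w: "continuous_on UNIV w" "\<And>x. 0 < w x"
    and f: "AE x in lborel. f x = f' x" "f' \<in> borel_measurable borel"
    and g: "AE x in lborel. g x = g' x" "g' \<in> borel_measurable borel"
  shows "L2_inner (weighted w) f g
    = L2_inner lborel (\<lambda>x. sqrt (w x) * f' x) (\<lambda>x. sqrt (w x) * g' x)"
proof -
  have wb [measurable]: "w \<in> borel_measurable borel"
    using w(1) by (rule borel_measurable_continuous_onI)
  have wl: "w \<in> borel_measurable lebesgue" using wb by (simp add: measurable_completion)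
  have fm: "f \<in> borel_measurable lebesgue" "g \<in> borel_measurable lebesgue"
    using lebesgue_measurable_cong_AE f g by auto
  have w0: "0 \<le> w x" for x using w(2)[of x] by simp
  note f(2)[measurable] g(2)[measurable]
  have "(\<lambda>x. f x * g x) \<in> borel_measurable lebesgue"
    using fm by (rule borel_measurable_times)
  then have "L2_inner (weighted w) f g = (LINT x|lebesgue. w x * (f x * g x))"
    unfolding L2_inner_def weighted_def using wl w0 by (simp add: integral_density)
  also have "\<dots> = (LINT x|lborel. w x * (f' x * g' x))"
  proof (rule lebesgue_integral_cong_lborel)
    show "AE x in lborel. w x * (f x * g x) = w x * (f' x * g' x)"
      using f(1) g(1) by eventually_elim simp
  qed measurable
  also have "\<dots> = L2_inner lborel (\<lambda>x. sqrt (w x) * f' x) (\<lambda>x. sqrt (w x) * g' x)"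
    unfolding L2_inner_def
  proof (rule arg_cong[where f="integral\<^sup>L lborel"], rule ext)
    fix x
    have "sqrt (w x) * sqrt (w x) = w x" using w0[of x] by simp
    then show "w x * (f' x * g' x) = sqrt (w x) * f' x * (sqrt (w x) * g' x)"
      by (metis mult.assoc mult.left_commute)
  qed
  finally show ?thesis .
qed

lemma AE_snd:
  assumes "AE t in (lborel :: real measure). P t"
  shows "AE z in (lborel :: ('a::euclidean_space \<times> real) measure). P (snd z)"
proof -
  obtain N where N: "N \<in> null_sets lborel" "{t. \<not> P t} \<subseteq> N"
    using AE_lborel_null_set[OF assms] by blast
  have [measurable]: "N \<in> sets lborel" using N by auto
  have "AE z in (lborel :: 'a measure) \<Otimes>\<^sub>M (lborel :: real measure). snd z \<notin> N"
  proof (rule lborel_pair.AE_pair_measure)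
    show "{x \<in> space ((lborel :: 'a measure) \<Otimes>\<^sub>M (lborel :: real measure)). snd x \<notin> N}
        \<in> sets (lborel \<Otimes>\<^sub>M lborel)" by measurable
    show "AE x in lborel. AE y in lborel. snd (x::'a, y) \<notin> N"
      using AE_not_in[OF N(1)] by simp
  qed
  then show ?thesis
    unfolding lborel_prod by eventually_elim (use N in auto)
qed

lemma AE_slices:
  fixes P :: "'a::euclidean_space \<times> real \<Rightarrow> bool"
  assumes "AE z in lborel. P z"
  shows "AE t in lborel. AE x in lborel. P (x, t)"
proof -
  obtain N where N: "N \<in> null_sets lborel" "{z. \<not> P z} \<subseteq> N"
    using AE_lborel_null_set[OF assms] by blast
  have [measurable]: "N \<in> sets (lborel \<Otimes>\<^sub>M lborel)"
    unfolding lborel_prod by (rule null_setsD2[OF N(1)])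
  have "AE z in (lborel :: 'a measure) \<Otimes>\<^sub>M (lborel :: real measure). z \<notin> N"
    unfolding lborel_prod by (rule AE_not_in[OF N(1)])
  then have "AE x in (lborel :: 'a measure). AE t in (lborel :: real measure). (x, t) \<notin> N"
    by (rule lborel_pair.AE_pair)
  then have "AE t in (lborel :: real measure). AE x in (lborel :: 'a measure). (x, t) \<notin> N"
    by (subst (asm) lborel_pair.AE_commute) measurable
  then show ?thesis
    by eventually_elim (elim eventually_mono, use N in auto)
qed

lemma lebesgue_measurable_snd:
  assumes "d \<in> borel_measurable lebesgue"
  shows "(\<lambda>z :: 'a::euclidean_space \<times> real. d (snd z) :: real) \<in> borel_measurable lebesgue"
proof -
  obtain d' where d': "d' \<in> borel_measurable borel" "AE t in lborel. d t = d' t"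
    using borel_representative[OF assms] by blast
  show ?thesis
  proof (rule lebesgue_measurable_cong_AE)
    show "(\<lambda>z :: 'a \<times> real. d' (snd z)) \<in> borel_measurable borel"
      by (subst borel_prod[symmetric]) (rule measurable_compose[OF measurable_snd d'(1)])
    show "AE z :: 'a \<times> real in lborel. d (snd z) = d' (snd z)"
      using AE_snd[OF d'(2)] .
  qed
qed

section \<open>Square roots of self-adjoint operators\<close>

lemma self_adjoint_L2: "self_adjoint \<mu> T \<Longrightarrow> (f, h) \<in> T \<Longrightarrow> f \<in> Lq 2 \<mu> \<and> h \<in> Lq 2 \<mu>"
  by (auto simp: self_adjoint_def densely_defined_def)

lemma self_adjoint_sym:
  assumes "self_adjoint \<mu> T" "(f, h) \<in> T" "(g, k) \<in> T"
  shows "L2_inner \<mu> h g = L2_inner \<mu> f k"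
proof -
  have "(g, k) \<in> adjoint_op \<mu> T" using assms by (simp add: self_adjoint_def)
  then show ?thesis using assms(2) by (auto simp: adjoint_op_def)
qed

lemma self_adjointI:
  assumes "self_adjoint \<mu> T" "g \<in> Lq 2 \<mu>" "k \<in> Lq 2 \<mu>"
    "\<And>f h. (f, h) \<in> T \<Longrightarrow> L2_inner \<mu> h g = L2_inner \<mu> f k"
  shows "(g, k) \<in> T"
proof -
  have "(g, k) \<in> adjoint_op \<mu> T" using assms by (auto simp: adjoint_op_def)
  then show ?thesis using assms(1) by (simp add: self_adjoint_def)
qed

lemma self_adjoint_lin:
  assumes T: "self_adjoint \<mu> T" and "(f, h) \<in> T" "(g, k) \<in> T"
  shows "(\<lambda>x. a * f x + b * g x, \<lambda>x. a * h x + b * k x) \<in> T"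
proof (rule self_adjointI[OF T])
  note L = self_adjoint_L2[OF T assms(2)] self_adjoint_L2[OF T assms(3)]
  show "(\<lambda>x. a * f x + b * g x) \<in> Lq 2 \<mu>" "(\<lambda>x. a * h x + b * k x) \<in> Lq 2 \<mu>"
    using L by (auto intro: Lq2_lin)
  fix p q assume pq: "(p, q) \<in> T"
  note Lp = self_adjoint_L2[OF T pq]
  show "L2_inner \<mu> q (\<lambda>x. a * f x + b * g x) = L2_inner \<mu> p (\<lambda>x. a * h x + b * k x)"
    using L Lp self_adjoint_sym[OF T pq assms(2)] self_adjoint_sym[OF T pq assms(3)]
    by (simp add: L2_inner_commute[of \<mu> q] L2_inner_commute[of \<mu> p] L2_inner_lin)
qed

lemma self_adjoint_cong_AE:
  assumes T: "self_adjoint \<mu> T" and "(f, h) \<in> T" and eq: "AE x in \<mu>. h x = k x" "k \<in> Lq 2 \<mu>"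
  shows "(f, k) \<in> T"
proof (rule self_adjointI[OF T])
  note L = self_adjoint_L2[OF T assms(2)]
  show "f \<in> Lq 2 \<mu>" "k \<in> Lq 2 \<mu>" using L eq by auto
  fix p q assume pq: "(p, q) \<in> T"
  have "L2_inner \<mu> p h = L2_inner \<mu> p k"
    using L self_adjoint_L2[OF T pq] eq by (intro L2_inner_cong_AE) (auto simp: Lq2_iff)
  then show "L2_inner \<mu> q f = L2_inner \<mu> p k"
    using self_adjoint_sym[OF T pq assms(2)] by simp
qed

text \<open>The difference between \<open>B \<phi>\<close> and \<open>sqrt \<nu> \<phi>\<close> is an eigenvector of the non-negative operator \<open>B\<close>
  with the eigenvalue \<open>- sqrt \<nu>\<close>, hence zero if \<open>\<nu> > 0\<close>. For \<open>\<nu> = 0\<close> it is \<open>B \<phi>\<close>, whose square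
  norm is the inner product of \<open>\<phi>\<close> and \<open>A \<phi> = 0\<close>.\<close>

lemma sqrt_op_eigenfunction:
  assumes B: "is_sqrt_op \<mu> A B" and A: "(\<phi>, \<lambda>x. \<nu> * \<phi> x) \<in> A" and \<nu>: "0 \<le> \<nu>"
  shows "(\<phi>, \<lambda>x. sqrt \<nu> * \<phi> x) \<in> B"
proof -
  have T: "self_adjoint \<mu> B" and pos: "\<And>f g. (f, g) \<in> B \<Longrightarrow> 0 \<le> L2_inner \<mu> g f" and BB: "B O B = A"
    using B by (auto simp: is_sqrt_op_def)
  obtain h where h: "(\<phi>, h) \<in> B" "(h, \<lambda>x. \<nu> * \<phi> x) \<in> B" using A BB by auto
  define m where "m = sqrt \<nu>"
  have m: "0 \<le> m" "\<nu> = m * m" using \<nu> by (auto simp: m_def)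
  note L = self_adjoint_L2[OF T h(1)]
  define w where "w x = 1 * h x + (- m) * \<phi> x" for x
  have w: "w \<in> Lq 2 \<mu>" unfolding w_def[abs_def] using L by (intro Lq2_lin) auto
  have "sqnorm \<mu> w = 0"
  proof (cases "m = 0")
    case True
    then have "w = h" by (simp add: w_def fun_eq_iff)
    moreover have "sqnorm \<mu> h = 0"
      using self_adjoint_sym[OF T h(1) h(2)] True m by (simp add: L2_inner_def)
    ultimately show ?thesis by simp
  next
    case False
    have "(w, \<lambda>x. 1 * (\<nu> * \<phi> x) + (- m) * h x) \<in> B"
      unfolding w_def[abs_def] by (rule self_adjoint_lin[OF T h(2) h(1)])
    also have "(\<lambda>x. 1 * (\<nu> * \<phi> x) + (- m) * h x) = (\<lambda>x. (- m) * w x + 0 * w x)"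
      by (simp add: w_def m algebra_simps)
    finally have "0 \<le> - m * sqnorm \<mu> w"
      using pos L2_inner_lin[OF w w w, of "- m" 0] by fastforce
    then show ?thesis
      using False m sqnorm_nonneg[of \<mu> w] by (simp add: mult_le_0_iff)
  qed
  then have "AE x in \<mu>. w x = 0" by (rule sqnorm_0_AE[OF w])
  then have "AE x in \<mu>. h x = m * \<phi> x" by eventually_elim (simp add: w_def)
  then show ?thesis
    unfolding m_def[symmetric] using L by (intro self_adjoint_cong_AE[OF T h(1)] Lq2_scale) auto
qed

section \<open>Expansion of solutions in eigenfunctions\<close>

definition eigen_index :: "(nat \<Rightarrow> nat) \<Rightarrow> (nat \<times> nat) set" where
  "eigen_index D = Sigma UNIV (\<lambda>n. {..<D n})"

definition eigen_level :: "(nat \<Rightarrow> nat) \<Rightarrow> nat \<Rightarrow> (nat \<times> nat) set" where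
  "eigen_level D k = Sigma {..<k} (\<lambda>n. {..<D n})"

lemma eigen_level_props:
  "incseq (eigen_level D)" "finite (eigen_level D k)" "(\<Union>k. eigen_level D k) = eigen_index D"
  by (auto simp: eigen_level_def eigen_index_def mono_def)

lemma eigenvalue_nonneg: "A1 M V A \<nu> D \<phi> \<Longrightarrow> 0 \<le> \<nu> n"
  by (auto simp: A1_def intro: order_trans[of 0 "\<nu> 0"] strict_mono_leD)

lemma admissible_solution_time_derivative:
  assumes "admissible_solution \<alpha> p V Vt d dt B u"
  shows "\<exists>ut. has_weak_deriv (0, 1) u ut \<and> ut \<in> Lq 2 (mV V)" "locally_integrable u"
proof -
  obtain ut Bu where "W_data p V d B u ut Bu"
    using assms by (auto simp: admissible_solution_def weak_solution_def W_space_def)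
  then have "has_weak_deriv (0, 1) u ut" "ut \<in> Lq 2 (mV V)" by (auto simp: W_data_def)
  then show "\<exists>ut. has_weak_deriv (0, 1) u ut \<and> ut \<in> Lq 2 (mV V)" "locally_integrable u"
    by (auto simp: has_weak_deriv_def)
qed

text \<open>The reduction common to both parts. Multiplication by \<open>sqrt (V x)\<close> is an isometry from $L^2_V$ onto
  $L^2$, and the weight \<open>d\<close> can be dropped because it is bounded from below. Self-adjointness of \<open>B\<close>
  moves \<open>B\<close> from \<open>u\<close> to the eigenfunctions, which relates the coefficients of \<open>u\<close> and of \<open>B u\<close>. All
  functions are replaced by Borel representatives, so that Fubini's theorem for Borel measure
  applies.\<close>

theorem solution_expansion:
  fixes V :: "'a::euclidean_space \<Rightarrow> real" and u :: "'a \<times> real \<Rightarrow> real"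
    and S :: "nat \<times> nat \<Rightarrow> 'a \<Rightarrow> real"
  assumes V: "continuous_on UNIV V" "\<And>x. 0 < V x"
    and SA: "standing_assumptions M V Vt d dt A \<nu> D \<phi> \<alpha>"
    and B: "is_sqrt_op (weighted V) A B" and sol: "admissible_solution \<alpha> p V Vt d dt B u"
    and S: "\<And>n l. l < D n \<Longrightarrow> continuous_on UNIV (S (n, l)) \<and> (AE x in lborel. \<phi> n l x = S (n, l) x)"
  shows "\<exists>u' g'. u' \<in> borel_measurable borel \<and> (AE z in lborel. u z = u' z) \<and>
      slice_expansion (eigen_index D) (eigen_level D) (\<lambda>i x. sqrt (V x) * S i x)
        (\<lambda>(n, l). sqrt (\<nu> n)) (\<lambda>z. sqrt (V (fst z)) * u' z) g'"
    and "orthonormal lborel (eigen_index D) (\<lambda>i x. sqrt (V x) * S i x)"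
    and "f \<in> Lq 2 lborel \<Longrightarrow>
      (\<And>i. i \<in> eigen_index D \<Longrightarrow> L2_inner lborel f (\<lambda>x. sqrt (V x) * S i x) = 0) \<Longrightarrow>
      AE x in lborel. f x = 0"
proof -
  have A: "A1 M V A \<nu> D \<phi>" using SA by (simp add: standing_assumptions_def)
  obtain \<delta> where d: "d \<in> borel_measurable lebesgue" "\<And>t. 0 \<le> d t" "\<delta> > 0" "AE t in lebesgue. \<delta> \<le> d t"
    using SA by (auto simp: standing_assumptions_def A4_def)
  obtain ut Bu where W: "W_data p V d B u ut Bu"
    using sol by (auto simp: admissible_solution_def weak_solution_def W_space_def)
  have uB: "AE t in lebesgue. (\<lambda>x. u (x, t), \<lambda>x. Bu (x, t)) \<in> B"
    using W by (auto simp: W_data_def)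
  have u: "u \<in> Lq 2 (mVd V d)" "Bu \<in> Lq 2 (mVd V d)"
    using sol W by (auto simp: admissible_solution_def W_data_def)
  have Vb [measurable]: "V \<in> borel_measurable borel"
    using V(1) by (rule borel_measurable_continuous_onI)
  have Vl: "V \<in> borel_measurable lebesgue" using Vb by (simp add: measurable_completion)
  have V0: "0 \<le> V x" for x using V(2)[of x] by simp
  have sb [measurable]: "(\<lambda>x. sqrt (V x)) \<in> borel_measurable borel" by measurable
  define e where "e i x = sqrt (V x) * S i x" for i x
  have Sb: "S (n, l) \<in> borel_measurable borel" if "l < D n" for n l
    using S[OF that] by (auto intro: borel_measurable_continuous_onI)
  have eb: "e i \<in> borel_measurable borel" if "i \<in> eigen_index D" for i
    using Sb that unfolding e_def[abs_def] eigen_index_def by (auto intro!: borel_measurable_times)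
  have inner: "L2_inner (weighted V) f (\<phi> n l) = L2_inner lborel (\<lambda>x. sqrt (V x) * f' x) (e (n, l))"
    if "l < D n" "AE x in lborel. f x = f' x" "f' \<in> borel_measurable borel" for f f' n l
    unfolding e_def[abs_def] using S[OF that(1)] Sb[OF that(1)] that
    by (intro L2_inner_weighted[OF V]) auto
  have \<phi>L: "\<phi> n l \<in> Lq 2 (weighted V)" "(\<phi> n l, \<lambda>x. \<nu> n * \<phi> n l x) \<in> A" if "l < D n" for n l
    using A that by (auto simp: A1_def eigenspace_def)
  have Lq: "(\<lambda>x. sqrt (V x) * f' x) \<in> Lq 2 lborel"
    if "f \<in> Lq 2 (weighted V)" "AE x in lborel. f x = f' x" "f' \<in> borel_measurable borel" for f f'
  proof -
    note that(3)[measurable]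
    have ae: "AE x in lborel. V x * (f x)\<^sup>2 = V x * (f' x)\<^sup>2"
      using that(2) by eventually_elim simp
    have "integrable lebesgue (\<lambda>x. V x * (f x)\<^sup>2)"
      using that Lq2_weighted_iff[OF Vl V0] by auto
    then have "integrable lborel (\<lambda>x. V x * (f' x)\<^sup>2)"
      by (subst (asm) lebesgue_integral_cong_lborel(2)[OF _ ae]) auto
    then show ?thesis using V0 by (simp add: Lq2_iff power_mult_distrib)
  qed
  have eL: "e i \<in> Lq 2 lborel" if "i \<in> eigen_index D" for i
    using that Lq[OF \<phi>L(1)] S Sb unfolding e_def[abs_def] eigen_index_def by auto
  have on: "orthonormal lborel (eigen_index D) e"
    unfolding orthonormal_def
  proof (intro conjI ballI)
    fix i j assume ij: "i \<in> eigen_index D" "j \<in> eigen_index D"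
    obtain n l m k where nl: "i = (n, l)" "j = (m, k)" "l < D n" "k < D m"
      using ij by (auto simp: eigen_index_def)
    have "L2_inner (weighted V) (\<phi> n l) (\<phi> m k) = of_bool (n = m \<and> l = k)"
      using A nl by (auto simp: A1_def)
    then show "L2_inner lborel (e i) (e j) = of_bool (i = j)"
      using inner[of k m "\<phi> n l" "S (n, l)"] nl S Sb by (simp add: e_def[abs_def])
  qed (use eL in auto)
  then show "orthonormal lborel (eigen_index D) (\<lambda>i x. sqrt (V x) * S i x)"
    by (simp add: e_def[abs_def])
  show "AE x in lborel. f x = 0"
    if f: "f \<in> Lq 2 lborel"
      and 0: "\<And>i. i \<in> eigen_index D \<Longrightarrow> L2_inner lborel f (\<lambda>x. sqrt (V x) * S i x) = 0"
    for f :: "'a \<Rightarrow> real"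
  proof -
    define h where "h x = f x / sqrt (V x)" for x
    have [measurable]: "f \<in> borel_measurable borel" using f by (simp add: Lq2_iff)
    have hb [measurable]: "h \<in> borel_measurable borel" unfolding h_def[abs_def] by measurable
    have fh: "f = (\<lambda>x. sqrt (V x) * h x)" using V(2) by (auto simp: h_def less_imp_neq[symmetric])
    have Vh: "V x * (h x)\<^sup>2 = (f x)\<^sup>2" for x
      using V0[of x] unfolding fh by (simp add: power_mult_distrib)
    have "h \<in> Lq 2 (weighted V)"
      unfolding Lq2_weighted_iff[OF Vl V0] Vh using f hb
      by (simp add: Lq2_iff measurable_completion integrable_completion)
    moreover have "L2_inner (weighted V) h (\<phi> n l) = 0" if "l < D n" for n l
      using inner[OF that _ hb, of h] 0[of "(n, l)"] that fh by (simp add: e_def[abs_def] eigen_index_def)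
    ultimately have "AE x in weighted V. h x = 0"
      using A unfolding A1_def by blast
    then have "AE x in lborel. h x = 0"
      using AE_weighted_iff[OF Vl V(2)] by blast
    then show ?thesis by eventually_elim (simp add: fh)
  qed
  have dl: "(\<lambda>z :: 'a \<times> real. d (snd z)) \<in> borel_measurable lebesgue"
    by (rule lebesgue_measurable_snd[OF d(1)])
  have Vf: "(\<lambda>z :: 'a \<times> real. V (fst z)) \<in> borel_measurable borel"
    by (subst borel_prod[symmetric]) (rule measurable_compose[OF measurable_fst Vb])
  have wl: "(\<lambda>(x, t). V x * d t) \<in> borel_measurable (lebesgue :: ('a \<times> real) measure)"
  proof -
    have "(\<lambda>z :: 'a \<times> real. V (fst z)) \<in> borel_measurable lebesgue"
      using Vf by (simp add: measurable_completion)
    from borel_measurable_times[OF this dl] show ?thesis by (simp add: case_prod_beta')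
  qed
  have rep: "\<exists>v'. v' \<in> borel_measurable borel \<and> (AE z in lborel. v z = v' z) \<and>
      (\<lambda>z. sqrt (V (fst z)) * v' z) \<in> Lq 2 lborel"
    if v: "v \<in> Lq 2 (mVd V d)" for v :: "'a \<times> real \<Rightarrow> real"
  proof -
    have "v \<in> borel_measurable lebesgue \<and> integrable lebesgue (\<lambda>z. V (fst z) * d (snd z) * (v z)\<^sup>2)"
      using v V0 d(2) Lq2_weighted_iff[OF wl, of v] by (simp add: mVd_def case_prod_beta')
    then have vm: "v \<in> borel_measurable lebesgue"
      and vi: "integrable lebesgue (\<lambda>z. V (fst z) * d (snd z) * (v z)\<^sup>2)" by auto
    obtain v' where v': "v' \<in> borel_measurable borel" "AE z in lborel. v z = v' z"
      using borel_representative[OF vm] by blast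
    note v'(1)[measurable] Vf[measurable]
    have Vv: "(\<lambda>z. V (fst z) * (v' z)\<^sup>2) \<in> borel_measurable borel" by measurable
    have "integrable lebesgue (\<lambda>z. V (fst z) * (v' z)\<^sup>2)"
    proof (rule Bochner_Integration.integrable_bound[OF integrable_mult_right[OF vi, of "1 / \<delta>"]])
      show "(\<lambda>z. V (fst z) * (v' z)\<^sup>2) \<in> borel_measurable lebesgue"
        using Vv by (simp add: measurable_completion)
      have "AE z :: 'a \<times> real in lborel. \<delta> \<le> d (snd z)"
        using AE_snd[of "\<lambda>t. \<delta> \<le> d t"] d(4) by (simp add: AE_lebesgue_iff)
      then have "AE z in lborel. norm (V (fst z) * (v' z)\<^sup>2) \<le> norm (1 / \<delta> * (V (fst z) * d (snd z) * (v z)\<^sup>2))"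
        using v'(2)
      proof eventually_elim
        case (elim z)
        have "1 \<le> d (snd z) / \<delta>" using elim d(3) by simp
        then have "1 * (V (fst z) * (v z)\<^sup>2) \<le> d (snd z) / \<delta> * (V (fst z) * (v z)\<^sup>2)"
          using V0 by (intro mult_right_mono) auto
        then show ?case using elim V0[of "fst z"] d(2)[of "snd z"] d(3) by (simp add: mult_ac abs_mult)
      qed
      then show "AE z in lebesgue. norm (V (fst z) * (v' z)\<^sup>2) \<le> norm (1 / \<delta> * (V (fst z) * d (snd z) * (v z)\<^sup>2))"
        by (simp add: AE_lebesgue_iff)
    qed
    then have "integrable lborel (\<lambda>z. V (fst z) * (v' z)\<^sup>2)"
      using Vv by (simp add: integrable_completion)
    moreover have "(\<lambda>z. sqrt (V (fst z)) * v' z) \<in> borel_measurable borel" by measurable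
    ultimately have "(\<lambda>z. sqrt (V (fst z)) * v' z) \<in> Lq 2 lborel"
      using V0 by (simp add: Lq2_iff power_mult_distrib)
    then show ?thesis using v' by blast
  qed
  obtain u' where u': "u' \<in> borel_measurable borel" "AE z in lborel. u z = u' z"
      "(\<lambda>z. sqrt (V (fst z)) * u' z) \<in> Lq 2 lborel" using rep[OF u(1)] by blast
  obtain g' where g': "g' \<in> borel_measurable borel" "AE z in lborel. Bu z = g' z"
      "(\<lambda>z. sqrt (V (fst z)) * g' z) \<in> Lq 2 lborel" using rep[OF u(2)] by blast
  note \<nu>0 = eigenvalue_nonneg[OF A]
  have slice: "AE t in lborel. \<forall>i\<in>eigen_index D.
      L2_inner lborel (\<lambda>x. sqrt (V (fst (x, t))) * g' (x, t)) (e i)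
        = (case i of (n, l) \<Rightarrow> sqrt (\<nu> n)) * L2_inner lborel (\<lambda>x. sqrt (V (fst (x, t))) * u' (x, t)) (e i)"
    using uB[unfolded AE_lebesgue_iff] AE_slices[OF u'(2)] AE_slices[OF g'(2)]
  proof eventually_elim
    case (elim t)
    have T: "self_adjoint (weighted V) B" using B by (simp add: is_sqrt_op_def)
    have sec: "(\<lambda>x. v (x, t)) \<in> borel_measurable borel" if "v \<in> borel_measurable borel" for v :: "'a \<times> real \<Rightarrow> real"
    proof -
      have "(\<lambda>x::'a. (x, t)) \<in> borel \<rightarrow>\<^sub>M (borel \<Otimes>\<^sub>M borel)" by measurable
      from measurable_compose[OF this[unfolded borel_prod] that] show ?thesis .
    qed
    show ?case
    proof (intro ballI, clarify)
      fix n l assume "(n, l) \<in> eigen_index D"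
      then have l: "l < D n" by (simp add: eigen_index_def)
      have \<phi>: "(\<phi> n l, \<lambda>x. sqrt (\<nu> n) * \<phi> n l x) \<in> B"
        by (rule sqrt_op_eigenfunction[OF B \<phi>L(2)[OF l] \<nu>0])
      note L = self_adjoint_L2[OF T elim(1)]
      have "L2_inner (weighted V) (\<lambda>x. Bu (x, t)) (\<phi> n l)
          = L2_inner (weighted V) (\<lambda>x. u (x, t)) (\<lambda>x. sqrt (\<nu> n) * \<phi> n l x + 0 * \<phi> n l x)"
        using self_adjoint_sym[OF T elim(1) \<phi>] by simp
      also have "\<dots> = sqrt (\<nu> n) * L2_inner (weighted V) (\<lambda>x. u (x, t)) (\<phi> n l)"
        using L2_inner_lin[OF \<phi>L(1)[OF l] \<phi>L(1)[OF l], of "\<lambda>x. u (x, t)" "sqrt (\<nu> n)" 0] L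
        by (simp add: L2_inner_commute[of _ "\<lambda>x. u (x, t)"])
      finally show "L2_inner lborel (\<lambda>x. sqrt (V (fst (x, t))) * g' (x, t)) (e (n, l))
        = sqrt (\<nu> n) * L2_inner lborel (\<lambda>x. sqrt (V (fst (x, t))) * u' (x, t)) (e (n, l))"
        using inner[OF l elim(2) sec[OF u'(1)]] inner[OF l elim(3) sec[OF g'(1)]] by simp
    qed
  qed
  have "slice_expansion (eigen_index D) (eigen_level D) e
        (\<lambda>(n, l). sqrt (\<nu> n)) (\<lambda>z. sqrt (V (fst z)) * u' z) (\<lambda>z. sqrt (V (fst z)) * g' z)"
    using on eigen_level_props u'(3) g'(3) slice by unfold_locales auto
  then show "\<exists>u' g'. u' \<in> borel_measurable borel \<and> (AE z in lborel. u z = u' z) \<and>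
      slice_expansion (eigen_index D) (eigen_level D) (\<lambda>i x. sqrt (V x) * S i x)
        (\<lambda>(n, l). sqrt (\<nu> n)) (\<lambda>z. sqrt (V (fst z)) * u' z) g'"
    using u' unfolding e_def[abs_def] by blast
qed

section \<open>The harmonic oscillator\<close>

text \<open>Integration over the real line with the cut-off \<open>1 - (x/r)\<^sup>2\<close> on \<open>[-r, r]\<close>: the boundary terms
  \<open>E n\<close> vanish at the end points, and Fatou's lemma removes the cut-off.\<close>

lemma cutoff_integral:
  fixes P :: "real \<Rightarrow> real" and E E' Q :: "nat \<Rightarrow> real \<Rightarrow> real"
  defines "r \<equiv> \<lambda>n. real (Suc n)"
  assumes P: "continuous_on UNIV P" "\<And>x. 0 \<le> P x"
    and E: "\<And>n x. (E n has_real_derivative E' n x) (at x)" "\<And>n. continuous_on UNIV (E' n)"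
      "\<And>n. E n (r n) = 0" "\<And>n. E n (- r n) = 0"
    and Q: "\<And>n. integrable lborel (Q n)" "\<And>n x. 0 \<le> Q n x" "\<And>n. (LINT x|lborel. Q n x) \<le> K n"
    and lim: "K \<longlonglongrightarrow> C"
    and ineq: "\<And>n x. \<bar>x\<bar> \<le> r n \<Longrightarrow> (1 - (x / r n)\<^sup>2)\<^sup>2 * P x \<le> E' n x + Q n x"
  shows "integrable lborel P" "(LINT x|lborel. P x) \<le> C"
proof -
  have r: "r n > 0" for n by (simp add: r_def)
  define p where "p n x = indicator {- r n..r n} x * ((1 - (x / r n)\<^sup>2)\<^sup>2 * P x)" for n x
  have c1: "continuous_on {- r n..r n} (\<lambda>x. (1 - (x / r n)\<^sup>2)\<^sup>2 * P x)" for n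
    using r[of n] by (intro continuous_intros continuous_on_subset[OF P(1) subset_UNIV]) auto
  have pint: "integrable lborel (p n)" for n
    using borel_integrable_compact[OF compact_Icc c1[of n]] by (simp add: p_def[abs_def])
  have eint: "integrable lborel (\<lambda>x. E' n x * indicator {- r n..r n} x)" for n
    using borel_integrable_compact[OF compact_Icc continuous_on_subset[OF E(2) subset_UNIV], of "- r n" "r n" n]
    by (simp add: mult.commute)
  have "(LINT x|lborel. p n x) \<le> K n" for n
  proof -
    have "(LINT x|lborel. p n x) \<le> (LINT x|lborel. E' n x * indicator {- r n..r n} x + Q n x)"
    proof (rule integral_mono)
      show "p n x \<le> E' n x * indicator {- r n..r n} x + Q n x" for x
      proof (cases "x \<in> {- r n..r n}")
        case True
        then have "\<bar>x\<bar> \<le> r n" by auto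
        then show ?thesis using ineq[of x n] True by (simp add: p_def)
      qed (use Q(2) in \<open>simp add: p_def\<close>)
    qed (use pint eint Q in auto)
    also have "\<dots> = (E n (r n) - E n (- r n)) + (LINT x|lborel. Q n x)"
      using eint Q FTC_Icc[of "- r n" "r n" "E n" "E' n"] E r[of n] by simp
    also have "\<dots> \<le> K n" using E(3,4) Q(3) by simp
    finally show ?thesis .
  qed
  then have ev: "\<forall>\<^sub>F n in sequentially. integral\<^sup>L lborel (p n) \<le> K n" by simp
  have l: "AE x in lborel. (\<lambda>n. p n x) \<longlonglongrightarrow> P x"
  proof (intro AE_I2)
    fix x
    have ri: "(\<lambda>n. x / r n) \<longlonglongrightarrow> 0"
      unfolding r_def by (rule LIMSEQ_Suc[OF lim_const_over_n])
    have "(\<lambda>n. (1 - (x / r n)\<^sup>2)\<^sup>2 * P x) \<longlonglongrightarrow> (1 - 0\<^sup>2)\<^sup>2 * P x"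
      by (intro tendsto_intros ri)
    moreover have "\<forall>\<^sub>F n in sequentially. (1 - (x / r n)\<^sup>2)\<^sup>2 * P x = p n x"
    proof -
      obtain N :: nat where N: "\<bar>x\<bar> < real N" using reals_Archimedean2 by blast
      show ?thesis
        using eventually_ge_at_top[of N]
      proof eventually_elim
        case (elim n)
        then have "\<bar>x\<bar> \<le> r n" using N by (simp add: r_def)
        then have "x \<in> {- r n..r n}" by auto
        then show ?case by (simp add: p_def)
      qed
    qed
    ultimately show "(\<lambda>n. p n x) \<longlonglongrightarrow> P x"
      using Lim_transform_eventually by fastforce
  qed
  have p0: "0 \<le> p n x" for n x using P(2) by (simp add: p_def)
  have Pm: "P \<in> borel_measurable lborel"
    using borel_measurable_continuous_onI[OF P(1)] by simp
  show "integrable lborel P" "(LINT x|lborel. P x) \<le> C"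
    using integral_Fatou[OF pint p0 ev lim l Pm] by auto
qed

lemma quadratic_term: "2 * (a::real) * b \<ge> - (c * a\<^sup>2 + b\<^sup>2 / c)" if "c > 0"
proof -
  have "0 \<le> (c * a + b)\<^sup>2 / c" using that by simp
  also have "\<dots> = c * a\<^sup>2 + b\<^sup>2 / c + 2 * a * b"
    using that by (simp add: power2_sum field_simps power2_eq_square)
  finally show ?thesis by linarith
qed

text \<open>A priori estimate: multiply \<open>- S'' + x\<^sup>2 S = G\<close> by \<open>\<eta>\<^sup>2 (1 + x\<^sup>2) S\<close> with the cut-off \<open>\<eta>\<close>, integrate
  by parts, and absorb the mixed terms. The boundary function is \<open>E = \<eta>\<^sup>2 (1 + x\<^sup>2) S S'\<close>, and three
  quarters of the good term in \<open>S'\<close> and half of the one in \<open>S\<close> are spent on the absorption.\<close>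

lemma harmonic_estimate:
  assumes S: "\<And>x. (S has_real_derivative S1 x) (at x)" "\<And>x. (S1 has_real_derivative S2 x) (at x)"
    and c: "continuous_on UNIV S2" and SL: "S \<in> Lq 2 lborel"
    and GL: "(\<lambda>x. x\<^sup>2 * S x - S2 x) \<in> Lq 2 lborel"
  defines "C \<equiv> sqnorm lborel (\<lambda>x. x\<^sup>2 * S x - S2 x) + sqnorm lborel S"
  shows "S1 \<in> Lq 2 lborel \<and> sqnorm lborel S1 \<le> 142 * C"
    "(\<lambda>x. x * S1 x) \<in> Lq 2 lborel \<and> sqnorm lborel (\<lambda>x. x * S1 x) \<le> 142 * C"
    "(\<lambda>x. x\<^sup>2 * S x) \<in> Lq 2 lborel \<and> sqnorm lborel (\<lambda>x. x\<^sup>2 * S x) \<le> 142 * C"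
    "S2 \<in> Lq 2 lborel \<and> sqnorm lborel S2 \<le> 142 * C"
proof -
  define G where "G x = x\<^sup>2 * S x - S2 x" for x
  have Sc: "continuous_on UNIV S" "continuous_on UNIV S1"
    by (rule has_real_derivative_continuous[OF S(1)], rule has_real_derivative_continuous[OF S(2)])
  define P where "P x = (1 + x\<^sup>2) * (S1 x)\<^sup>2 / 4 + (1 + x\<^sup>2) * x\<^sup>2 * (S x)\<^sup>2 / 2" for x
  define r where "r n = real (Suc n)" for n
  have r: "r n \<ge> 1" for n by (simp add: r_def)
  define \<eta> where "\<eta> n x = 1 - (x / r n)\<^sup>2" for n x
  define \<eta>' where "\<eta>' n x = - 2 * x / (r n)\<^sup>2" for n x
  define q where "q n x = (\<eta> n x)\<^sup>2 * (1 + x\<^sup>2)" for n x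
  define q' where "q' n x = 2 * \<eta> n x * \<eta>' n x * (1 + x\<^sup>2) + (\<eta> n x)\<^sup>2 * (2 * x)" for n x
  have \<eta>': "(\<eta> n has_real_derivative \<eta>' n x) (at x)" for n x
    unfolding \<eta>_def[abs_def] \<eta>'_def using r[of n]
    by (auto intro!: derivative_eq_intros simp: power2_eq_square field_simps)
  have q': "(q n has_real_derivative q' n x) (at x)" for n x
    unfolding q_def[abs_def] q'_def
    by (rule derivative_eq_intros \<eta>' refl)+ (simp add: algebra_simps)
  define E where "E n x = q n x * (S x * S1 x)" for n x
  define E' where "E' n x = q' n x * (S x * S1 x) + q n x * (S1 x * S1 x + S x * S2 x)" for n x
  define Q where "Q x = (G x)\<^sup>2 + 35 * (S x)\<^sup>2" for x
  have E': "(E n has_real_derivative E' n x) (at x)" for n x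
    unfolding E_def[abs_def] E'_def
    by (rule derivative_eq_intros q' S refl)+ (simp add: algebra_simps)
  have \<eta>c: "continuous_on UNIV (\<eta> n)" "continuous_on UNIV (\<eta>' n)" for n
    unfolding \<eta>_def[abs_def] \<eta>'_def[abs_def] using r[of n] by (auto intro!: continuous_intros)
  have E'c: "continuous_on UNIV (E' n)" for n
    unfolding E'_def[abs_def] q'_def q_def by (intro continuous_intros \<eta>c Sc c)
  have GS: "integrable lborel (\<lambda>x. (G x)\<^sup>2)" "integrable lborel (\<lambda>x. (S x)\<^sup>2)"
    using SL GL by (auto simp: Lq2_iff G_def)
  have Qi: "integrable lborel Q" unfolding Q_def[abs_def] using GS by simp
  have Qv: "(LINT x|lborel. Q x) \<le> 35 * C"
  proof -
    have "(LINT x|lborel. Q x) = sqnorm lborel G + 35 * sqnorm lborel S"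
      unfolding Q_def[abs_def] using GS by (simp add: sqnorm_eq)
    also have "\<dots> \<le> 35 * C"
      using sqnorm_nonneg[of lborel G] by (simp add: C_def G_def[abs_def])
    finally show ?thesis .
  qed
  have ineq: "(\<eta> n x)\<^sup>2 * P x \<le> E' n x + Q x" if x: "\<bar>x\<bar> \<le> r n" for n x
  proof -
    define X where "X = (\<eta> n x)\<^sup>2"
    define y where "y = x\<^sup>2"
    have y: "0 \<le> y" "y \<le> (r n)\<^sup>2" using x by (auto simp: y_def abs_le_square_iff[symmetric] power2_le_iff_abs_le)
    have r2: "1 \<le> (r n)\<^sup>2" using r[of n] by simp
    have X: "0 \<le> X" "X \<le> 1"
    proof -
      have "0 \<le> \<eta> n x" "\<eta> n x \<le> 1"
        using y r2 by (auto simp: \<eta>_def power_divide y_def[symmetric] divide_le_eq)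
      then show "0 \<le> X" "X \<le> 1" by (auto simp: X_def power_le_one)
    qed
    have d: "(\<eta>' n x)\<^sup>2 * (1 + y) \<le> 8"
    proof -
      have "(\<eta>' n x)\<^sup>2 * (1 + y) = 4 * (y / (r n)\<^sup>2) * ((1 + y) / (r n)\<^sup>2)"
        by (simp add: \<eta>'_def y_def power2_eq_square field_simps)
      also have "\<dots> \<le> 4 * 1 * 2"
        using y r2 by (intro mult_mono) (auto simp: divide_le_eq)
      finally show ?thesis by simp
    qed
    \<comment> \<open>the derivative of the cut-off, the derivative of the weight, and the right-hand side; they cost
      32, 2 and 1 times \<open>S\<^sup>2\<close>, which explains the 35\<close>
    have t1: "2 * (\<eta> n x * S1 x) * (\<eta>' n x * S x) * (1 + y) \<ge> - (X * (1 + y) * (S1 x)\<^sup>2 / 4 + 32 * (S x)\<^sup>2)"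
    proof -
      have "2 * (\<eta> n x * S1 x) * (\<eta>' n x * S x) \<ge> - (1/4 * (\<eta> n x * S1 x)\<^sup>2 + (\<eta>' n x * S x)\<^sup>2 / (1/4))"
        by (rule quadratic_term) simp
      from mult_right_mono[OF this, of "1 + y"] y
      have "2 * (\<eta> n x * S1 x) * (\<eta>' n x * S x) * (1 + y)
          \<ge> - (X * (1 + y) * (S1 x)\<^sup>2 / 4 + 4 * ((\<eta>' n x)\<^sup>2 * (1 + y)) * (S x)\<^sup>2)"
        by (simp add: X_def power_mult_distrib algebra_simps)
      moreover have "((\<eta>' n x)\<^sup>2 * (1 + y)) * (S x)\<^sup>2 \<le> 8 * (S x)\<^sup>2"
        using d by (rule mult_right_mono) simp
      ultimately show ?thesis by linarith
    qed
    have t2: "X * (2 * (x * S1 x) * S x) \<ge> - (X * (1 + y) * (S1 x)\<^sup>2 / 2 + 2 * (S x)\<^sup>2)"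
    proof -
      have "2 * (x * S1 x) * S x \<ge> - (1/2 * (x * S1 x)\<^sup>2 + (S x)\<^sup>2 / (1/2))"
        by (rule quadratic_term) simp
      from mult_left_mono[OF this X(1)]
      have "X * (2 * (x * S1 x) * S x) \<ge> - (X * y * (S1 x)\<^sup>2 / 2 + 2 * (X * (S x)\<^sup>2))"
        by (simp add: y_def power_mult_distrib algebra_simps)
      moreover have "X * (S x)\<^sup>2 \<le> 1 * (S x)\<^sup>2" using X by (intro mult_right_mono) auto
      moreover have "X * y * (S1 x)\<^sup>2 \<le> X * (1 + y) * (S1 x)\<^sup>2"
        using X y by (intro mult_right_mono mult_left_mono) auto
      ultimately show ?thesis by linarith
    qed
    have t3: "X * (1 + y) * (S x * G x) \<le> (G x)\<^sup>2 + X * (1 + y) * y * (S x)\<^sup>2 / 2 + (S x)\<^sup>2"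
    proof -
      have "2 * ((1 + y) * S x) * (- G x) \<ge> - (1/2 * ((1 + y) * S x)\<^sup>2 + (- G x)\<^sup>2 / (1/2))"
        by (rule quadratic_term) simp
      moreover have "2 * ((1 + y) * S x) * (- G x) = - 2 * ((1 + y) * (S x * G x))" by simp
      moreover have "1/2 * ((1 + y) * S x)\<^sup>2 + (- G x)\<^sup>2 / (1/2) = (1 + y)\<^sup>2 * (S x)\<^sup>2 / 2 + 2 * (G x)\<^sup>2"
        by (simp add: power_mult_distrib)
      ultimately have "(1 + y) * (S x * G x) \<le> (1 + y)\<^sup>2 * (S x)\<^sup>2 / 4 + (G x)\<^sup>2"
        by linarith
      also have "\<dots> \<le> (1 + 2 * y * (1 + y)) * (S x)\<^sup>2 / 4 + (G x)\<^sup>2"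
        using y by (intro add_right_mono divide_right_mono mult_right_mono) (auto simp: power2_eq_square algebra_simps)
      finally have "X * ((1 + y) * (S x * G x)) \<le> X * ((1 + 2 * y * (1 + y)) * (S x)\<^sup>2 / 4 + (G x)\<^sup>2)"
        using X by (intro mult_left_mono) auto
      also have "\<dots> = X * (1 + y) * y * (S x)\<^sup>2 / 2 + (X * (S x)\<^sup>2 / 4 + X * (G x)\<^sup>2)"
        by (simp add: algebra_simps)
      finally have "X * (1 + y) * (S x * G x) \<le> X * (1 + y) * y * (S x)\<^sup>2 / 2 + (X * (S x)\<^sup>2 / 4 + X * (G x)\<^sup>2)"
        by (simp add: mult.assoc)
      moreover have "X * (S x)\<^sup>2 \<le> 1 * (S x)\<^sup>2" "X * (G x)\<^sup>2 \<le> 1 * (G x)\<^sup>2"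
        by (rule mult_right_mono[OF X(2) zero_le_power2])+
      moreover have "0 \<le> (S x)\<^sup>2" by simp
      ultimately show ?thesis by linarith
    qed
    have E'eq: "E' n x = 2 * (\<eta> n x * S1 x) * (\<eta>' n x * S x) * (1 + y) + X * (2 * (x * S1 x) * S x)
        + X * (1 + y) * (S1 x)\<^sup>2 + X * (1 + y) * y * (S x)\<^sup>2 - X * (1 + y) * (S x * G x)"
      by (simp add: E'_def q'_def q_def G_def X_def y_def power2_eq_square algebra_simps)
    have Peq: "(\<eta> n x)\<^sup>2 * P x = X * (1 + y) * (S1 x)\<^sup>2 / 4 + X * (1 + y) * y * (S x)\<^sup>2 / 2"
      by (simp add: P_def X_def y_def algebra_simps)
    have "0 \<le> (S x)\<^sup>2" by simp
    then show ?thesis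
      unfolding E'eq Peq Q_def using t1 t2 t3 by linarith
  qed
  have Pc: "continuous_on UNIV P"
    unfolding P_def[abs_def] by (intro continuous_intros Sc) auto
  have P0: "0 \<le> P x" for x by (simp add: P_def)
  have \<eta>0: "\<eta> n (r n) = 0" "\<eta> n (- r n) = 0" for n
    using r[of n] by (auto simp: \<eta>_def power_divide)
  have rr: "E n (real (Suc n)) = 0" "E n (- real (Suc n)) = 0" for n
    using \<eta>0[of n, unfolded r_def] by (auto simp: E_def q_def simp del: of_nat_Suc)
  have Q0: "0 \<le> Q x" for x by (simp add: Q_def)
  have Pint: "integrable lborel P" "(LINT x|lborel. P x) \<le> 35 * C"
    using cutoff_integral[OF Pc P0 E' E'c rr Qi Q0 Qv tendsto_const] ineq
    unfolding \<eta>_def r_def by auto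
  have dom: "f \<in> Lq 2 lborel \<and> sqnorm lborel f \<le> 4 * (35 * C)"
    if f: "continuous_on UNIV f" "\<And>x. (f x)\<^sup>2 \<le> 4 * P x" for f
  proof -
    have [measurable]: "f \<in> borel_measurable lborel"
      using borel_measurable_continuous_onI[OF f(1)] by simp
    have i4: "integrable lborel (\<lambda>x. 4 * P x)" using Pint by simp
    have i: "integrable lborel (\<lambda>x. (f x)\<^sup>2)"
      by (rule Bochner_Integration.integrable_bound[OF i4]) (use f P0 in auto)
    have "(LINT x|lborel. (f x)\<^sup>2) \<le> (LINT x|lborel. 4 * P x)"
      by (rule integral_mono[OF i i4 f(2)])
    also have "\<dots> \<le> 4 * (35 * C)" using Pint by simp
    finally show ?thesis using i by (simp add: Lq2_iff sqnorm_eq)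
  qed
  have P4: "4 * P x = (S1 x)\<^sup>2 + (x * S1 x)\<^sup>2 + 2 * (x * S x)\<^sup>2 + 2 * (x\<^sup>2 * S x)\<^sup>2" for x
    by (simp add: P_def field_simps power2_eq_square)
  have C0: "0 \<le> C" by (simp add: C_def sqnorm_nonneg)
  have 1: "S1 \<in> Lq 2 lborel \<and> sqnorm lborel S1 \<le> 4 * (35 * C)"
    by (rule dom[OF Sc(2)]) (simp add: P4)
  have 2: "(\<lambda>x. x * S1 x) \<in> Lq 2 lborel \<and> sqnorm lborel (\<lambda>x. x * S1 x) \<le> 4 * (35 * C)"
    by (rule dom) (auto intro!: continuous_intros Sc simp: P4)
  define z where "z x = sqrt 2 * (x\<^sup>2 * S x)" for x
  have z3: "z \<in> Lq 2 lborel \<and> sqnorm lborel z \<le> 4 * (35 * C)"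
    unfolding z_def[abs_def]
  proof (rule dom)
    fix x
    have "(sqrt 2 * (x\<^sup>2 * S x))\<^sup>2 = 2 * (x\<^sup>2 * S x)\<^sup>2"
      by (subst power_mult_distrib) simp
    then show "(sqrt 2 * (x\<^sup>2 * S x))\<^sup>2 \<le> 4 * P x"
      by (simp add: P4)
  qed (intro continuous_intros Sc)
  have 3: "(\<lambda>x. x\<^sup>2 * S x) \<in> Lq 2 lborel \<and> sqnorm lborel (\<lambda>x. x\<^sup>2 * S x) \<le> 70 * C"
  proof -
    have "(\<lambda>x. (1 / sqrt 2) * z x) \<in> Lq 2 lborel" using z3 by (intro Lq2_scale) auto
    moreover have "(\<lambda>x. (1 / sqrt 2) * z x) = (\<lambda>x. x\<^sup>2 * S x)" by (simp add: z_def)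
    moreover have "sqnorm lborel z = 2 * sqnorm lborel (\<lambda>x. x\<^sup>2 * S x)"
      by (simp add: sqnorm_eq z_def power_mult_distrib)
    ultimately show ?thesis using z3 by simp
  qed
  have GL': "G \<in> Lq 2 lborel" using GL by (simp add: G_def[abs_def])
  have mG: "(\<lambda>x. (- 1) * G x) \<in> Lq 2 lborel" by (rule Lq2_scale[OF GL'])
  have S2eq: "S2 = (\<lambda>x. x\<^sup>2 * S x + (- 1) * G x)" by (auto simp: G_def)
  have "sqnorm lborel (\<lambda>x. (- 1) * G x) = sqnorm lborel G" by (simp add: L2_inner_def)
  moreover have "C = sqnorm lborel G + sqnorm lborel S" by (simp add: C_def G_def[abs_def])
  ultimately have "sqnorm lborel (\<lambda>x. (- 1) * G x) \<le> C"
    using sqnorm_nonneg[of lborel S] by linarith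
  then have "sqnorm lborel S2 \<le> 2 * (70 * C) + 2 * C"
    using sqnorm_add_le[OF conjunct1[OF 3] mG] 3 unfolding S2eq[symmetric] by linarith
  moreover have "S2 \<in> Lq 2 lborel"
    using Lq2_add[OF conjunct1[OF 3] mG] unfolding S2eq[symmetric] .
  ultimately show "S2 \<in> Lq 2 lborel \<and> sqnorm lborel S2 \<le> 142 * C" by simp
  show "S1 \<in> Lq 2 lborel \<and> sqnorm lborel S1 \<le> 142 * C"
    "(\<lambda>x. x * S1 x) \<in> Lq 2 lborel \<and> sqnorm lborel (\<lambda>x. x * S1 x) \<le> 142 * C"
    "(\<lambda>x. x\<^sup>2 * S x) \<in> Lq 2 lborel \<and> sqnorm lborel (\<lambda>x. x\<^sup>2 * S x) \<le> 142 * C"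
    using 1 2 3 C0 by auto
qed

text \<open>Positivity of the oscillator, in the form needed for square roots. Testing with \<open>\<eta>\<^sup>2 w\<close> leaves only the term \<open>(\<eta>')\<^sup>2 w\<^sup>2\<close>, which vanishes in the limit.\<close>

lemma harmonic_positive:
  assumes w: "\<And>x. (w has_real_derivative w1 x) (at x)"
      "\<And>x. (w1 has_real_derivative (x\<^sup>2 + m) * w x) (at x)"
    and wL: "w \<in> Lq 2 lborel" and m: "0 \<le> m"
  shows "AE x in lborel. w x = 0"
proof -
  have wc: "continuous_on UNIV w" "continuous_on UNIV w1"
    by (rule has_real_derivative_continuous[OF w(1)], rule has_real_derivative_continuous[OF w(2)])
  define P where "P x = x\<^sup>2 * (w x)\<^sup>2" for x
  define r where "r n = real (Suc n)" for n
  have r: "r n \<ge> 1" for n by (simp add: r_def)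
  define \<eta> where "\<eta> n x = 1 - (x / r n)\<^sup>2" for n x
  define \<eta>' where "\<eta>' n x = - 2 * x / (r n)\<^sup>2" for n x
  have \<eta>': "(\<eta> n has_real_derivative \<eta>' n x) (at x)" for n x
    unfolding \<eta>_def[abs_def] \<eta>'_def using r[of n]
    by (auto intro!: derivative_eq_intros simp: power2_eq_square field_simps)
  define E where "E n x = (\<eta> n x)\<^sup>2 * (w x * w1 x)" for n x
  define E' where "E' n x = 2 * (\<eta> n x * w1 x) * (\<eta>' n x * w x)
      + (\<eta> n x)\<^sup>2 * (w1 x * w1 x + w x * ((x\<^sup>2 + m) * w x))" for n x
  define Q where "Q n x = (4 / (r n)\<^sup>2) * (w x)\<^sup>2" for n x
  have E': "(E n has_real_derivative E' n x) (at x)" for n x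
    unfolding E_def[abs_def] E'_def
    by (rule derivative_eq_intros \<eta>' w refl)+ (simp add: algebra_simps)
  have \<eta>c: "continuous_on UNIV (\<eta> n)" "continuous_on UNIV (\<eta>' n)" for n
    unfolding \<eta>_def[abs_def] \<eta>'_def[abs_def] using r[of n] by (auto intro!: continuous_intros)
  have E'c: "continuous_on UNIV (E' n)" for n
    unfolding E'_def[abs_def] by (intro continuous_intros \<eta>c wc)
  have wi: "integrable lborel (\<lambda>x. (w x)\<^sup>2)" using wL by (simp add: Lq2_iff)
  have Qi: "integrable lborel (Q n)" for n unfolding Q_def[abs_def] using wi by simp
  have Qv: "(LINT x|lborel. Q n x) \<le> 4 / (r n)\<^sup>2 * sqnorm lborel w" for n
    by (simp add: Q_def sqnorm_eq)
  have lim: "(\<lambda>n. 4 / (r n)\<^sup>2 * sqnorm lborel w) \<longlonglongrightarrow> 0"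
  proof -
    have "(\<lambda>n. 2 / r n) \<longlonglongrightarrow> 0"
      unfolding r_def by (rule LIMSEQ_Suc[OF lim_const_over_n])
    then have "(\<lambda>n. (2 / r n)\<^sup>2 * sqnorm lborel w) \<longlonglongrightarrow> 0\<^sup>2 * sqnorm lborel w"
      by (intro tendsto_intros)
    then show ?thesis by (simp add: power_divide)
  qed
  have ineq: "(\<eta> n x)\<^sup>2 * P x \<le> E' n x + Q n x" if x: "\<bar>x\<bar> \<le> r n" for n x
  proof -
    have "2 * (\<eta> n x * w1 x) * (\<eta>' n x * w x) \<ge> - (1 * (\<eta> n x * w1 x)\<^sup>2 + (\<eta>' n x * w x)\<^sup>2 / 1)"
      by (rule quadratic_term) simp
    moreover have "(\<eta>' n x)\<^sup>2 * (w x)\<^sup>2 \<le> (4 / (r n)\<^sup>2) * (w x)\<^sup>2"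
    proof (rule mult_right_mono)
      have "(\<eta>' n x)\<^sup>2 = 4 / (r n)\<^sup>2 * (x\<^sup>2 / (r n)\<^sup>2)"
        by (simp add: \<eta>'_def power2_eq_square)
      also have "\<dots> \<le> 4 / (r n)\<^sup>2 * 1"
        using x r[of n] by (intro mult_left_mono) (auto simp: divide_le_eq abs_le_square_iff[symmetric])
      finally show "(\<eta>' n x)\<^sup>2 \<le> 4 / (r n)\<^sup>2" by simp
    qed simp
    moreover have "0 \<le> (\<eta> n x)\<^sup>2 * (m * (w x)\<^sup>2)" using m by simp
    ultimately show ?thesis
      by (simp add: P_def E'_def Q_def power_mult_distrib power2_eq_square algebra_simps)
  qed
  have Pc: "continuous_on UNIV P"
    unfolding P_def[abs_def] by (intro continuous_intros wc)
  have P0: "0 \<le> P x" for x by (simp add: P_def)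
  have \<eta>0: "\<eta> n (r n) = 0" "\<eta> n (- r n) = 0" for n
    using r[of n] by (auto simp: \<eta>_def power_divide)
  have rr: "E n (real (Suc n)) = 0" "E n (- real (Suc n)) = 0" for n
    using \<eta>0[of n, unfolded r_def] by (auto simp: E_def simp del: of_nat_Suc)
  have Q0: "0 \<le> Q n x" for n x by (simp add: Q_def)
  have Pint: "integrable lborel P" "(LINT x|lborel. P x) \<le> 0"
    using cutoff_integral[OF Pc P0 E' E'c rr Qi Q0 Qv lim] ineq
    unfolding \<eta>_def r_def by auto
  have "(LINT x|lborel. P x) = 0"
    using Pint(2) P0 by (intro antisym integral_nonneg) auto
  then have "AE x in lborel. P x = 0"
    using integral_nonneg_eq_0_iff_AE[OF Pint(1)] P0 by auto
  then show ?thesis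
    using AE_lborel_singleton[of 0] by eventually_elim (simp add: P_def)
qed

lemma harmonic_expr_eq: "harmonic_expr \<psi> x = x\<^sup>2 * \<psi> x - pd 1 (pd 1 \<psi>) x"
  by (simp add: harmonic_expr_def)

lemma harmonic_classical:
  assumes f: "(f, \<lambda>x. \<kappa> * f x) \<in> harmonic_oscillator"
  shows "\<exists>S S1. (\<forall>x. (S has_real_derivative S1 x) (at x)) \<and>
      (\<forall>x. (S1 has_real_derivative (x\<^sup>2 - \<kappa>) * S x) (at x)) \<and>
      S \<in> Lq 2 lborel \<and> (AE x in lborel. f x = S x)"
proof -
  have fL: "f \<in> Lq 2 lebesgue" and weak: "\<And>\<psi>. \<psi> \<in> test_fun \<Longrightarrow>
      (LINT x|lebesgue. f x * harmonic_expr \<psi> x) = (LINT x|lebesgue. \<kappa> * f x * \<psi> x)"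
    using f by (auto simp: harmonic_oscillator_def)
  obtain f' where f': "f' \<in> borel_measurable borel" "AE x in lborel. f x = f' x"
    using borel_representative[OF Lq2_measurable[OF fL]] by blast
  have f'L: "f' \<in> Lq 2 lborel" using Lq2_lebesgue_iff[OF f'] fL by blast
  note f'loc = loc_int_Lq2[OF f'L]
  have "\<exists>S S1. (\<forall>x. (S has_real_derivative S1 x) (at x)) \<and>
      (\<forall>x. (S1 has_real_derivative (x\<^sup>2 - \<kappa>) * S x) (at x)) \<and> (AE x in lborel. f' x = S x)"
  proof (rule weak_solution_classical[OF f'loc])
    show "continuous_on UNIV (\<lambda>x. x\<^sup>2 - \<kappa>)" by (intro continuous_intros)
    fix \<psi> :: "real \<Rightarrow> real" assume \<psi>: "\<psi> \<in> test_fun"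
    note \<psi>2 = test_fun_pd1[OF test_fun_pd1[OF \<psi>]]
    have x2: "smooth (\<lambda>x::real. x\<^sup>2)"
      by (intro smooth_power smooth_linear) simp
    note \<psi>x = smooth_mult_test[OF x2 \<psi>]
    have meas [measurable]: "\<psi> \<in> borel_measurable borel" "pd 1 (pd 1 \<psi>) \<in> borel_measurable borel"
      using \<psi> \<psi>2 by (auto intro!: borel_measurable_continuous_onI smooth_continuous test_fun_smooth)
    note f'(1)[measurable]
    have "(LINT x|lebesgue. f x * harmonic_expr \<psi> x)
        = (LINT x|lborel. f' x * (x\<^sup>2 * \<psi> x) - f' x * pd 1 (pd 1 \<psi>) x)"
    proof (rule lebesgue_integral_cong_lborel)
      show "AE x in lborel. f x * harmonic_expr \<psi> x = f' x * (x\<^sup>2 * \<psi> x) - f' x * pd 1 (pd 1 \<psi>) x"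
        using f'(2) by eventually_elim (simp add: harmonic_expr_eq algebra_simps)
    qed measurable
    moreover have "(LINT x|lebesgue. \<kappa> * f x * \<psi> x) = (LINT x|lborel. \<kappa> * (f' x * \<psi> x))"
    proof (rule lebesgue_integral_cong_lborel)
      show "AE x in lborel. \<kappa> * f x * \<psi> x = \<kappa> * (f' x * \<psi> x)"
        using f'(2) by eventually_elim simp
    qed measurable
    moreover have "(x\<^sup>2 - \<kappa>) * f' x * \<psi> x = f' x * (x\<^sup>2 * \<psi> x) - \<kappa> * (f' x * \<psi> x)" for x
      by (simp add: algebra_simps)
    ultimately show "(LINT x|lborel. f' x * pd 1 (pd 1 \<psi>) x) = (LINT x|lborel. (x\<^sup>2 - \<kappa>) * f' x * \<psi> x)"
      using weak[OF \<psi>] loc_int_test[OF f'loc \<psi>] loc_int_test[OF f'loc \<psi>2] loc_int_test[OF f'loc \<psi>x]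
      by simp
  qed
  then obtain S S1 where S: "\<forall>x. (S has_real_derivative S1 x) (at x)"
      "\<forall>x. (S1 has_real_derivative (x\<^sup>2 - \<kappa>) * S x) (at x)" "AE x in lborel. f' x = S x" by blast
  have "continuous_on UNIV S"
    by (rule has_real_derivative_continuous[OF S(1)[rule_format]])
  then have "S \<in> borel_measurable borel" by (rule borel_measurable_continuous_onI)
  then have "S \<in> Lq 2 lborel"
    using Lq2_cong_AE[OF f'L S(3)] by simp
  moreover have "AE x in lborel. f x = S x"
    using f'(2) S(3) by eventually_elim simp
  ultimately show ?thesis using S by blast
qed

lemma harmonic_oscillator_lin:
  assumes "(f, g) \<in> harmonic_oscillator" "(h, k) \<in> harmonic_oscillator"
  shows "(\<lambda>x. a * f x + b * h x, \<lambda>x. a * g x + b * k x) \<in> harmonic_oscillator"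
proof -
  have int: "integrable lebesgue (\<lambda>x. v x * \<psi> x)" if "v \<in> Lq 2 lebesgue" "\<psi> \<in> test_fun"
    for v \<psi> :: "real \<Rightarrow> real"
  proof (rule Lq2_mult_integrable[OF that(1)])
    have "\<psi> \<in> Lq 2 lborel"
      by (intro Lq2_continuous_bounded_support smooth_continuous test_fun_smooth test_fun_bounded that)
    then show "\<psi> \<in> Lq 2 lebesgue"
      using Lq2_lebesgue_iff[of \<psi> \<psi>] by (simp add: Lq2_iff)
  qed
  have ht: "harmonic_expr \<psi> \<in> test_fun" if \<psi>: "\<psi> \<in> test_fun" for \<psi>
  proof -
    have "smooth (\<lambda>x::real. x\<^sup>2)"
      by (intro smooth_power smooth_linear) simp
    from test_fun_lin[OF smooth_mult_test[OF this \<psi>] test_fun_pd1[OF test_fun_pd1[OF \<psi>]], of "- 1"]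
    show ?thesis by (simp add: harmonic_expr_eq[abs_def])
  qed
  have L: "f \<in> Lq 2 lebesgue" "g \<in> Lq 2 lebesgue" "h \<in> Lq 2 lebesgue" "k \<in> Lq 2 lebesgue"
    using assms by (auto simp: harmonic_oscillator_def)
  have "(LINT x|lebesgue. (a * f x + b * h x) * harmonic_expr \<psi> x)
      = (LINT x|lebesgue. (a * g x + b * k x) * \<psi> x)" if \<psi>: "\<psi> \<in> test_fun" for \<psi>
  proof -
    have "(LINT x|lebesgue. a * (f x * harmonic_expr \<psi> x) + b * (h x * harmonic_expr \<psi> x))
      = (LINT x|lebesgue. a * (g x * \<psi> x) + b * (k x * \<psi> x))"
      using assms \<psi> int[OF L(1) ht[OF \<psi>]] int[OF L(3) ht[OF \<psi>]] int[OF L(2) \<psi>] int[OF L(4) \<psi>]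
      by (simp add: harmonic_oscillator_def)
    then show ?thesis by (simp add: algebra_simps)
  qed
  then show ?thesis using L by (auto simp: harmonic_oscillator_def intro!: Lq2_lin)
qed

text \<open>As for abstract square roots, the difference between \<open>H f\<close> and \<open>sqrt \<nu> f\<close> is an eigenfunction of \<open>H\<close> with
  the eigenvalue \<open>- sqrt \<nu>\<close>; here \<open>harmonic_positive\<close> excludes it.\<close>

lemma harmonic_square_eigenfunction:
  assumes A: "(f, \<lambda>x. \<nu> * f x) \<in> harmonic_oscillator O harmonic_oscillator" and \<nu>: "0 \<le> \<nu>"
  shows "\<exists>S S1. (\<forall>x. (S has_real_derivative S1 x) (at x)) \<and>
      (\<forall>x. (S1 has_real_derivative (x\<^sup>2 - sqrt \<nu>) * S x) (at x)) \<and>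
      S \<in> Lq 2 lborel \<and> (AE x in lborel. f x = S x)"
proof (rule harmonic_classical)
  obtain h where h: "(f, h) \<in> harmonic_oscillator" "(h, \<lambda>x. \<nu> * f x) \<in> harmonic_oscillator"
    using A by auto
  define m where "m = sqrt \<nu>"
  have m: "0 \<le> m" "\<nu> = m * m" using \<nu> by (auto simp: m_def)
  define w where "w x = 1 * h x + (- m) * f x" for x
  have "(w, \<lambda>x. 1 * (\<nu> * f x) + (- m) * h x) \<in> harmonic_oscillator"
    unfolding w_def[abs_def] by (rule harmonic_oscillator_lin[OF h(2) h(1)])
  also have "(\<lambda>x. 1 * (\<nu> * f x) + (- m) * h x) = (\<lambda>x. (- m) * w x)"
    by (simp add: w_def m algebra_simps)
  finally obtain S S1 where S: "\<And>x. (S has_real_derivative S1 x) (at x)"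
      "\<And>x. (S1 has_real_derivative (x\<^sup>2 - - m) * S x) (at x)" "S \<in> Lq 2 lborel" "AE x in lborel. w x = S x"
    using harmonic_classical by blast
  have "AE x in lborel. S x = 0"
    using harmonic_positive[of S S1 m] S m by simp
  then have ae: "AE x in lebesgue. h x = m * f x"
    unfolding AE_lebesgue_iff using S(4) by eventually_elim (simp add: w_def)
  have L: "f \<in> Lq 2 lebesgue" "h \<in> Lq 2 lebesgue" using h by (auto simp: harmonic_oscillator_def)
  have "(LINT x|lebesgue. h x * \<psi> x) = (LINT x|lebesgue. m * f x * \<psi> x)" if "\<psi> \<in> test_fun" for \<psi>
  proof (rule integral_cong_AE)
    have [measurable]: "\<psi> \<in> borel_measurable lebesgue"
      using that by (auto intro!: measurable_completion borel_measurable_continuous_onI smooth_continuous test_fun_smooth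
          simp: measurable_lborel2)
    have [measurable]: "f \<in> borel_measurable lebesgue" "h \<in> borel_measurable lebesgue"
      using L by (auto simp: Lq2_iff)
    show "(\<lambda>x. h x * \<psi> x) \<in> borel_measurable lebesgue" "(\<lambda>x. m * f x * \<psi> x) \<in> borel_measurable lebesgue"
      by measurable
    show "AE x in lebesgue. h x * \<psi> x = m * f x * \<psi> x" using ae by eventually_elim simp
  qed
  then show "(f, \<lambda>x. sqrt \<nu> * f x) \<in> harmonic_oscillator"
    using h(1) L unfolding m_def[symmetric] by (auto simp: harmonic_oscillator_def intro: Lq2_scale)
qed

section \<open>Stereographic lifts of spherical harmonics\<close>

text \<open>The conformal factor of stereographic projection; it equals \<open>2 sqrt V\<close> for the weight \<open>V\<close> of the
  problem.\<close>

definition conf :: "'a::euclidean_space \<Rightarrow> real" where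
  "conf x = 2 / ((norm x)\<^sup>2 + 1)"

lemma conf_pos: "0 < conf x"
  by (simp add: conf_def add_nonneg_pos)

lemma conf_le: "conf x \<le> 2"
  by (simp add: conf_def divide_le_eq add_nonneg_pos)

lemma conf_norm: "conf x * norm x \<le> 1"
proof -
  have "2 * norm x \<le> (norm x)\<^sup>2 + 1"
    using sum_squares_bound[of "norm x" 1] by simp
  then show ?thesis by (simp add: conf_def divide_le_eq add_nonneg_pos)
qed

lemma conf_norm2: "conf x * (norm x)\<^sup>2 \<le> 2"
  by (simp add: conf_def divide_le_eq add_nonneg_pos)

lemma conf_has_derivative:
  "(conf has_derivative (\<lambda>v. - (conf x * conf x) * (x \<bullet> v))) (at x)"
proof -
  have nz: "x \<bullet> x + 1 \<noteq> 0" using inner_ge_zero[of x] by linarith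
  have alt: "conf x = 2 / (x \<bullet> x + 1)" for x :: 'a
    by (simp add: conf_def power2_norm_eq_inner)
  have "((\<lambda>x. 2 / (x \<bullet> x + 1)) has_derivative (\<lambda>v. - (conf x * conf x) * (x \<bullet> v))) (at x)"
    unfolding alt
    by (rule has_derivative_eq_rhs, (rule derivative_intros nz | simp)+)
      (use nz in \<open>auto simp: fun_eq_iff inner_commute field_simps\<close>)
  then show ?thesis by (simp add: alt[abs_def])
qed

lemma smooth_conf: "smooth conf"
proof -
  have "C_k k (conf :: 'a \<Rightarrow> real)" for k
  proof (induction k)
    case 0
    have "continuous_on UNIV (conf :: 'a \<Rightarrow> real)"
      by (rule differentiable_continuous) (use conf_has_derivative differentiable_def in blast)
    then show ?case by simp
  next
    case (Suc k)
    have "pd b conf = (\<lambda>x. (- 1) * (conf x * conf x) * (x \<bullet> b))" for b :: 'a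
      using pd_eq[OF conf_has_derivative] by auto
    moreover have "C_k k (\<lambda>x. (- 1) * (conf x * conf x) * (x \<bullet> b))" for b :: 'a
      using smooth_linear[OF bounded_linear_inner_left[of b]]
      by (intro C_k_mult C_k_const Suc) (simp add: smooth_def)
    moreover have "conf differentiable (at x)" for x :: 'a
      using conf_has_derivative differentiable_def by blast
    ultimately show ?case by simp
  qed
  then show ?thesis by (simp add: smooth_def)
qed

lemma pd_conf: "pd b conf x = - (conf x * conf x) * (x \<bullet> b)"
  by (rule pd_eq[OF conf_has_derivative])

text \<open>The decay of a smooth function on the sphere that is multiplied by the \<open>m\<close>-th power of the conformal
  factor. For \<open>m > 0\<close> its gradient decays faster than the bound required here, which is chosen
  because it holds for all \<open>m\<close> and suffices for Green's formula.\<close>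

definition tame :: "nat \<Rightarrow> ('a::euclidean_space \<Rightarrow> real) \<Rightarrow> bool" where
  "tame m F \<longleftrightarrow> smooth F \<and> (\<exists>C. \<forall>x. \<bar>F x\<bar> \<le> C * conf x ^ m) \<and>
     (\<exists>C. \<forall>x. \<forall>b\<in>Basis. \<bar>pd b F x\<bar> \<le> C * conf x)"

lemma tame_add:
  assumes "tame m f" "tame m g" shows "tame m (\<lambda>x. f x + g x)"
proof -
  obtain C C' K K' where
    C: "\<And>x. \<bar>f x\<bar> \<le> C * conf x ^ m" "\<And>x. \<bar>g x\<bar> \<le> C' * conf x ^ m" and
    K: "\<And>x b. b \<in> Basis \<Longrightarrow> \<bar>pd b f x\<bar> \<le> K * conf x" "\<And>x b. b \<in> Basis \<Longrightarrow> \<bar>pd b g x\<bar> \<le> K' * conf x"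
    using assms unfolding tame_def by blast
  have s: "smooth f" "smooth g" using assms by (auto simp: tame_def)
  have "\<bar>f x + g x\<bar> \<le> (C + C') * conf x ^ m" for x
    using C[of x] by (simp add: algebra_simps)
  moreover have "\<bar>pd b (\<lambda>x. f x + g x) x\<bar> \<le> (K + K') * conf x" if "b \<in> Basis" for x b
    using K[OF that, of x] by (simp add: pd_add s smooth_differentiable algebra_simps)
  ultimately show ?thesis using s unfolding tame_def by (blast intro: smooth_add)
qed

lemma tame_scale:
  assumes "tame m f" shows "tame m (\<lambda>x. c * f x)"
proof -
  obtain C K where
    C: "\<And>x. \<bar>f x\<bar> \<le> C * conf x ^ m" and K: "\<And>x b. b \<in> Basis \<Longrightarrow> \<bar>pd b f x\<bar> \<le> K * conf x"
    using assms unfolding tame_def by blast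
  have s: "smooth f" using assms by (auto simp: tame_def)
  have "\<bar>c * f x\<bar> \<le> (\<bar>c\<bar> * C) * conf x ^ m" for x
    using mult_left_mono[OF C[of x], of "\<bar>c\<bar>"] by (simp add: abs_mult mult.assoc)
  moreover have "\<bar>pd b (\<lambda>x. c * f x) x\<bar> \<le> (\<bar>c\<bar> * K) * conf x" if "b \<in> Basis" for x b
  proof -
    have "pd b (\<lambda>x. c * f x) x = c * pd b f x"
      using pd_mult[of "\<lambda>_. c" x f b] s by (simp add: pd_const smooth_differentiable)
    then show ?thesis
      using mult_left_mono[OF K[OF that, of x], of "\<bar>c\<bar>"] by (simp add: abs_mult mult.assoc)
  qed
  moreover have "smooth (\<lambda>x. c * f x)" by (rule smooth_mult[OF smooth_const s])
  ultimately show ?thesis unfolding tame_def by blast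
qed

lemma tame_sum: "finite L \<Longrightarrow> (\<And>i. i \<in> L \<Longrightarrow> tame m (f i)) \<Longrightarrow> tame m (\<lambda>x. \<Sum>i\<in>L. c i * f i x)"
proof (induction L rule: finite_induct)
  case empty
  have "tame m (\<lambda>x. 0)"
    unfolding tame_def by (auto simp: smooth_const pd_const intro!: exI[of _ 0])
  then show ?case by simp
next
  case (insert i L)
  then show ?case by (simp add: tame_add tame_scale)
qed

lemma tame_mult_0:
  assumes "tame 0 f" "tame 0 g" shows "tame 0 (\<lambda>x. f x * g x)"
proof -
  obtain C C' K K' where
    C: "\<And>x. \<bar>f x\<bar> \<le> C" "\<And>x. \<bar>g x\<bar> \<le> C'" and
    K: "\<And>x b. b \<in> Basis \<Longrightarrow> \<bar>pd b f x\<bar> \<le> K * conf x" "\<And>x b. b \<in> Basis \<Longrightarrow> \<bar>pd b g x\<bar> \<le> K' * conf x"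
    using assms unfolding tame_def power_0 mult_1_right by blast
  have s: "smooth f" "smooth g" using assms by (auto simp: tame_def)
  have C0: "0 \<le> C" using C(1) by (meson abs_ge_zero order_trans)
  have C0': "0 \<le> C'" using C(2) by (meson abs_ge_zero order_trans)
  have "\<bar>f x * g x\<bar> \<le> (C * C') * conf x ^ 0" for x
    using mult_mono[OF C(1)[of x] C(2)[of x]] C0 by (simp add: abs_mult)
  moreover have "\<bar>pd b (\<lambda>x. f x * g x) x\<bar> \<le> (C * K' + K * C') * conf x" if b: "b \<in> Basis" for x b
  proof -
    have "\<bar>f x * pd b g x\<bar> \<le> C * (K' * conf x)"
      unfolding abs_mult using C(1) K(2)[OF b] C0 by (intro mult_mono) auto
    moreover have "\<bar>pd b f x * g x\<bar> \<le> (K * conf x) * C'"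
      unfolding abs_mult using C(2) K(1)[OF b, of x] by (intro mult_mono) auto
    moreover have "pd b (\<lambda>x. f x * g x) x = f x * pd b g x + pd b f x * g x"
      by (simp add: pd_mult s smooth_differentiable)
    ultimately show ?thesis by (simp add: algebra_simps)
  qed
  ultimately show ?thesis using s unfolding tame_def by (blast intro: smooth_mult)
qed

lemma stereo_inv_conf: "stereo_inv x = (conf x *\<^sub>R x, 1 - conf x)"
proof -
  have "(norm x)\<^sup>2 + 1 \<noteq> 0" by (smt (verit) zero_le_power2)
  then show ?thesis by (simp add: stereo_inv_def conf_def field_simps)
qed

text \<open>A linear function on the sphere becomes a combination of \<open>conf x * l x\<close>, \<open>conf x\<close> and constants. Its
  derivative is of order \<open>conf\<close>, the norm of the differential of inverse stereographic projection;
  products inherit both bounds.\<close>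

lemma tame_polynomial:
  fixes Y :: "'a::euclidean_space \<times> real \<Rightarrow> real"
  assumes "real_polynomial_function Y"
  shows "tame 0 (\<lambda>x. Y (stereo_inv x))"
  using assms
proof (induction Y rule: real_polynomial_function.induct)
  case (linear L)
  define l where "l x = L (x, 0)" for x
  define c where "c = L (0, 1)"
  interpret L: bounded_linear L by fact
  have bl: "bounded_linear l"
    unfolding l_def[abs_def]
    by (rule bounded_linear_compose[OF linear bounded_linear_Pair[OF bounded_linear_ident bounded_linear_zero]])
  then obtain K where K: "\<And>x. \<bar>l x\<bar> \<le> norm x * K" "0 \<le> K"
    using bounded_linear.nonneg_bounded by fastforce
  have eq: "L (stereo_inv x) = conf x * l x + (c + (- c) * conf x)" for x
  proof -
    have "(conf x *\<^sub>R x, 1 - conf x) = conf x *\<^sub>R (x, 0) + (1 - conf x) *\<^sub>R (0, 1)" by simp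
    then have "L (stereo_inv x) = conf x * l x + (1 - conf x) * c"
      by (simp only: stereo_inv_conf L.add L.scaleR l_def c_def real_scaleR_def)
    then show ?thesis by (simp add: algebra_simps)
  qed
  have sl: "smooth l" by (rule smooth_linear[OF bl])
  have sm: "smooth (\<lambda>x. conf x * l x + (c + (- c) * conf x))"
    by (intro smooth_add smooth_mult smooth_const smooth_conf sl)
  have cl: "\<bar>conf x * l x\<bar> \<le> K" for x
  proof -
    have "\<bar>conf x * l x\<bar> \<le> conf x * (norm x * K)"
      using K(1)[of x] conf_pos[of x] by (simp add: abs_mult)
    also have "\<dots> \<le> 1 * K"
      using mult_right_mono[OF conf_norm[of x] K(2)] by (simp add: mult.assoc)
    finally show ?thesis by simp
  qed
  have "\<bar>L (stereo_inv x)\<bar> \<le> (K + \<bar>c\<bar>) * conf x ^ 0" for x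
  proof -
    have "\<bar>c + (- c) * conf x\<bar> = \<bar>c\<bar> * \<bar>1 - conf x\<bar>"
      by (simp add: abs_mult[symmetric] algebra_simps)
    also have "\<dots> \<le> \<bar>c\<bar> * 1"
      using conf_pos[of x] conf_le[of x] by (intro mult_left_mono) auto
    finally show ?thesis unfolding eq using cl[of x] by simp
  qed
  moreover have "\<bar>pd b (\<lambda>x. L (stereo_inv x)) x\<bar> \<le> (2 * K + K + \<bar>c\<bar>) * conf x" if b: "b \<in> Basis" for x b
  proof -
    have d: "conf differentiable (at x)" "l differentiable (at x)"
      using smooth_conf sl smooth_differentiable by blast+
    have p1: "pd b (\<lambda>x. conf x * l x) x = conf x * l b + pd b conf x * l x"
      using pd_mult[OF d] pd_linear[OF bl] by simp
    have p2: "pd b (\<lambda>x. c + (- c) * conf x) x = (- c) * pd b conf x"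
    proof -
      have "((\<lambda>x. c + (- c) * conf x) has_derivative (\<lambda>v. 0 + (- c) * pd v conf x)) (at x)"
        by (intro has_derivative_add has_derivative_const has_derivative_mult_right pd_has_derivative d)
      from pd_eq[OF this, of b] show ?thesis by (simp only: add_0)
    qed
    have "pd b (\<lambda>x. L (stereo_inv x)) x = conf x * l b + pd b conf x * l x + (- c) * pd b conf x"
    proof -
      have "(\<lambda>x. conf x * l x) differentiable (at x)" "(\<lambda>x. c + (- c) * conf x) differentiable (at x)"
        by (intro smooth_differentiable smooth_add smooth_mult smooth_const smooth_conf sl)+
      from pd_add[OF this, of b] show ?thesis unfolding eq p1 p2 .
    qed
    moreover have "\<bar>conf x * l b\<bar> \<le> conf x * K"
      using K(1)[of b] b conf_pos[of x] by (simp add: abs_mult)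
    moreover have xb: "\<bar>x \<bullet> b\<bar> \<le> norm x" using Basis_le_norm[OF b] .
    moreover have "\<bar>pd b conf x * l x\<bar> \<le> conf x * (2 * K)"
    proof -
      have "\<bar>pd b conf x * l x\<bar> = conf x * conf x * (\<bar>x \<bullet> b\<bar> * \<bar>l x\<bar>)"
        using conf_pos[of x] by (simp add: pd_conf abs_mult)
      also have "\<dots> \<le> conf x * conf x * (norm x * (norm x * K))"
        using xb K conf_pos[of x] by (intro mult_left_mono mult_mono) auto
      also have "\<dots> = conf x * ((conf x * (norm x)\<^sup>2) * K)" by (simp add: power2_eq_square)
      also have "\<dots> \<le> conf x * (2 * K)"
        using conf_pos[of x] K(2) conf_norm2[of x] by (intro mult_left_mono mult_right_mono) auto
      finally show ?thesis .
    qed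
    moreover have "\<bar>(- c) * pd b conf x\<bar> \<le> \<bar>c\<bar> * conf x"
    proof -
      have "\<bar>pd b conf x\<bar> = conf x * (conf x * \<bar>x \<bullet> b\<bar>)"
        using conf_pos[of x] by (simp add: pd_conf abs_mult)
      also have "\<dots> \<le> conf x * (conf x * norm x)"
        using xb conf_pos[of x] by (intro mult_left_mono) auto
      also have "\<dots> \<le> conf x * 1"
        using conf_norm[of x] conf_pos[of x] by (intro mult_left_mono) auto
      finally show ?thesis by (simp add: abs_mult mult_left_mono)
    qed
    ultimately show ?thesis by (simp add: algebra_simps)
  qed
  ultimately show ?case
    using sm unfolding tame_def eq by blast
next
  case (const c)
  show ?case
    unfolding tame_def
  proof (intro conjI)
    show "smooth (\<lambda>x. c)" by (rule smooth_const)
    show "\<exists>C. \<forall>x. \<bar>c\<bar> \<le> C * conf x ^ 0" by (intro exI[of _ "\<bar>c\<bar>"]) simp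
    show "\<exists>C. \<forall>x. \<forall>b\<in>Basis. \<bar>pd b (\<lambda>x. c) x\<bar> \<le> C * conf x"
      by (intro exI[of _ 0]) (simp add: pd_const)
  qed
qed (simp_all add: tame_add tame_mult_0)

lemma stereo_lift_eq:
  assumes "DIM('a) = 2 * m + 2"
  shows "stereo_lift Y (x::'a::euclidean_space) = conf x ^ m * Y (stereo_inv x)"
proof -
  have "(real DIM('a) - 2) / 2 = real m" using assms by simp
  then show ?thesis
    using conf_pos[of x] by (simp add: stereo_lift_def conf_def powr_realpow)
qed

lemma tame_stereo_lift:
  assumes dim: "DIM('a) = 2 * m + 2" and Y: "real_polynomial_function Y"
  shows "tame m (stereo_lift Y :: 'a::euclidean_space \<Rightarrow> real)"
proof -
  define P where "P x = Y (stereo_inv x)" for x :: 'a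
  have "tame 0 P" unfolding P_def[abs_def] by (rule tame_polynomial[OF Y])
  then obtain C K where sP: "smooth P" and C: "\<And>x. \<bar>P x\<bar> \<le> C"
    and K: "\<And>x b. b \<in> Basis \<Longrightarrow> \<bar>pd b P x\<bar> \<le> K * conf x"
    unfolding tame_def power_0 mult_1_right by blast
  have eq: "stereo_lift Y = (\<lambda>x::'a. conf x ^ m * P x)"
    using stereo_lift_eq[OF dim] by (auto simp: P_def)
  have C0: "0 \<le> C" using C by (meson abs_ge_zero order_trans)
  have p0: "0 \<le> conf x ^ m" for x :: 'a using conf_pos[of x] by simp
  have b1: "\<bar>conf x ^ m * P x\<bar> \<le> C * conf x ^ m" for x
    using mult_left_mono[OF C[of x] p0[of x]] p0[of x] by (simp add: abs_mult mult.commute)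
  have le2: "conf x ^ k \<le> 2 ^ k" for x :: 'a and k
    using conf_pos[of x] conf_le[of x] by (intro power_mono) auto
  have b2: "\<bar>pd b (\<lambda>x. conf x ^ m * P x) x\<bar> \<le> (2 ^ m * K + real m * 2 ^ m * C) * conf x"
    if b: "b \<in> Basis" for x b
  proof -
    have dm: "((\<lambda>x. conf x ^ m) has_derivative (\<lambda>v. real m * pd v conf x * conf x ^ (m - 1))) (at x)"
      using has_derivative_power[OF pd_has_derivative[OF smooth_differentiable[OF smooth_conf]], where n=m]
      by (simp add: mult_ac)
    then have pm: "pd b (\<lambda>x. conf x ^ m) x = real m * pd b conf x * conf x ^ (m - 1)"
      by (rule pd_eq)
    have "pd b (\<lambda>x. conf x ^ m * P x) x = conf x ^ m * pd b P x + real m * pd b conf x * conf x ^ (m - 1) * P x"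
      using pd_mult[of "\<lambda>x. conf x ^ m" x P b] dm differentiable_def smooth_differentiable[OF sP] pm by metis
    moreover have "\<bar>conf x ^ m * pd b P x\<bar> \<le> 2 ^ m * (K * conf x)"
      unfolding abs_mult using le2[of x m] K[OF b, of x] p0[of x] by (intro mult_mono) auto
    moreover have "\<bar>real m * pd b conf x * conf x ^ (m - 1) * P x\<bar> \<le> real m * conf x * 2 ^ m * C"
    proof -
      have "\<bar>pd b conf x\<bar> = conf x * (conf x * \<bar>x \<bullet> b\<bar>)"
        using conf_pos[of x] by (simp add: pd_conf abs_mult)
      also have "\<dots> \<le> conf x * (conf x * norm x)"
        using Basis_le_norm[OF b, of x] conf_pos[of x] by (intro mult_left_mono) auto
      also have "\<dots> \<le> conf x * 1"
        using conf_norm[of x] conf_pos[of x] by (intro mult_left_mono) auto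
      finally have 1: "\<bar>pd b conf x\<bar> \<le> conf x" by simp
      have 2: "\<bar>conf x ^ (m - 1)\<bar> \<le> 2 ^ m"
      proof -
        have "(2::real) ^ (m - 1) \<le> 2 ^ m" by (rule power_increasing) auto
        moreover have "\<bar>conf x ^ (m - 1)\<bar> = conf x ^ (m - 1)" using conf_pos[of x] by simp
        ultimately show ?thesis using le2[of x "m - 1"] by linarith
      qed
      show ?thesis
        unfolding abs_mult using 1 2 C[of x] C0 conf_pos[of x]
        by (intro mult_mono) auto
    qed
    ultimately show ?thesis by (simp add: algebra_simps)
  qed
  have "smooth (\<lambda>x. conf x ^ m * P x)"
    by (intro smooth_mult smooth_power smooth_conf sP)
  then show ?thesis unfolding tame_def eq using b1 b2 by blast
qed

text \<open>The function is dominated by a sum of multiples of the indicators of the balls of radius \<open>2\<^sup>k\<close>, and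
  the volumes of these balls lose one power of \<open>2\<^sup>k\<close> against the coefficients.\<close>

lemma integrable_inverse_power:
  "integrable lborel (\<lambda>x::'a::euclidean_space. (1 / (1 + norm x)) ^ Suc DIM('a))"
proof -
  let ?N = "DIM('a)"
  define a :: "nat \<Rightarrow> real" where "a k = (2 / 2 ^ k) ^ Suc ?N" for k
  have a0: "0 \<le> a k" for k by (simp add: a_def)
  have pt: "ennreal ((1 / (1 + norm x)) ^ Suc ?N) \<le> (\<Sum>k. ennreal (a k) * indicator (ball 0 (2 ^ k)) x)" for x :: 'a
  proof -
    obtain k0 :: nat where "norm x < 2 ^ k0" using real_arch_pow[of 2 "norm x"] by auto
    define k where "k = (LEAST k. norm x < 2 ^ k)"
    have k: "norm x < 2 ^ k" unfolding k_def by (rule LeastI) fact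
    have "2 ^ k \<le> 2 * (1 + norm x)"
    proof (cases k)
      case 0 then show ?thesis by simp
    next
      case (Suc j)
      then have "\<not> norm x < 2 ^ j" unfolding k_def using not_less_Least lessI by metis
      then show ?thesis by (simp add: Suc)
    qed
    then have "1 / (1 + norm x) \<le> 2 / 2 ^ k"
      by (simp add: field_simps add_pos_nonneg)
    then have "(1 / (1 + norm x)) ^ Suc ?N \<le> a k"
      unfolding a_def by (intro power_mono) auto
    then have "ennreal ((1 / (1 + norm x)) ^ Suc ?N) \<le> ennreal (a k) * indicator (ball 0 (2 ^ k)) x"
      using k by (simp add: ennreal_leI)
    also have "\<dots> \<le> (\<Sum>k. ennreal (a k) * indicator (ball 0 (2 ^ k)) x)"
    proof -
      define g where "g j = ennreal (a j) * indicator (ball 0 (2 ^ j)) x" for j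
      have "sum g {k} \<le> suminf g" by (rule sum_le_suminf) auto
      moreover have "sum g {k} = g k" by simp
      ultimately show ?thesis by (simp only: g_def[abs_def])
    qed
    finally show ?thesis .
  qed
  have "(\<integral>\<^sup>+x. ennreal ((1 / (1 + norm x)) ^ Suc ?N) \<partial>(lborel :: 'a measure))
      \<le> (\<integral>\<^sup>+x. (\<Sum>k. ennreal (a k) * indicator (ball 0 (2 ^ k)) x) \<partial>(lborel :: 'a measure))"
    by (intro nn_integral_mono pt)
  also have "\<dots> = (\<Sum>k. \<integral>\<^sup>+x. ennreal (a k) * indicator (ball 0 (2 ^ k)) x \<partial>(lborel :: 'a measure))"
    by (rule nn_integral_suminf) (auto intro!: borel_measurable_times_ennreal borel_measurable_indicator)
  also have "\<dots> = (\<Sum>k. ennreal (2 ^ Suc ?N * unit_ball_vol ?N * (1 / 2) ^ k))"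
  proof (rule suminf_cong)
    fix k :: nat
    have eq: "a k * (unit_ball_vol ?N * (2 ^ k) ^ ?N) = 2 ^ Suc ?N * unit_ball_vol ?N * (1 / 2) ^ k"
      by (simp add: a_def power_divide field_simps)
    have "(\<integral>\<^sup>+x. ennreal (a k) * indicator (ball 0 (2 ^ k)) x \<partial>(lborel :: 'a measure))
        = ennreal (a k) * emeasure lborel (ball (0::'a) (2 ^ k))"
      by (rule nn_integral_cmult_indicator) simp
    also have "\<dots> = ennreal (a k) * ennreal (unit_ball_vol ?N * (2 ^ k) ^ ?N)"
      by (subst emeasure_ball) auto
    also have "\<dots> = ennreal (a k * (unit_ball_vol ?N * (2 ^ k) ^ ?N))"
      using a0[of k] by (simp only: ennreal_mult')
    also note eq
    finally show "(\<integral>\<^sup>+x. ennreal (a k) * indicator (ball 0 (2 ^ k)) x \<partial>(lborel :: 'a measure))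
        = ennreal (2 ^ Suc ?N * unit_ball_vol ?N * (1 / 2) ^ k)" .
  qed
  also have "\<dots> = ennreal (\<Sum>k. 2 ^ Suc ?N * unit_ball_vol ?N * (1 / 2) ^ k)"
    by (rule suminf_ennreal2) (auto intro!: summable_mult)
  also have "\<dots> < \<infinity>" by simp
  finally have fin: "(\<integral>\<^sup>+x. ennreal ((1 / (1 + norm x)) ^ Suc ?N) \<partial>(lborel :: 'a measure)) < \<infinity>" .
  have m: "(\<lambda>x::'a. (1 / (1 + norm x)) ^ Suc ?N) \<in> borel_measurable lborel" by measurable
  show ?thesis
    by (rule integrableI_nonneg[OF m _ fin]) simp
qed

lemma conf_power_le: "conf x ^ Suc m \<le> 4 ^ Suc m * (1 / (1 + norm x)) ^ (2 * m + 2)"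
proof -
  have "(1 + norm x)\<^sup>2 \<le> 2 * ((norm x)\<^sup>2 + 1)"
    using sum_squares_bound[of "norm x" 1] by (simp add: power2_sum)
  moreover have "0 < (1 + norm x)\<^sup>2" "0 < (norm x)\<^sup>2 + 1"
    using norm_ge_zero[of x] by (auto intro!: add_nonneg_pos simp del: norm_ge_zero)
  ultimately have "4 / (2 * ((norm x)\<^sup>2 + 1)) \<le> 4 / (1 + norm x)\<^sup>2"
    by (intro divide_left_mono) auto
  moreover have "4 / (2 * y) = 2 / y" for y :: real by simp
  ultimately have "conf x \<le> 4 / (1 + norm x)\<^sup>2"
    by (simp only: conf_def)
  then have "conf x \<le> 4 * (1 / (1 + norm x))\<^sup>2"
    by (simp add: power_divide)
  then have "conf x ^ Suc m \<le> (4 * (1 / (1 + norm x))\<^sup>2) ^ Suc m"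
    using conf_pos[of x] by (intro power_mono) auto
  also have "\<dots> = 4 ^ Suc m * (1 / (1 + norm x)) ^ (2 * m + 2)"
    by (simp only: power_mult_distrib power_mult[symmetric]) simp
  finally show ?thesis .
qed

section \<open>The Dirichlet energy of combinations of lifts\<close>

text \<open>The cut-off at scale \<open>r\<close>, normalized to tend to one.\<close>

definition cutoff :: "real \<Rightarrow> 'a::euclidean_space \<Rightarrow> real" where
  "cutoff r x = exp 1 * bump (1 + (- 1 / r\<^sup>2) * (x \<bullet> x))"

lemma flat_2_le: "0 \<le> flat 2 y" "flat 2 y \<le> 2"
proof -
  show "0 \<le> flat 2 y" by (simp add: flat_def)
  show "flat 2 y \<le> 2"
  proof (cases "y > 0")
    case True
    define t where "t = 1 / y"
    have "t > 0" using True by (simp add: t_def)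
    then have "t\<^sup>2 \<le> 2 * exp t"
      using exp_lower_Taylor_quadratic[of t] by simp
    then show ?thesis
    proof -
      have "flat 2 y = t\<^sup>2 / exp t" using True by (simp add: flat_def t_def exp_minus divide_inverse)
      also have "\<dots> \<le> 2" using \<open>t\<^sup>2 \<le> 2 * exp t\<close> by (simp add: divide_le_eq)
      finally show ?thesis .
    qed
  qed (simp add: flat_def)
qed

lemma smooth_inner_self: "smooth (\<lambda>x::'a::euclidean_space. x \<bullet> x)"
proof -
  have "smooth (\<lambda>x::'a. \<Sum>b\<in>Basis. (x \<bullet> b) * (x \<bullet> b))"
    by (intro smooth_sum smooth_mult smooth_linear bounded_linear_inner_left)
  then show ?thesis by (simp add: euclidean_inner[symmetric])
qed

lemma cutoff_props:
  fixes x :: "'a::euclidean_space"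
  assumes r: "r \<ge> 1"
  shows "(cutoff r :: 'a \<Rightarrow> real) \<in> test_fun" "0 \<le> cutoff r x" "cutoff r x \<le> exp 1"
    "b \<in> Basis \<Longrightarrow> \<bar>pd b (cutoff r) x\<bar> \<le> 12 / r"
    "b \<in> Basis \<Longrightarrow> \<bar>pd b (cutoff r) x\<bar> \<le> 24 * (1 / (1 + norm x))"
proof -
  define q where "q x = 1 + (- 1 / r\<^sup>2) * (x \<bullet> x)" for x :: 'a
  have sq: "smooth q"
    unfolding q_def[abs_def] by (intro smooth_add smooth_mult smooth_const smooth_inner_self)
  have r2: "0 < r\<^sup>2" using r by simp
  have out: "q x \<le> 0" if "norm x \<ge> r" for x
  proof -
    have "r\<^sup>2 \<le> (norm x)\<^sup>2" using that r by (intro power_mono) auto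
    then show ?thesis using r2 by (simp add: q_def power2_norm_eq_inner field_simps)
  qed
  show "(cutoff r :: 'a \<Rightarrow> real) \<in> test_fun"
  proof (rule test_funI)
    show "smooth (cutoff r :: 'a \<Rightarrow> real)"
      unfolding cutoff_def[abs_def] q_def[symmetric]
      by (rule smooth_mult[OF smooth_const smooth_comp[OF smooth_bump sq]])
    have "{x :: 'a. cutoff r x \<noteq> 0} \<subseteq> ball 0 r"
    proof
      fix x :: 'a assume "x \<in> {x. cutoff r x \<noteq> 0}"
      then have "\<not> q x \<le> 0" using bump_bounds(3) by (auto simp: cutoff_def q_def)
      then show "x \<in> ball 0 r" using out[of x] by (cases "norm x \<ge> r") auto
    qed
    then show "bounded {x :: 'a. cutoff r x \<noteq> 0}" by (rule bounded_subset[OF bounded_ball])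
  qed
  show "0 \<le> cutoff r x" "cutoff r x \<le> exp 1"
    using bump_bounds by (auto simp: cutoff_def)
  assume b: "b \<in> Basis"
  have dq: "(q has_derivative (\<lambda>v. (- 2 / r\<^sup>2) * (x \<bullet> v))) (at x)"
  proof -
    have "((\<lambda>x. 1 + (- 1 / r\<^sup>2) * (x \<bullet> x)) has_derivative (\<lambda>v. 0 + (- 1 / r\<^sup>2) * (x \<bullet> v + v \<bullet> x))) (at x)"
      by (intro has_derivative_add has_derivative_const has_derivative_mult_right
          has_derivative_inner has_derivative_ident)
    moreover have "(\<lambda>v. 0 + (- 1 / r\<^sup>2) * (x \<bullet> v + v \<bullet> x)) = (\<lambda>v. (- 2 / r\<^sup>2) * (x \<bullet> v))"
      by (auto simp: inner_commute)
    ultimately show ?thesis by (simp only: q_def[abs_def])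
  qed
  have "bump differentiable (at (q x))" by (rule smooth_differentiable[OF smooth_bump])
  then have "pd b (\<lambda>x. bump (q x)) x = pd 1 bump (q x) * pd b q x"
    using smooth_differentiable[OF sq] by (intro pd_comp) auto
  also have "pd 1 bump (q x) = flat 2 (q x)"
    unfolding bump_def using pd_real[OF flat_deriv[of 0 "q x"]] by (simp add: numeral_2_eq_2)
  finally have "pd b (\<lambda>x. bump (q x)) x = flat 2 (q x) * ((- 2 / r\<^sup>2) * (x \<bullet> b))"
    using pd_eq[OF dq] by simp
  moreover have "pd b (cutoff r) x = exp 1 * pd b (\<lambda>x. bump (q x)) x"
    unfolding cutoff_def[abs_def] q_def[symmetric]
    using pd_mult[of "\<lambda>_. exp 1" x "\<lambda>x. bump (q x)" b] smooth_differentiable[OF smooth_comp[OF smooth_bump sq]]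
    by (simp add: pd_const)
  ultimately have P: "pd b (cutoff r) x = exp 1 * (flat 2 (q x) * ((- 2 / r\<^sup>2) * (x \<bullet> b)))"
    by simp
  have main: "\<bar>pd b (cutoff r) x\<bar> \<le> 12 / r \<and> (norm x \<ge> r \<longrightarrow> pd b (cutoff r) x = 0)"
  proof (cases "norm x \<ge> r")
    case True
    then have "pd b (cutoff r) x = 0" using out[of x] by (simp add: P flat_def)
    then show ?thesis using r by simp
  next
    case False
    have "\<bar>(- 2 / r\<^sup>2) * (x \<bullet> b)\<bar> \<le> 2 / r\<^sup>2 * r"
      using Basis_le_norm[OF b, of x] False r2 by (simp add: abs_mult divide_right_mono)
    also have "\<dots> = 2 / r" using r by (simp add: power2_eq_square)
    finally have 1: "\<bar>(- 2 / r\<^sup>2) * (x \<bullet> b)\<bar> \<le> 2 / r" .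
    have "\<bar>pd b (cutoff r) x\<bar> = exp 1 * (flat 2 (q x) * \<bar>(- 2 / r\<^sup>2) * (x \<bullet> b)\<bar>)"
      unfolding P abs_mult using flat_2_le(1)[of "q x"] by simp
    also have "\<dots> \<le> 3 * (2 * (2 / r))"
      using exp_le flat_2_le 1 r by (intro mult_mono) auto
    finally show ?thesis using False by simp
  qed
  then show "\<bar>pd b (cutoff r) x\<bar> \<le> 12 / r" by simp
  show "\<bar>pd b (cutoff r) x\<bar> \<le> 24 * (1 / (1 + norm x))"
  proof (cases "norm x \<ge> r")
    case True
    then show ?thesis using main by (simp add: add_nonneg_nonneg)
  next
    case False
    then have "1 + norm x \<le> 2 * r" using r by simp
    then have "12 / r \<le> 24 * (1 / (1 + norm x))"
      using r by (simp add: field_simps add_pos_nonneg)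
    then show ?thesis using main by linarith
  qed
qed

lemma cutoff_tendsto: "(\<lambda>n. cutoff (real (Suc n)) x) \<longlonglongrightarrow> 1"
proof -
  have c: "isCont bump 1"
    using smooth_continuous[OF smooth_bump, of UNIV] by (simp add: continuous_on_eq_continuous_at)
  have "(\<lambda>n. 1 / real (Suc n)) \<longlonglongrightarrow> 0" by (rule LIMSEQ_Suc[OF lim_const_over_n])
  then have "(\<lambda>n. 1 + (- ((1 / real (Suc n))\<^sup>2)) * (x \<bullet> x)) \<longlonglongrightarrow> 1 + (- (0\<^sup>2)) * (x \<bullet> x)"
    by (intro tendsto_intros)
  then have "(\<lambda>n. 1 + (- 1 / (real (Suc n))\<^sup>2) * (x \<bullet> x)) \<longlonglongrightarrow> 1"
    by (simp add: power_divide)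
  from isCont_tendsto_compose[OF c this]
  have "(\<lambda>n. exp 1 * bump (1 + (- 1 / (real (Suc n))\<^sup>2) * (x \<bullet> x))) \<longlonglongrightarrow> exp 1 * bump 1"
    by (intro tendsto_mult tendsto_const)
  moreover have "exp 1 * bump 1 = 1"
    by (simp add: bump_def flat_def exp_minus)
  ultimately show ?thesis by (simp add: cutoff_def)
qed

text \<open>Green's formula for combinations of eigenfunctions. The equation is tested with \<open>\<eta> F\<close>, where \<open>\<eta>\<close> is a
  smooth cut-off. The error terms \<open>F (\<partial>\<^sub>b F) (\<partial>\<^sub>b \<eta>)\<close> tend to zero and are dominated by a multiple of
  $(1 + |x|)^{-N-1}$: the first two factors are of order $(1+|x|)^{-N}$ by the decay of the lifts,
  and the gradient of \<open>\<eta>\<close> is of order $(1+|x|)^{-1}$.\<close>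

lemma dirichlet_energy:
  fixes F G V :: "'a::euclidean_space \<Rightarrow> real"
  assumes dim: "DIM('a) = 2 * m + 2" and F: "tame m F" and G: "continuous_on UNIV G"
    and V: "continuous_on UNIV V" "\<And>x. 0 < V x"
    and FL: "(\<lambda>x. sqrt (V x) * F x) \<in> Lq 2 lborel" and GL: "(\<lambda>x. sqrt (V x) * G x) \<in> Lq 2 lborel"
    and weak: "\<And>\<psi>. \<psi> \<in> test_fun \<Longrightarrow>
      (LINT x|lborel. F x * (- laplacian \<psi> x + V x * \<psi> x)) = (LINT x|lborel. V x * G x * \<psi> x)"
    and b: "b \<in> Basis"
  shows "pd b F \<in> Lq 2 lborel"
    "sqnorm lborel (pd b F) \<le> L2_inner lborel (\<lambda>x. sqrt (V x) * G x) (\<lambda>x. sqrt (V x) * F x)"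
proof -
  have sF: "smooth F" using F by (simp add: tame_def)
  have cF: "continuous_on UNIV F" by (rule smooth_continuous[OF sF])
  have cpF: "continuous_on UNIV (pd b F)" if "b \<in> Basis" for b
    by (rule smooth_continuous[OF smooth_pd[OF sF that]])
  have V0: "sqrt (V x) * sqrt (V x) = V x" for x using V(2)[of x] by simp
  have VV: "sqrt (V x) * y * (sqrt (V x) * z) = V x * y * z" for x y z
    using V0[of x] by (metis mult.assoc mult.left_commute)
  have VGF: "integrable lborel (\<lambda>x. V x * G x * F x)" "integrable lborel (\<lambda>x. V x * F x * F x)"
    using Lq2_mult_integrable[OF GL FL] Lq2_mult_integrable[OF FL FL] unfolding VV by auto
  define H where "H x = V x * (G x - F x) * F x" for x
  have Hi: "integrable lborel H"
    using Bochner_Integration.integrable_diff[OF VGF] unfolding H_def[abs_def]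
    by (simp add: algebra_simps)
  have cH: "continuous_on UNIV H" unfolding H_def[abs_def] by (intro continuous_intros V G cF)
  define \<eta> where "\<eta> n = (cutoff (real (Suc n)) :: 'a \<Rightarrow> real)" for n
  have r1: "real (Suc n) \<ge> 1" for n by simp
  have \<eta>t: "\<eta> n \<in> test_fun" for n unfolding \<eta>_def by (rule cutoff_props(1)[OF r1])
  have \<eta>b: "0 \<le> \<eta> n x" "\<eta> n x \<le> exp 1" for n x
    unfolding \<eta>_def using cutoff_props(2,3)[OF r1] by auto
  have \<eta>lim: "(\<lambda>n. \<eta> n x) \<longlonglongrightarrow> 1" for x unfolding \<eta>_def by (rule cutoff_tendsto)
  have c\<eta>: "continuous_on UNIV (\<eta> n)" for n by (rule smooth_continuous[OF test_fun_smooth[OF \<eta>t]])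
  have cp\<eta>: "continuous_on UNIV (pd b (\<eta> n))" if "b \<in> Basis" for b n
    by (rule smooth_continuous[OF test_fun_smooth[OF test_fun_pd[OF \<eta>t that]]])
  define R where "R n x = (\<Sum>b\<in>Basis. F x * pd b F x * pd b (\<eta> n) x)" for n x
  define Q where "Q x = (\<Sum>b\<in>Basis. (pd b F x)\<^sup>2)" for x
  have cont_int: "integrable lborel (\<lambda>x. g x * h x)"
    if "continuous_on UNIV g" "continuous_on UNIV h" "bounded {x. h x \<noteq> 0}" for g h :: "'a \<Rightarrow> real"
    by (intro integrable_continuous_bounded_support continuous_intros that bounded_subset[OF that(3)]) auto
  have Ri: "integrable lborel (R n)" for n
    unfolding R_def[abs_def]
    by (intro Bochner_Integration.integrable_sum cont_int continuous_intros cF cpF cp\<eta>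
        bounded_pd_support[OF test_fun_bounded[OF \<eta>t]])
  have Qc: "continuous_on UNIV Q" unfolding Q_def[abs_def] by (intro continuous_intros cpF)
  have QI: "integrable lborel (\<lambda>x. \<eta> n x * Q x)" for n
    using cont_int[OF Qc c\<eta> test_fun_bounded[OF \<eta>t]] by (simp add: mult.commute)
  have HI: "integrable lborel (\<lambda>x. \<eta> n x * H x)" for n
    using cont_int[OF cH c\<eta> test_fun_bounded[OF \<eta>t]] by (simp add: mult.commute)
  have identity: "(LINT x|lborel. \<eta> n x * Q x) = (LINT x|lborel. \<eta> n x * H x) - (LINT x|lborel. R n x)" for n
  proof -
    define \<psi> where "\<psi> x = F x * \<eta> n x" for x
    have \<psi>: "\<psi> \<in> test_fun" unfolding \<psi>_def[abs_def] by (rule smooth_mult_test[OF sF \<eta>t])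
    note \<psi>b = test_fun_pd[OF \<psi>]
    have p\<psi>: "pd b \<psi> x = F x * pd b (\<eta> n) x + pd b F x * \<eta> n x" for b x
      unfolding \<psi>_def[abs_def]
      by (rule pd_mult[OF smooth_differentiable[OF sF] smooth_differentiable[OF test_fun_smooth[OF \<eta>t]]])
    have part: "integrable lborel (\<lambda>x. F x * pd b (pd b \<psi>) x)"
        "(LINT x|lborel. F x * pd b (pd b \<psi>) x) = - (LINT x|lborel. pd b F x * pd b \<psi> x)"
        "integrable lborel (\<lambda>x. pd b F x * pd b \<psi> x)" if b: "b \<in> Basis" for b
      using integration_by_parts_pd[of F b "pd b \<psi>", OF smooth_differentiable[OF sF] cpF[OF b]
          smooth_differentiable[OF test_fun_smooth[OF \<psi>b[OF b]]]
          smooth_continuous[OF test_fun_smooth[OF test_fun_pd[OF \<psi>b[OF b] b]]] test_fun_bounded[OF \<psi>b[OF b]]]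
      by auto
    have c\<psi>: "continuous_on UNIV \<psi>" by (rule smooth_continuous[OF test_fun_smooth[OF \<psi>]])
    have i1: "integrable lborel (\<lambda>x. V x * F x * \<psi> x)" "integrable lborel (\<lambda>x. V x * G x * \<psi> x)"
      by (intro cont_int continuous_intros V cF G c\<psi> test_fun_bounded[OF \<psi>])+
    have "(LINT x|lborel. F x * (- laplacian \<psi> x + V x * \<psi> x))
        = (LINT x|lborel. V x * F x * \<psi> x - (\<Sum>b\<in>Basis. F x * pd b (pd b \<psi>) x))"
      by (simp add: laplacian_def algebra_simps sum_distrib_left)
    also have "\<dots> = (LINT x|lborel. V x * F x * \<psi> x) + (\<Sum>b\<in>Basis. LINT x|lborel. pd b F x * pd b \<psi> x)"
      using i1 part by (simp add: sum_negf)
    also have "(\<Sum>b\<in>Basis. LINT x|lborel. pd b F x * pd b \<psi> x)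
        = (LINT x|lborel. (\<Sum>b\<in>Basis. pd b F x * pd b \<psi> x))"
      using part by simp
    also have "(\<lambda>x. \<Sum>b\<in>Basis. pd b F x * pd b \<psi> x) = (\<lambda>x. \<eta> n x * Q x + R n x)"
      by (auto simp: p\<psi> Q_def R_def sum_distrib_left sum.distrib[symmetric] power2_eq_square algebra_simps
          intro!: sum.cong)
    finally have "(LINT x|lborel. V x * F x * \<psi> x) + (LINT x|lborel. \<eta> n x * Q x + R n x)
        = (LINT x|lborel. V x * G x * \<psi> x)"
      using weak[OF \<psi>] by simp
    moreover have "(LINT x|lborel. \<eta> n x * H x)
        = (LINT x|lborel. V x * G x * \<psi> x - V x * F x * \<psi> x)"
      by (simp add: H_def \<psi>_def algebra_simps)
    ultimately show ?thesis using i1 QI Ri by simp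
  qed
  have Hlim: "(\<lambda>n. LINT x|lborel. \<eta> n x * H x) \<longlonglongrightarrow> (LINT x|lborel. H x)"
  proof (rule integral_dominated_convergence[where w="\<lambda>x. exp 1 * \<bar>H x\<bar>"])
    show "integrable lborel (\<lambda>x. exp 1 * \<bar>H x\<bar>)" using Hi by simp
    show "AE x in lborel. (\<lambda>n. \<eta> n x * H x) \<longlonglongrightarrow> H x"
      using tendsto_mult_right[OF \<eta>lim] by (intro AE_I2) fastforce
    show "AE x in lborel. norm (\<eta> n x * H x) \<le> exp 1 * \<bar>H x\<bar>" for n
      using \<eta>b by (intro AE_I2) (auto simp: abs_mult intro!: mult_right_mono)
  qed (use Hi HI in auto)
  obtain C K where C: "\<And>x. \<bar>F x\<bar> \<le> C * conf x ^ m"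
    and K: "\<And>x b. b \<in> Basis \<Longrightarrow> \<bar>pd b F x\<bar> \<le> K * conf x"
    using F unfolding tame_def by blast
  have CK0: "0 \<le> C" "0 \<le> K"
  proof -
    have "0 \<le> C * conf (0::'a) ^ m" using C[of 0] by (meson abs_ge_zero order_trans)
    then show "0 \<le> C" using zero_less_power[OF conf_pos[of "0::'a"], of m]
      by (simp add: zero_le_mult_iff not_le[symmetric])
    have "0 \<le> K * conf (0::'a)" using K[OF b, of 0] by (meson abs_ge_zero order_trans)
    then show "0 \<le> K" using conf_pos[of "0::'a"] by (simp add: zero_le_mult_iff)
  qed
  have FF: "\<bar>F x * pd b F x\<bar> \<le> C * K * conf x ^ Suc m" if "b \<in> Basis" for b x
  proof -
    have "\<bar>F x\<bar> * \<bar>pd b F x\<bar> \<le> (C * conf x ^ m) * (K * conf x)"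
      using C[of x] K[OF that, of x] CK0 conf_pos[of x] by (intro mult_mono) auto
    then show ?thesis by (simp add: abs_mult mult_ac)
  qed
  define E where "E = C * K * 4 ^ Suc m * 24 * real DIM('a)"
  have Rbound: "\<bar>R n x\<bar> \<le> E * (1 / (1 + norm x)) ^ Suc DIM('a)" for n x
  proof -
    have "\<bar>R n x\<bar> \<le> (\<Sum>b\<in>(Basis::'a set). \<bar>F x * pd b F x * pd b (\<eta> n) x\<bar>)"
      unfolding R_def by (rule sum_abs)
    also have "\<dots> \<le> (\<Sum>b\<in>(Basis::'a set). C * K * 4 ^ Suc m * 24 * (1 / (1 + norm x)) ^ Suc DIM('a))"
    proof (rule sum_mono)
      fix b :: 'a assume b: "b \<in> Basis"
      have "\<bar>F x * pd b F x\<bar> \<le> C * K * (4 ^ Suc m * (1 / (1 + norm x)) ^ (2 * m + 2))"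
        using FF[OF b, of x] mult_left_mono[OF conf_power_le[of x m], of "C * K"] CK0 by simp
      then have "\<bar>F x * pd b F x\<bar> * \<bar>pd b (\<eta> n) x\<bar>
          \<le> (C * K * (4 ^ Suc m * (1 / (1 + norm x)) ^ (2 * m + 2))) * (24 * (1 / (1 + norm x)))"
        using cutoff_props(5)[OF r1 b, of n x] CK0
        by (intro mult_mono) (auto simp: \<eta>_def)
      also have "\<dots> = C * K * 4 ^ Suc m * 24 * (1 / (1 + norm x)) ^ Suc DIM('a)"
        by (simp add: dim mult_ac)
      finally show "\<bar>F x * pd b F x * pd b (\<eta> n) x\<bar> \<le> C * K * 4 ^ Suc m * 24 * (1 / (1 + norm x)) ^ Suc DIM('a)"
        by (simp only: abs_mult)
    qed
    also have "\<dots> = E * (1 / (1 + norm x)) ^ Suc DIM('a)" by (simp add: E_def)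
    finally show ?thesis .
  qed
  have Rlim: "(\<lambda>n. LINT x|lborel. R n x) \<longlonglongrightarrow> (LINT x|(lborel :: 'a measure). 0)"
  proof (rule integral_dominated_convergence[where w="\<lambda>x. E * (1 / (1 + norm x)) ^ Suc DIM('a)"])
    show "integrable lborel (\<lambda>x::'a. E * (1 / (1 + norm x)) ^ Suc DIM('a))"
      by (rule integrable_mult_right[OF integrable_inverse_power])
    show "AE x in lborel. norm (R n x) \<le> E * (1 / (1 + norm x)) ^ Suc DIM('a)" for n
      using Rbound by simp
    show "AE x in lborel. (\<lambda>n. R n x) \<longlonglongrightarrow> 0"
    proof (intro AE_I2)
      fix x
      have "(\<lambda>n. pd b (\<eta> n) x) \<longlonglongrightarrow> 0" if b: "b \<in> Basis" for b
      proof (rule tendsto_rabs_zero_cancel, rule tendsto_sandwich[of "\<lambda>_. 0"])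
        show "\<forall>\<^sub>F n in sequentially. \<bar>pd b (\<eta> n) x\<bar> \<le> 12 / real (Suc n)"
          using cutoff_props(4)[OF r1 b, of _ x] by (simp add: \<eta>_def)
        show "(\<lambda>n. 12 / real (Suc n)) \<longlonglongrightarrow> 0"
          by (rule LIMSEQ_Suc[OF lim_const_over_n])
      qed auto
      then have "(\<lambda>n. R n x) \<longlonglongrightarrow> (\<Sum>b\<in>(Basis::'a set). F x * pd b F x * 0)"
        unfolding R_def by (intro tendsto_sum tendsto_mult tendsto_const) auto
      then show "(\<lambda>n. R n x) \<longlonglongrightarrow> 0" by simp
    qed
  qed (use Ri in auto)
  define h where "h = (LINT x|lborel. H x)"
  have Klim: "(\<lambda>n. LINT x|lborel. \<eta> n x * Q x) \<longlonglongrightarrow> h"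
    using tendsto_diff[OF Hlim Rlim] unfolding identity h_def by simp
  have Q0: "0 \<le> Q x" for x by (simp add: Q_def sum_nonneg)
  have Qint: "integrable lborel Q" "(LINT x|lborel. Q x) \<le> h"
  proof -
    have p0: "0 \<le> \<eta> n x * Q x" for n x using \<eta>b Q0 by simp
    have ev: "\<forall>\<^sub>F n in sequentially. (LINT x|lborel. \<eta> n x * Q x) \<le> (LINT x|lborel. \<eta> n x * Q x)" by simp
    have l: "AE x in lborel. (\<lambda>n. \<eta> n x * Q x) \<longlonglongrightarrow> Q x"
      using tendsto_mult_right[OF \<eta>lim] by (intro AE_I2) fastforce
    have Qm: "Q \<in> borel_measurable lborel" using borel_measurable_continuous_onI[OF Qc] by simp
    show "integrable lborel Q" "(LINT x|lborel. Q x) \<le> h"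
      using integral_Fatou[OF QI p0 ev Klim l Qm] by auto
  qed
  have le: "(pd b F x)\<^sup>2 \<le> Q x" for x
    unfolding Q_def using b by (intro member_le_sum) auto
  have bm [measurable]: "pd b F \<in> borel_measurable lborel"
    using borel_measurable_continuous_onI[OF cpF[OF b]] by simp
  have bi: "integrable lborel (\<lambda>x. (pd b F x)\<^sup>2)"
    by (rule Bochner_Integration.integrable_bound[OF Qint(1)]) (use le Q0 in auto)
  then show "pd b F \<in> Lq 2 lborel" using bm by (simp add: Lq2_iff)
  have "sqnorm lborel (pd b F) \<le> h"
    using integral_mono[OF bi Qint(1) le] Qint(2) by (simp add: sqnorm_eq)
  also have "h = (LINT x|lborel. V x * G x * F x) - (LINT x|lborel. V x * F x * F x)"
  proof -
    have "H = (\<lambda>x. V x * G x * F x - V x * F x * F x)" by (auto simp: H_def algebra_simps)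
    then show ?thesis using VGF by (simp add: h_def)
  qed
  also have "\<dots> \<le> (LINT x|lborel. V x * G x * F x)"
  proof -
    have "0 \<le> (LINT x|lborel. V x * F x * F x)"
      using V(2) by (intro Bochner_Integration.integral_nonneg) (simp add: mult.assoc less_imp_le)
    then show ?thesis by simp
  qed
  also have "\<dots> = L2_inner lborel (\<lambda>x. sqrt (V x) * G x) (\<lambda>x. sqrt (V x) * F x)"
    unfolding L2_inner_def VV ..
  finally show "sqnorm lborel (pd b F) \<le> L2_inner lborel (\<lambda>x. sqrt (V x) * G x) (\<lambda>x. sqrt (V x) * F x)" .
qed

section \<open>Weak derivatives\<close>

lemma locally_integrable_L2:
  fixes w :: "'a::euclidean_space \<Rightarrow> real"
  assumes "w \<in> Lq 2 lborel" shows "locally_integrable w"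
  unfolding locally_integrable_def set_integrable_def
proof (intro allI impI)
  fix K :: "'a set" assume K: "compact K"
  then have Kb: "K \<in> sets borel" by (simp add: borel_compact)
  have "integrable lborel (indicator K :: 'a \<Rightarrow> real)"
    using K Kb emeasure_compact_finite by (intro integrable_real_indicator) auto
  moreover have "(\<lambda>x. (indicator K x :: real)\<^sup>2) = indicator K"
    by (auto simp: indicator_def)
  ultimately have "(indicator K :: 'a \<Rightarrow> real) \<in> Lq 2 lborel"
    using Kb by (simp add: Lq2_iff)
  from Lq2_mult_integrable[OF this assms]
  have i: "integrable lborel (\<lambda>x. indicator K x * w x)" .
  then have "(\<lambda>x. indicator K x * w x) \<in> borel_measurable lborel"
    by (rule borel_measurable_integrable)
  then show "integrable lebesgue (\<lambda>x. indicator K x *\<^sub>R w x)"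
    using i by (simp add: integrable_completion)
qed

lemma has_weak_derivI:
  assumes "v \<in> Basis" "u' \<in> borel_measurable borel" "AE z in lborel. u z = u' z"
    "locally_integrable u" "w \<in> Lq 2 lborel"
    and weak: "\<And>\<psi>. \<psi> \<in> test_fun \<Longrightarrow>
      (LINT z|lborel. u' z * pd v \<psi> z) = - (LINT z|lborel. w z * \<psi> z)"
  shows "has_weak_deriv v u w"
  unfolding has_weak_deriv_def
proof (intro conjI ballI)
  show "locally_integrable w" by (rule locally_integrable_L2) fact
  fix \<psi> :: "'a \<Rightarrow> real" assume \<psi>: "\<psi> \<in> test_fun"
  have [measurable]: "\<psi> \<in> borel_measurable borel" "pd v \<psi> \<in> borel_measurable borel"
    using \<psi> test_fun_pd[OF \<psi> assms(1)]
    by (auto intro!: borel_measurable_continuous_onI smooth_continuous test_fun_smooth)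
  have [measurable]: "w \<in> borel_measurable borel" using assms(5) by (simp add: Lq2_iff)
  note assms(2)[measurable]
  have "(LINT z|lebesgue. u z * pd v \<psi> z) = (LINT z|lborel. u' z * pd v \<psi> z)"
  proof (rule lebesgue_integral_cong_lborel)
    show "AE z in lborel. u z * pd v \<psi> z = u' z * pd v \<psi> z"
      using assms(3) by eventually_elim simp
  qed measurable
  moreover have "(LINT z|lebesgue. w z * \<psi> z) = (LINT z|lborel. w z * \<psi> z)"
    by (rule lebesgue_integral_cong_lborel) auto
  ultimately show "(LINT z|lebesgue. u z * pd v \<psi> z) = - (LINT z|lebesgue. w z * \<psi> z)"
    using weak[OF \<psi>] by simp
qed fact

section \<open>The oscillator: regularity of solutions\<close>

text \<open>Finite combinations of eigenfunctions satisfy \<open>- F'' + x\<^sup>2 F = G\<close> with the combination \<open>G\<close> whose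
  coefficients are multiplied by \<open>\<mu>\<close>, so orthonormality evaluates the right-hand side of the a priori
  estimate.\<close>

lemma harmonic_controlled:
  fixes S S1 :: "'i \<Rightarrow> real \<Rightarrow> real"
  assumes on: "orthonormal lborel I S"
    and S: "\<And>i x. i \<in> I \<Longrightarrow> (S i has_real_derivative S1 i x) (at x)"
      "\<And>i x. i \<in> I \<Longrightarrow> (S1 i has_real_derivative (x\<^sup>2 - \<mu> i) * S i x) (at x)"
  shows "controlled I \<mu> 142 S1" "controlled I \<mu> 142 (\<lambda>i x. x * S1 i x)"
    "controlled I \<mu> 142 (\<lambda>i x. x\<^sup>2 * S i x)" "controlled I \<mu> 142 (\<lambda>i x. (x\<^sup>2 - \<mu> i) * S i x)"
proof -
  have SL: "S i \<in> Lq 2 lborel" if "i \<in> I" for i using on that by (simp add: orthonormal_def)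
  have Sc: "continuous_on UNIV (S i)" if "i \<in> I" for i
    by (rule has_real_derivative_continuous[OF S(1)[OF that]])
  define K where "K L b = 142 * (\<Sum>i\<in>L. (1 + (\<mu> i)\<^sup>2) * (b i)\<^sup>2)" for L b
  have main: "((\<lambda>x. \<Sum>i\<in>L. b i * S1 i x) \<in> Lq 2 lborel \<and> sqnorm lborel (\<lambda>x. \<Sum>i\<in>L. b i * S1 i x) \<le> K L b)
    \<and> ((\<lambda>x. x * (\<Sum>i\<in>L. b i * S1 i x)) \<in> Lq 2 lborel \<and> sqnorm lborel (\<lambda>x. x * (\<Sum>i\<in>L. b i * S1 i x)) \<le> K L b)
    \<and> ((\<lambda>x. x\<^sup>2 * (\<Sum>i\<in>L. b i * S i x)) \<in> Lq 2 lborel \<and> sqnorm lborel (\<lambda>x. x\<^sup>2 * (\<Sum>i\<in>L. b i * S i x)) \<le> K L b)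
    \<and> ((\<lambda>x. \<Sum>i\<in>L. b i * ((x\<^sup>2 - \<mu> i) * S i x)) \<in> Lq 2 lborel
        \<and> sqnorm lborel (\<lambda>x. \<Sum>i\<in>L. b i * ((x\<^sup>2 - \<mu> i) * S i x)) \<le> K L b)"
    if L: "finite L" "L \<subseteq> I" for L b
  proof -
    define F where "F x = (\<Sum>i\<in>L. b i * S i x)" for x
    define F1 where "F1 x = (\<Sum>i\<in>L. b i * S1 i x)" for x
    define F2 where "F2 x = (\<Sum>i\<in>L. b i * ((x\<^sup>2 - \<mu> i) * S i x))" for x
    have d1: "(F has_real_derivative F1 x) (at x)" for x
      unfolding F_def[abs_def] F1_def using S(1) L by (intro DERIV_sum DERIV_cmult) auto
    have d2: "(F1 has_real_derivative F2 x) (at x)" for x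
      unfolding F1_def[abs_def] F2_def using S(2) L by (intro DERIV_sum DERIV_cmult) auto
    have c2: "continuous_on UNIV F2"
      unfolding F2_def[abs_def] using Sc L by (intro continuous_intros) auto
    have FL: "F \<in> Lq 2 lborel" unfolding F_def[abs_def] using SL L by (intro Lq2_sum Lq2_scale) auto
    have Geq: "(\<lambda>x. x\<^sup>2 * F x - F2 x) = (\<lambda>x. \<Sum>i\<in>L. (b i * \<mu> i) * S i x)"
      by (auto simp: F_def F2_def sum_distrib_left sum_subtractf[symmetric] algebra_simps intro!: sum.cong)
    have GL: "(\<lambda>x. x\<^sup>2 * F x - F2 x) \<in> Lq 2 lborel"
      unfolding Geq using SL L by (intro Lq2_sum Lq2_scale) auto
    have "sqnorm lborel (\<lambda>x. x\<^sup>2 * F x - F2 x) + sqnorm lborel F = (\<Sum>i\<in>L. (1 + (\<mu> i)\<^sup>2) * (b i)\<^sup>2)"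
      unfolding Geq unfolding F_def[abs_def] orthonormal_comb_sqnorm[OF on L]
      by (simp add: sum.distrib[symmetric] power2_eq_square algebra_simps)
    then have C: "142 * (sqnorm lborel (\<lambda>x. x\<^sup>2 * F x - F2 x) + sqnorm lborel F) = K L b"
      by (simp add: K_def)
    show ?thesis
      using harmonic_estimate[OF d1 d2 c2 FL GL] unfolding C
      unfolding F_def[abs_def] F1_def[abs_def] F2_def[abs_def] by blast
  qed
  have sumd: "x * (\<Sum>i\<in>L. b i * S1 i x) = (\<Sum>i\<in>L. b i * (x * S1 i x))"
    "x\<^sup>2 * (\<Sum>i\<in>L. b i * S i x) = (\<Sum>i\<in>L. b i * (x\<^sup>2 * S i x))" for L b x
    by (simp_all add: sum_distrib_left mult_ac)
  note main = main[unfolded sumd]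
  have one: "(\<Sum>i\<in>{i}. 1 * T i) = (T i :: real)" for i :: 'i and T by simp
  show "controlled I \<mu> 142 S1" "controlled I \<mu> 142 (\<lambda>i x. x * S1 i x)"
    "controlled I \<mu> 142 (\<lambda>i x. x\<^sup>2 * S i x)" "controlled I \<mu> 142 (\<lambda>i x. (x\<^sup>2 - \<mu> i) * S i x)"
    unfolding controlled_def K_def[symmetric]
    using main main[of "{i}" "\<lambda>_. 1" for i, unfolded one] by auto
qed

text \<open>The bound for \<open>x u\<close> follows from those for \<open>u\<close> and \<open>x\<^sup>2 u\<close>; all other quantities are limits of
  controlled systems.\<close>

theorem oscillator_regularity:
  fixes u :: "real \<times> real \<Rightarrow> real"
  assumes SA: "standing_assumptions M (\<lambda>x. 1) Vt d dt A \<nu> D \<phi> \<alpha>"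
    and B: "is_sqrt_op (weighted (\<lambda>x. 1)) A B"
    and u: "admissible_solution \<alpha> p (\<lambda>x. 1) Vt d dt B u"
    and A: "A = harmonic_oscillator O harmonic_oscillator"
  shows "\<exists>ut. has_weak_deriv (0, 1) u ut \<and> ut \<in> Lq 2 lebesgue"
    "(\<lambda>(x, t). x * u (x, t)) \<in> Lq 2 lebesgue"
    "(\<lambda>(x, t). x\<^sup>2 * u (x, t)) \<in> Lq 2 lebesgue"
    "\<exists>ux uxx. has_weak_deriv (1, 0) u ux \<and> has_weak_deriv (1, 0) ux uxx \<and>
       ux \<in> Lq 2 lebesgue \<and> (\<lambda>(x, t). x * ux (x, t)) \<in> Lq 2 lebesgue \<and> uxx \<in> Lq 2 lebesgue"
proof -
  have "weighted (\<lambda>(x::real, t::real). 1) = lebesgue"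
    by (simp add: weighted_def case_prod_beta' density_1)
  then show "\<exists>ut. has_weak_deriv (0, 1) u ut \<and> ut \<in> Lq 2 lebesgue"
    using admissible_solution_time_derivative(1)[OF u] by (simp add: mV_def)
  note uloc = admissible_solution_time_derivative(2)[OF u]
  have A1: "A1 M (\<lambda>x. 1) A \<nu> D \<phi>" using SA by (simp add: standing_assumptions_def)
  define I where "I = eigen_index D"
  define \<mu> where "\<mu> = (\<lambda>(n, l :: nat). sqrt (\<nu> n))"
  have "\<forall>i\<in>I. \<exists>S S1. (\<forall>x. (S has_real_derivative S1 x) (at x)) \<and>
      (\<forall>x. (S1 has_real_derivative (x\<^sup>2 - \<mu> i) * S x) (at x)) \<and>
      (AE x in lborel. \<phi> (fst i) (snd i) x = S x)"
  proof
    fix i assume "i \<in> I"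
    then obtain n l where i: "i = (n, l)" "l < D n" by (auto simp: I_def eigen_index_def)
    have "(\<phi> n l, \<lambda>x. \<nu> n * \<phi> n l x) \<in> harmonic_oscillator O harmonic_oscillator"
      using A1 i A by (auto simp: A1_def eigenspace_def)
    from harmonic_square_eigenfunction[OF this eigenvalue_nonneg[OF A1]]
    show "\<exists>S S1. (\<forall>x. (S has_real_derivative S1 x) (at x)) \<and>
      (\<forall>x. (S1 has_real_derivative (x\<^sup>2 - \<mu> i) * S x) (at x)) \<and>
      (AE x in lborel. \<phi> (fst i) (snd i) x = S x)"
      using i by (auto simp: \<mu>_def)
  qed
  from bchoice[OF this] obtain S where "\<forall>i\<in>I. \<exists>S1. (\<forall>x. (S i has_real_derivative S1 x) (at x)) \<and>
      (\<forall>x. (S1 has_real_derivative (x\<^sup>2 - \<mu> i) * S i x) (at x)) \<and>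
      (AE x in lborel. \<phi> (fst i) (snd i) x = S i x)" by blast
  from bchoice[OF this] obtain S1 where SS: "\<forall>i\<in>I. (\<forall>x. (S i has_real_derivative S1 i x) (at x)) \<and>
      (\<forall>x. (S1 i has_real_derivative (x\<^sup>2 - \<mu> i) * S i x) (at x)) \<and>
      (AE x in lborel. \<phi> (fst i) (snd i) x = S i x)" by blast
  then have S: "\<And>i x. i \<in> I \<Longrightarrow> (S i has_real_derivative S1 i x) (at x)"
      "\<And>i x. i \<in> I \<Longrightarrow> (S1 i has_real_derivative (x\<^sup>2 - \<mu> i) * S i x) (at x)"
      "\<And>i. i \<in> I \<Longrightarrow> AE x in lborel. \<phi> (fst i) (snd i) x = S i x"
    by blast+
  have Sc: "continuous_on UNIV (S i)" "continuous_on UNIV (S1 i)" if "i \<in> I" for i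
    by (rule has_real_derivative_continuous[OF S(1)[OF that]],
        rule has_real_derivative_continuous[OF S(2)[OF that]])
  have Srep: "continuous_on UNIV (S (n, l)) \<and> (AE x in lborel. \<phi> n l x = S (n, l) x)" if "l < D n" for n l
    using Sc(1)[of "(n, l)"] S(3)[of "(n, l)"] that by (auto simp: I_def eigen_index_def)
  have c1: "continuous_on UNIV (\<lambda>x::real. 1::real)" by simp
  note exp = solution_expansion[OF c1 zero_less_one SA B u Srep,
      unfolded real_sqrt_one mult_1, folded I_def \<mu>_def]
  obtain u' g' where u': "u' \<in> borel_measurable borel" "AE z in lborel. u z = u' z"
    and sl: "slice_expansion I (eigen_level D) S \<mu> u' g'"
    using exp(1) by blast
  interpret slice_expansion I "eigen_level D" S \<mu> u' g' by (rule sl)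
  have ulim: "(\<lambda>k. sqnorm lborel (\<lambda>z. partial_sum S k z - u' z)) \<longlonglongrightarrow> 0"
    by (rule expansion_converges) (use exp(3) in blast)
  note ctrl = harmonic_controlled[OF on S(1,2)]
  define S2 where "S2 i x = (x\<^sup>2 - \<mu> i) * S i x" for i x
  obtain ux where ux: "ux \<in> Lq 2 lborel" "(\<lambda>k. sqnorm lborel (\<lambda>z. partial_sum S1 k z - ux z)) \<longlonglongrightarrow> 0"
    using controlled_limit[OF ctrl(1)] by auto
  obtain xux where xux: "xux \<in> Lq 2 lborel"
      "(\<lambda>k. sqnorm lborel (\<lambda>z. partial_sum (\<lambda>i x. x * S1 i x) k z - xux z)) \<longlonglongrightarrow> 0"
    using controlled_limit[OF ctrl(2)] by auto
  obtain xxu where xxu: "xxu \<in> Lq 2 lborel"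
      "(\<lambda>k. sqnorm lborel (\<lambda>z. partial_sum (\<lambda>i x. x\<^sup>2 * S i x) k z - xxu z)) \<longlonglongrightarrow> 0"
    using controlled_limit[OF ctrl(3)] by auto
  obtain uxx where uxx: "uxx \<in> Lq 2 lborel" "(\<lambda>k. sqnorm lborel (\<lambda>z. partial_sum S2 k z - uxx z)) \<longlonglongrightarrow> 0"
    using controlled_limit[OF ctrl(4)] unfolding S2_def[abs_def] by auto
  have dS: "S i differentiable (at x)" "S1 i = pd 1 (S i)" "S1 i differentiable (at x)" "S2 i = pd 1 (S1 i)"
    if "i \<in> I" for i x
    using S(1,2)[OF that] pd_real[OF S(1)[OF that]] pd_real[OF S(2)[OF that]]
    by (auto simp: real_differentiable_def S2_def)
  have S2c: "continuous_on UNIV (S2 i)" if "i \<in> I" for i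
    unfolding S2_def[abs_def] by (intro continuous_intros Sc that)
  have S2L: "S2 i \<in> Lq 2 lborel" if "i \<in> I" for i
    using controlledD[OF ctrl(4) that] unfolding S2_def[abs_def] .
  have mx [measurable]: "(fst :: real \<times> real \<Rightarrow> real) \<in> borel_measurable borel"
    by (intro borel_measurable_continuous_onI continuous_intros)
  have wd1: "(LINT z|lborel. u' z * pd (1, 0) \<psi> z) = - (LINT z|lborel. ux z * \<psi> z)"
    if "\<psi> \<in> test_fun" for \<psi>
    using weak_derivative_limit[of 1 S S1 "\<lambda>_. 1" u' ux \<psi>] dS Sc e_L2 controlledD[OF ctrl(1)] U ulim ux that
    by simp
  have wd2: "(LINT z|lborel. ux z * pd (1, 0) \<psi> z) = - (LINT z|lborel. uxx z * \<psi> z)"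
    if "\<psi> \<in> test_fun" for \<psi>
    using weak_derivative_limit[of 1 S1 S2 "\<lambda>_. 1" ux uxx \<psi>] dS Sc S2c S2L controlledD[OF ctrl(1)] ux uxx that
    by simp
  have uxb: "ux \<in> borel_measurable borel" "uxx \<in> borel_measurable borel"
    using ux uxx by (auto simp: Lq2_iff)
  have b10: "(1, 0) \<in> (Basis :: (real \<times> real) set)" by (simp add: Basis_prod_def)
  have h1: "has_weak_deriv (1, 0) u ux"
    by (rule has_weak_derivI[OF b10 u' uloc ux(1) wd1])
  have h2: "has_weak_deriv (1, 0) ux uxx"
    by (rule has_weak_derivI[OF b10 uxb(1) _ locally_integrable_L2[OF ux(1)] uxx(1) wd2]) simp
  have X2: "(\<lambda>z. (fst z)\<^sup>2 * u' z) \<in> Lq 2 lborel"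
  proof (rule L2_lim_mult[OF partial_sum_L2[OF e_L2] U ulim])
    have eq: "(\<lambda>z. (fst z)\<^sup>2 * partial_sum S k z) = partial_sum (\<lambda>i x. x\<^sup>2 * S i x) k" for k
      by (auto simp: partial_sum_def sum_distrib_left mult_ac)
    show "(\<lambda>z. (fst z)\<^sup>2 * partial_sum S k z) \<in> Lq 2 lborel" for k
      unfolding eq by (rule partial_sum_L2[OF controlledD[OF ctrl(3)]])
    show "(\<lambda>k. sqnorm lborel (\<lambda>z. (fst z)\<^sup>2 * partial_sum S k z - xxu z)) \<longlonglongrightarrow> 0"
      using xxu(2) unfolding fun_cong[OF eq, symmetric] .
  qed (use xxu in auto)
  have X1: "(\<lambda>z. fst z * ux z) \<in> Lq 2 lborel"
  proof (rule L2_lim_mult[OF partial_sum_L2[OF controlledD[OF ctrl(1)]] ux])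
    have eq: "(\<lambda>z. fst z * partial_sum S1 k z) = partial_sum (\<lambda>i x. x * S1 i x) k" for k
      by (auto simp: partial_sum_def sum_distrib_left mult_ac)
    show "(\<lambda>z. fst z * partial_sum S1 k z) \<in> Lq 2 lborel" for k
      unfolding eq by (rule partial_sum_L2[OF controlledD[OF ctrl(2)]])
    show "(\<lambda>k. sqnorm lborel (\<lambda>z. fst z * partial_sum S1 k z - xux z)) \<longlonglongrightarrow> 0"
      using xux(2) unfolding fun_cong[OF eq, symmetric] .
  qed (use xux in auto)
  have X0: "(\<lambda>z. fst z * u' z) \<in> Lq 2 lborel"
  proof -
    note u'(1)[measurable]
    have i: "integrable lborel (\<lambda>z. (u' z)\<^sup>2 + ((fst z)\<^sup>2 * u' z)\<^sup>2)"
      using U X2 by (intro Bochner_Integration.integrable_add) (auto simp: Lq2_iff)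
    have "(x * y)\<^sup>2 \<le> y\<^sup>2 + (x\<^sup>2 * y)\<^sup>2" for x y :: real
    proof -
      have "0 \<le> (1 - x\<^sup>2)\<^sup>2 * y\<^sup>2 + (1 + (x\<^sup>2)\<^sup>2) * y\<^sup>2" by simp
      also have "\<dots> = 2 * (y\<^sup>2 + (x\<^sup>2 * y)\<^sup>2 - (x * y)\<^sup>2)"
        by (simp add: power2_eq_square algebra_simps)
      finally show ?thesis by simp
    qed
    then have "integrable lborel (\<lambda>z. (fst z * u' z)\<^sup>2)"
      by (intro Bochner_Integration.integrable_bound[OF i]) auto
    moreover have "(\<lambda>z. fst z * u' z) \<in> borel_measurable borel" by measurable
    ultimately show ?thesis by (simp add: Lq2_iff)
  qed
  have transfer: "(\<lambda>(x, t). f x * v (x, t)) \<in> Lq 2 lebesgue"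
    if "(\<lambda>z. f (fst z) * v' z) \<in> Lq 2 lborel" "AE z in lborel. v z = v' z"
    for v v' :: "real \<times> real \<Rightarrow> real" and f
  proof -
    have "(\<lambda>z. f (fst z) * v' z) \<in> borel_measurable borel"
      using that(1) by (simp add: Lq2_iff)
    moreover have "AE z in lborel. (\<lambda>(x, t). f x * v (x, t)) z = f (fst z) * v' z"
      using that(2) by eventually_elim (simp add: split_beta)
    ultimately show ?thesis using Lq2_lebesgue_iff that(1) by blast
  qed
  show "(\<lambda>(x, t). x * u (x, t)) \<in> Lq 2 lebesgue" by (rule transfer[OF X0 u'(2)])
  show "(\<lambda>(x, t). x\<^sup>2 * u (x, t)) \<in> Lq 2 lebesgue" by (rule transfer[OF X2 u'(2)])
  have "(\<lambda>(x, t). x * ux (x, t)) \<in> Lq 2 lebesgue" by (rule transfer[OF X1]) simp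
  moreover have "ux \<in> Lq 2 lebesgue" "uxx \<in> Lq 2 lebesgue"
    using ux uxx uxb Lq2_lebesgue_iff[of ux ux] Lq2_lebesgue_iff[of uxx uxx] by auto
  ultimately show "\<exists>ux uxx. has_weak_deriv (1, 0) u ux \<and> has_weak_deriv (1, 0) ux uxx \<and>
       ux \<in> Lq 2 lebesgue \<and> (\<lambda>(x, t). x * ux (x, t)) \<in> Lq 2 lebesgue \<and> uxx \<in> Lq 2 lebesgue"
    using h1 h2 by blast
qed

section \<open>The conformal Laplacian: regularity of solutions\<close>

text \<open>Symmetry of \<open>A\<close>, applied to an eigenfunction and a test function, on which \<open>A\<close> acts as the
  differential expression.\<close>

lemma eigenfunction_weak_equation:
  fixes V \<phi> S :: "'a::euclidean_space \<Rightarrow> real"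
  assumes T: "self_adjoint (weighted V) A" and V: "continuous_on UNIV V" "\<And>x. 0 < V x"
    and M: "(\<psi>, \<lambda>x. (- laplacian \<psi> x + V x * \<psi> x) / V x) \<in> A"
    and \<phi>: "(\<phi>, \<lambda>x. \<kappa> * \<phi> x) \<in> A" "AE x in lborel. \<phi> x = S x" "continuous_on UNIV S"
    and \<psi>: "\<psi> \<in> test_fun"
  shows "(LINT x|lborel. S x * (- laplacian \<psi> x + V x * \<psi> x)) = \<kappa> * (LINT x|lborel. V x * S x * \<psi> x)"
proof -
  define L where "L x = - laplacian \<psi> x + V x * \<psi> x" for x
  have Vnz: "V x \<noteq> 0" for x using V(2)[of x] by simp
  have VV: "sqrt (V x) * y * (sqrt (V x) * z) = V x * (y * z)" for x y z
  proof -
    have "sqrt (V x) * sqrt (V x) = V x" using V(2)[of x] by simp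
    then show ?thesis by (metis mult.assoc mult.left_commute)
  qed
  have c\<psi>: "continuous_on UNIV \<psi>" by (rule smooth_continuous[OF test_fun_smooth[OF \<psi>]])
  have pp: "continuous_on UNIV (pd b (pd b \<psi>))" if "b \<in> Basis" for b
    by (rule smooth_continuous[OF test_fun_smooth[OF test_fun_pd[OF test_fun_pd[OF \<psi> that] that]]])
  have cL: "continuous_on UNIV L"
    unfolding L_def[abs_def] laplacian_def by (intro continuous_intros V c\<psi> pp)
  have cLV: "continuous_on UNIV (\<lambda>x. L x / V x)"
    using Vnz by (intro continuous_intros cL V) auto
  have b: "(\<lambda>x. L x / V x) \<in> borel_measurable borel" "S \<in> borel_measurable borel"
      "\<psi> \<in> borel_measurable borel" "(\<lambda>x. \<kappa> * S x) \<in> borel_measurable borel"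
    using cLV \<phi>(3) c\<psi> by (auto intro!: borel_measurable_continuous_onI continuous_intros)
  have "L2_inner (weighted V) (\<lambda>x. L x / V x) \<phi> = L2_inner (weighted V) \<psi> (\<lambda>x. \<kappa> * \<phi> x)"
    using self_adjoint_sym[OF T M \<phi>(1)] by (simp add: L_def)
  moreover have "L2_inner (weighted V) (\<lambda>x. L x / V x) \<phi> = (LINT x|lborel. V x * (L x / V x * S x))"
    using L2_inner_weighted[OF V _ b(1) \<phi>(2) b(2), of "\<lambda>x. L x / V x"] by (simp add: L2_inner_def VV)
  moreover have "V x * (L x / V x * S x) = S x * L x" for x using Vnz by simp
  moreover have "L2_inner (weighted V) \<psi> (\<lambda>x. \<kappa> * \<phi> x) = (LINT x|lborel. V x * (\<psi> x * (\<kappa> * S x)))"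
  proof -
    have "AE x in lborel. \<kappa> * \<phi> x = \<kappa> * S x" using \<phi>(2) by eventually_elim simp
    from L2_inner_weighted[OF V _ b(3) this b(4), of \<psi>] show ?thesis by (simp add: L2_inner_def VV)
  qed
  moreover have "V x * (\<psi> x * (\<kappa> * S x)) = \<kappa> * (V x * S x * \<psi> x)" for x by (simp add: mult_ac)
  ultimately show ?thesis by (simp add: L_def)
qed

text \<open>The energy of a combination is bounded by the inner product of \<open>G\<close> and \<open>F\<close>, which orthonormality
  evaluates to \<open>\<Sum> \<mu>\<^sup>2 c\<^sup>2\<close>.\<close>

lemma gradient_controlled:
  fixes V :: "'a::euclidean_space \<Rightarrow> real" and S :: "'i \<Rightarrow> 'a \<Rightarrow> real"
  assumes dim: "DIM('a) = 2 * m + 2" and V: "continuous_on UNIV V" "\<And>x. 0 < V x"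
    and on: "orthonormal lborel I (\<lambda>i x. sqrt (V x) * S i x)"
    and S: "\<And>i. i \<in> I \<Longrightarrow> tame m (S i)"
    and weak: "\<And>i \<psi>. i \<in> I \<Longrightarrow> \<psi> \<in> test_fun \<Longrightarrow>
      (LINT x|lborel. S i x * (- laplacian \<psi> x + V x * \<psi> x)) = (\<mu> i)\<^sup>2 * (LINT x|lborel. V x * S i x * \<psi> x)"
    and b: "b \<in> Basis"
  shows "controlled I \<mu> 1 (\<lambda>i. pd b (S i))"
proof -
  have sS: "smooth (S i)" if "i \<in> I" for i using S[OF that] by (simp add: tame_def)
  have eL: "(\<lambda>x. sqrt (V x) * S i x) \<in> Lq 2 lborel" if "i \<in> I" for i
    using on that by (simp add: orthonormal_def)
  have main: "(\<lambda>x. \<Sum>i\<in>L. c i * pd b (S i) x) \<in> Lq 2 lborel \<and>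
      sqnorm lborel (\<lambda>x. \<Sum>i\<in>L. c i * pd b (S i) x) \<le> 1 * (\<Sum>i\<in>L. (1 + (\<mu> i)\<^sup>2) * (c i)\<^sup>2)"
    if L: "finite L" "L \<subseteq> I" for L c
  proof -
    have iI: "i \<in> I" if "i \<in> L" for i using L that by auto
    define F where "F x = (\<Sum>i\<in>L. c i * S i x)" for x
    define G where "G x = (\<Sum>i\<in>L. (c i * (\<mu> i)\<^sup>2) * S i x)" for x
    have F: "tame m F" unfolding F_def[abs_def] using S iI by (intro tame_sum L) auto
    have Gc: "continuous_on UNIV G"
      unfolding G_def[abs_def] using smooth_continuous[OF sS] iI by (intro continuous_intros) auto
    have FS: "(\<lambda>x. sqrt (V x) * F x) = (\<lambda>x. \<Sum>i\<in>L. c i * (sqrt (V x) * S i x))"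
      "(\<lambda>x. sqrt (V x) * G x) = (\<lambda>x. \<Sum>i\<in>L. (c i * (\<mu> i)\<^sup>2) * (sqrt (V x) * S i x))"
      by (auto simp: F_def G_def sum_distrib_left mult_ac)
    have FL: "(\<lambda>x. sqrt (V x) * F x) \<in> Lq 2 lborel" "(\<lambda>x. sqrt (V x) * G x) \<in> Lq 2 lborel"
      unfolding FS using eL iI by (intro Lq2_sum Lq2_scale; blast)+
    have wF: "(LINT x|lborel. F x * (- laplacian \<psi> x + V x * \<psi> x)) = (LINT x|lborel. V x * G x * \<psi> x)"
      if \<psi>: "\<psi> \<in> test_fun" for \<psi>
    proof -
      have c\<psi>: "continuous_on UNIV \<psi>" by (rule smooth_continuous[OF test_fun_smooth[OF \<psi>]])
      have i2: "integrable lborel (\<lambda>x. V x * S i x * \<psi> x)" if "i \<in> L" for i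
        using iI[OF that] smooth_continuous[OF sS]
        by (intro integrable_continuous_bounded_support continuous_intros c\<psi> V
            bounded_subset[OF test_fun_bounded[OF \<psi>]]) auto
      have i1: "integrable lborel (\<lambda>x. S i x * (- laplacian \<psi> x + V x * \<psi> x))" if "i \<in> L" for i
      proof -
        have ci: "continuous_on UNIV (S i)" by (rule smooth_continuous[OF sS[OF iI[OF that]]])
        have "integrable lborel (\<lambda>x. S i x * pd b (pd b \<psi>) x)" if "b \<in> Basis" for b
          using test_fun_pd[OF test_fun_pd[OF \<psi> that] that]
          by (intro integrable_continuous_bounded_support continuous_intros ci
              smooth_continuous test_fun_smooth bounded_subset[OF test_fun_bounded[of "pd b (pd b \<psi>)"]]) auto
        then have "integrable lborel (\<lambda>x. V x * S i x * \<psi> x - (\<Sum>b\<in>Basis. S i x * pd b (pd b \<psi>) x))"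
          using i2[OF \<open>i \<in> L\<close>] by (intro Bochner_Integration.integrable_diff Bochner_Integration.integrable_sum) auto
        then show ?thesis by (simp add: laplacian_def algebra_simps sum_distrib_left)
      qed
      have "(LINT x|lborel. F x * (- laplacian \<psi> x + V x * \<psi> x))
          = (LINT x|lborel. (\<Sum>i\<in>L. c i * (S i x * (- laplacian \<psi> x + V x * \<psi> x))))"
        by (simp add: F_def sum_distrib_right mult.assoc)
      also have "\<dots> = (\<Sum>i\<in>L. c i * (LINT x|lborel. S i x * (- laplacian \<psi> x + V x * \<psi> x)))"
        using i1 by simp
      also have "\<dots> = (\<Sum>i\<in>L. c i * ((\<mu> i)\<^sup>2 * (LINT x|lborel. V x * S i x * \<psi> x)))"
        using weak[OF iI \<psi>] by simp
      also have "\<dots> = (LINT x|lborel. (\<Sum>i\<in>L. c i * ((\<mu> i)\<^sup>2 * (V x * S i x * \<psi> x))))"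
        using i2 by simp
      also have "\<dots> = (LINT x|lborel. V x * G x * \<psi> x)"
        by (simp add: G_def sum_distrib_left sum_distrib_right mult_ac)
      finally show ?thesis .
    qed
    have "pd b F x = (\<Sum>i\<in>L. pd b (\<lambda>x. c i * S i x) x)" for x
      unfolding F_def[abs_def] using sS iI
      by (intro pd_sum smooth_differentiable smooth_mult smooth_const) auto
    moreover have "pd b (\<lambda>x. c i * S i x) x = c i * pd b (S i) x" if "i \<in> L" for i x
      using pd_mult[of "\<lambda>_. c i" x "S i" b] smooth_differentiable[OF sS[OF iI[OF that]]]
      by (simp add: pd_const)
    ultimately have pF: "pd b F = (\<lambda>x. \<Sum>i\<in>L. c i * pd b (S i) x)" by auto
    note E = dirichlet_energy[OF dim F Gc V FL wF b]
    have "sqnorm lborel (pd b F) \<le> (\<Sum>i\<in>L. c i * (\<mu> i)\<^sup>2 * c i)"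
      using E(2) unfolding FS orthonormal_comb_sqnorm[OF on L] .
    also have "\<dots> \<le> (\<Sum>i\<in>L. (1 + (\<mu> i)\<^sup>2) * (c i)\<^sup>2)"
      by (intro sum_mono) (simp add: power2_eq_square algebra_simps)
    finally show ?thesis using E(1) unfolding pF by simp
  qed
  have one: "(\<Sum>i\<in>{i}. 1 * T i) = (T i :: real)" for i :: 'i and T by simp
  show ?thesis
    unfolding controlled_def using main main[of "{i}" "\<lambda>_. 1" for i, unfolded one] by auto
qed

text \<open>The dimension is written as \<open>2 m + 2\<close> because \<open>m\<close> is the exponent of the conformal factor in the lifts;
  it is a natural number precisely for even dimensions. The gradient is bounded in the unweighted
  space, and \<open>d\<close> is bounded from above.\<close>

theorem conformal_regularity:
  fixes V :: "'a::euclidean_space \<Rightarrow> real" and u :: "'a \<times> real \<Rightarrow> real"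
  assumes dim: "DIM('a) = 2 * m + 2"
    and SA: "standing_assumptions M V Vt d dt A \<nu> D \<phi> \<alpha>"
    and B: "is_sqrt_op (weighted V) A B"
    and u: "admissible_solution \<alpha> p V Vt d dt B u"
    and V: "V = (\<lambda>x. 1 / ((norm x)\<^sup>2 + 1)\<^sup>2)"
    and M: "M = (\<lambda>\<psi> x. - laplacian \<psi> x + V x * \<psi> x)"
    and A: "stereographic_spectrum A \<nu>"
  shows "\<exists>ut. has_weak_deriv (0, 1) u ut \<and> ut \<in> Lq 2 (mV V)"
    "\<forall>b\<in>Basis. \<exists>w. has_weak_deriv (b, 0) u w \<and> w \<in> Lq 2 (md d)"
proof -
  show "\<exists>ut. has_weak_deriv (0, 1) u ut \<and> ut \<in> Lq 2 (mV V)"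
    by (rule admissible_solution_time_derivative(1)[OF u])
  note uloc = admissible_solution_time_derivative(2)[OF u]
  have A1: "A1 M V A \<nu> D \<phi>" using SA by (simp add: standing_assumptions_def)
  have d: "d \<in> borel_measurable lebesgue" "\<And>t. 0 \<le> d t"
    using SA by (auto simp: standing_assumptions_def)
  obtain \<Delta> where \<Delta>: "AE t in lebesgue. \<bar>d t\<bar> \<le> \<Delta>"
    using SA by (auto simp: standing_assumptions_def A4_def Linf_def)
  have Vst: "V = stereo_weight" using V by (auto simp: stereo_weight_def)
  have nz: "(norm x)\<^sup>2 + 1 > 0" for x :: 'a by (simp add: add_nonneg_pos)
  have Vpos: "0 < V x" for x using nz[of x] by (simp add: V)
  have Vc: "continuous_on UNIV V"
    unfolding V using nz by (intro continuous_intros) (auto simp: less_imp_neq[symmetric])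
  have Vl: "V \<in> borel_measurable lebesgue" using SA by (simp add: standing_assumptions_def)
  define I where "I = eigen_index D"
  define \<mu> where "\<mu> = (\<lambda>(n, l :: nat). sqrt (\<nu> n))"
  have \<mu>2: "(\<mu> (n, l))\<^sup>2 = \<nu> n" for n l
    using A by (simp add: \<mu>_def stereographic_spectrum_def)
  have \<phi>A: "(\<phi> n l, \<lambda>x. \<nu> n * \<phi> n l x) \<in> A" "\<phi> n l \<in> eigenspace (weighted V) A (\<nu> n)" if "l < D n" for n l
    using A1 that by (auto simp: A1_def eigenspace_def)
  have "\<forall>i\<in>I. \<exists>Y. real_polynomial_function Y \<and> (AE x in lborel. \<phi> (fst i) (snd i) x = stereo_lift Y x)"
  proof
    fix i assume "i \<in> I"
    then obtain n l where i: "i = (n, l)" "l < D n" by (auto simp: I_def eigen_index_def)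
    have "eigenspace (weighted V) A (\<nu> n) = {f \<in> Lq 2 (weighted V).
        \<exists>Y\<in>solid_harmonics n. AE x in weighted V. f x = stereo_lift Y x}"
      using A unfolding stereographic_spectrum_def Vst by blast
    then obtain Y where "Y \<in> solid_harmonics n" "AE x in weighted V. \<phi> n l x = stereo_lift Y x"
      using \<phi>A(2)[OF i(2)] by blast
    then show "\<exists>Y. real_polynomial_function Y \<and> (AE x in lborel. \<phi> (fst i) (snd i) x = stereo_lift Y x)"
      unfolding AE_weighted_iff[OF Vl Vpos] using i by (auto simp: solid_harmonics_def)
  qed
  from bchoice[OF this] obtain Y
    where Y: "\<forall>i\<in>I. real_polynomial_function (Y i) \<and> (AE x in lborel. \<phi> (fst i) (snd i) x = stereo_lift (Y i) x)"
    by blast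
  define S where "S i = (stereo_lift (Y i) :: 'a \<Rightarrow> real)" for i
  have tS: "tame m (S i)" if "i \<in> I" for i
    unfolding S_def using Y that by (intro tame_stereo_lift[OF dim]) auto
  have sS: "smooth (S i)" if "i \<in> I" for i using tS[OF that] by (simp add: tame_def)
  have Srep: "continuous_on UNIV (S (n, l)) \<and> (AE x in lborel. \<phi> n l x = S (n, l) x)" if "l < D n" for n l
  proof -
    have i: "(n, l) \<in> I" using that by (simp add: I_def eigen_index_def)
    then show ?thesis using smooth_continuous[OF sS[OF i]] Y by (auto simp: S_def)
  qed
  note exp = solution_expansion[OF Vc Vpos SA B u Srep, folded I_def \<mu>_def]
  have weak: "(LINT x|lborel. S i x * (- laplacian \<psi> x + V x * \<psi> x)) = (\<mu> i)\<^sup>2 * (LINT x|lborel. V x * S i x * \<psi> x)"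
    if iI: "i \<in> I" and \<psi>: "\<psi> \<in> test_fun" for i \<psi>
  proof -
    obtain n l where i: "i = (n, l)" "l < D n" using iI by (auto simp: I_def eigen_index_def)
    have T: "self_adjoint (weighted V) A" using A1 by (simp add: A1_def)
    have "(\<psi>, \<lambda>x. (- laplacian \<psi> x + V x * \<psi> x) / V x) \<in> A"
      using A1 \<psi> M by (auto simp: A1_def)
    then show ?thesis
      using eigenfunction_weak_equation[OF T Vc Vpos _ \<phi>A(1)[OF i(2)] _ _ \<psi>] Srep[OF i(2)] \<mu>2[of n l] i
      by simp
  qed
  obtain u' g' where u': "u' \<in> borel_measurable borel" "AE z in lborel. u z = u' z"
    and sl: "slice_expansion I (eigen_level D) (\<lambda>i x. sqrt (V x) * S i x) \<mu> (\<lambda>z. sqrt (V (fst z)) * u' z) g'"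
    using exp(1) by blast
  interpret slice_expansion I "eigen_level D" "\<lambda>i x. sqrt (V x) * S i x" \<mu> "\<lambda>z. sqrt (V (fst z)) * u' z" g'
    by (rule sl)
  have ulim: "(\<lambda>k. sqnorm lborel (\<lambda>z. partial_sum (\<lambda>i x. sqrt (V x) * S i x) k z - sqrt (V (fst z)) * u' z)) \<longlonglongrightarrow> 0"
    by (rule expansion_converges) (use exp(3) in blast)
  show "\<forall>b\<in>Basis. \<exists>w. has_weak_deriv (b, 0) u w \<and> w \<in> Lq 2 (md d)"
  proof
    fix b :: 'a assume b: "b \<in> Basis"
    note ctrl = gradient_controlled[OF dim Vc Vpos on tS weak b]
    obtain w where w: "w \<in> Lq 2 lborel"
        "(\<lambda>k. sqnorm lborel (\<lambda>z. partial_sum (\<lambda>i. pd b (S i)) k z - w z)) \<longlonglongrightarrow> 0"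
      using controlled_limit[OF ctrl] by auto
    have b0: "(b, 0) \<in> (Basis :: ('a \<times> real) set)" using b by (simp add: Basis_prod_def)
    have "has_weak_deriv (b, 0) u w"
    proof (rule has_weak_derivI[OF b0 u' uloc w(1)])
      fix \<psi> :: "'a \<times> real \<Rightarrow> real" assume \<psi>: "\<psi> \<in> test_fun"
      have "(LINT z|lborel. sqrt (V (fst z)) * u' z / sqrt (V (fst z)) * pd (b, 0) \<psi> z)
          = - (LINT z|lborel. w z * \<psi> z)"
      proof (rule weak_derivative_limit[OF b _ _ _ _ _ _ _ U ulim w \<psi>])
        show "continuous_on UNIV (\<lambda>x. sqrt (V x))" by (intro continuous_intros Vc)
        show "pd b (S i) \<in> Lq 2 lborel" if "i \<in> I" for i by (rule controlledD[OF ctrl that])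
      qed (use e_L2 Vpos smooth_differentiable[OF sS] smooth_continuous[OF smooth_pd[OF sS b]] in auto)
      moreover have "sqrt (V (fst z)) * u' z / sqrt (V (fst z)) = u' z" for z
        using Vpos[of "fst z"] by simp
      ultimately show "(LINT z|lborel. u' z * pd (b, 0) \<psi> z) = - (LINT z|lborel. w z * \<psi> z)" by simp
    qed
    moreover have "w \<in> Lq 2 (md d)"
    proof -
      have wb: "w \<in> borel_measurable borel" using w by (simp add: Lq2_iff)
      have wl: "w \<in> borel_measurable lebesgue" using wb by (simp add: measurable_completion)
      have dl: "(\<lambda>(x :: 'a, t). d t) \<in> borel_measurable lebesgue"
        using lebesgue_measurable_snd[OF d(1)] by (simp add: case_prod_beta')
      have "integrable lebesgue (\<lambda>z. (w z)\<^sup>2)"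
        using w(1) by (subst integrable_completion) (auto simp: Lq2_iff)
      then have wi: "integrable lebesgue (\<lambda>z. \<Delta> * (w z)\<^sup>2)"
        by (rule integrable_mult_right)
      have "integrable lebesgue (\<lambda>z. (\<lambda>(x, t). d t) z * (w z)\<^sup>2)"
      proof (rule Bochner_Integration.integrable_bound[OF wi])
        show "(\<lambda>z. (\<lambda>(x, t). d t) z * (w z)\<^sup>2) \<in> borel_measurable lebesgue"
          using dl wl by (intro borel_measurable_times borel_measurable_power)
        have "AE z :: 'a \<times> real in lborel. \<bar>d (snd z)\<bar> \<le> \<Delta>"
          using AE_snd[of "\<lambda>t. \<bar>d t\<bar> \<le> \<Delta>"] \<Delta> by (simp add: AE_lebesgue_iff)
        then show "AE z in lebesgue. norm ((\<lambda>(x, t). d t) z * (w z)\<^sup>2) \<le> norm (\<Delta> * (w z)\<^sup>2)"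
          unfolding AE_lebesgue_iff
          by eventually_elim (auto simp: abs_mult split_beta intro!: mult_right_mono)
      qed
      then show ?thesis
        unfolding md_def using Lq2_weighted_iff[OF dl, of w] d(2) wl by auto
    qed
    ultimately show "\<exists>w. has_weak_deriv (b, 0) u w \<and> w \<in> Lq 2 (md d)" by blast
  qed
qed

theorem theorem1p12:
  fixes d dt :: "real \<Rightarrow> real" and \<alpha> p :: real
    and \<nu> :: "nat \<Rightarrow> real" and D :: "nat \<Rightarrow> nat"
  shows
    "(\<forall>(V :: real \<Rightarrow> real) Vt M A B \<phi> u.
        standing_assumptions M V Vt d dt A \<nu> D \<phi> \<alpha> \<and>
        is_sqrt_op (weighted V) A B \<and>
        admissible_solution \<alpha> p V Vt d dt B u \<and>
        V = (\<lambda>x. 1) \<and>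
        M = (\<lambda>\<psi>. harmonic_expr (harmonic_expr \<psi>)) \<and>
        A = harmonic_oscillator O harmonic_oscillator
        \<longrightarrow>
        (\<exists>ut. has_weak_deriv (0, 1) u ut \<and> ut \<in> Lq 2 lebesgue) \<and>
        (\<lambda>(x, t). x * u (x, t)) \<in> Lq 2 lebesgue \<and>
        (\<lambda>(x, t). x\<^sup>2 * u (x, t)) \<in> Lq 2 lebesgue \<and>
        (\<exists>ux uxx. has_weak_deriv (1, 0) u ux \<and> has_weak_deriv (1, 0) ux uxx \<and>
           ux \<in> Lq 2 lebesgue \<and> (\<lambda>(x, t). x * ux (x, t)) \<in> Lq 2 lebesgue \<and>
           uxx \<in> Lq 2 lebesgue))
     \<and>
     (\<forall>(V :: real ^ 'n \<Rightarrow> real) Vt M A B \<phi> u.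
        standing_assumptions M V Vt d dt A \<nu> D \<phi> \<alpha> \<and>
        is_sqrt_op (weighted V) A B \<and>
        admissible_solution \<alpha> p V Vt d dt B u \<and>
        CARD('n) \<ge> 2 \<and> even CARD('n) \<and>
        V = (\<lambda>x. 1 / ((norm x)\<^sup>2 + 1)\<^sup>2) \<and>
        M = (\<lambda>\<psi> x. - laplacian \<psi> x + V x * \<psi> x) \<and>
        stereographic_spectrum A \<nu>
        \<longrightarrow>
        (\<exists>ut. has_weak_deriv (0, 1) u ut \<and> ut \<in> Lq 2 (mV V)) \<and>
        (\<forall>b\<in>Basis. \<exists>w. has_weak_deriv (b, 0) u w \<and> w \<in> Lq 2 (md d)))"
proof (rule conjI; (intro allI impI; elim conjE))
  fix V Vt :: "real \<Rightarrow> real" and M A B \<phi> u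
  assume *: "standing_assumptions M V Vt d dt A \<nu> D \<phi> \<alpha>" "is_sqrt_op (weighted V) A B"
    "admissible_solution \<alpha> p V Vt d dt B u" "V = (\<lambda>x. 1)" "A = harmonic_oscillator O harmonic_oscillator"
  note r = oscillator_regularity[OF *(1-3)[unfolded *(4)] *(5)]
  show "(\<exists>ut. has_weak_deriv (0, 1) u ut \<and> ut \<in> Lq 2 lebesgue) \<and>
        (\<lambda>(x, t). x * u (x, t)) \<in> Lq 2 lebesgue \<and>
        (\<lambda>(x, t). x\<^sup>2 * u (x, t)) \<in> Lq 2 lebesgue \<and>
        (\<exists>ux uxx. has_weak_deriv (1, 0) u ux \<and> has_weak_deriv (1, 0) ux uxx \<and>
           ux \<in> Lq 2 lebesgue \<and> (\<lambda>(x, t). x * ux (x, t)) \<in> Lq 2 lebesgue \<and>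
           uxx \<in> Lq 2 lebesgue)"
    by (intro conjI r)
next
  fix V Vt :: "real ^ 'n \<Rightarrow> real" and M A B \<phi> u
  assume *: "standing_assumptions M V Vt d dt A \<nu> D \<phi> \<alpha>" "is_sqrt_op (weighted V) A B"
    "admissible_solution \<alpha> p V Vt d dt B u" and card: "2 \<le> CARD('n)" "even CARD('n)"
    and V: "V = (\<lambda>x. 1 / ((norm x)\<^sup>2 + 1)\<^sup>2)" "M = (\<lambda>\<psi> x. - laplacian \<psi> x + V x * \<psi> x)"
      "stereographic_spectrum A \<nu>"
  obtain k where "CARD('n) = 2 * k" using card(2) by (rule evenE)
  then have dim: "DIM(real ^ 'n) = 2 * (k - 1) + 2" using card(1) by (cases k) auto
  show "(\<exists>ut. has_weak_deriv (0, 1) u ut \<and> ut \<in> Lq 2 (mV V)) \<and>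
        (\<forall>b\<in>Basis. \<exists>w. has_weak_deriv (b, 0) u w \<and> w \<in> Lq 2 (md d))"
    by (intro conjI conformal_regularity[OF dim * V])
qed

end
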